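(* Let $2\le k<n$, $\Omega\subset\mathbb{R}^n$ open, $V$ a distribution of $k$-planes on $\Omega$ spanned by $v=v_1\wedge\dots\wedge v_k$ with $v_i$ $C^1$ vectorfields. Let $T=v\mu$ be a normal $k$-current on $\Omega$ tangent to $V$ ($\mu$ a finite signed measure) with $\partial T=\tau'\mu'$ ($\mu'$ finite positive), and let $\mu'=\mu'_a+\mu'_s$ be the Lebesgue decomposition of $\mu'$ with respect to $|\mu|$. Then (i) $\mathrm{span}(\tau'(x))\subset V(x)$ for $\mu'_s$-a.e. $x$; (ii) $\mathrm{span}(\tau'(x))+V(x)=\widehat V(x)$ for $\mu'_a$-a.e. $x$.
   Context: A normal current has $T$ and $\partial T$ of finite mass. For an $h$-vector $u$, $\mathrm{span}(u)$ is the smallest subspace $Z$ of $\mathbb{R}^n$ with $u\in\Lambda_h(Z)$. $[w,w']=\mathrm{d}w(w')-\mathrm{d}w'(w)$ is the Lie bracket. $\widehat V(x):=V(x)+\mathrm{span}\{[w,w'](x): w,w'\ C^1\text{ vectorfields on }\Omega\text{ with } w(y),w'(y)\in V(y)\ \forall y\}$. $|\mu|$ is the total variation of $\mu$. *)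

theory Defs
  imports "HOL-Analysis.Analysis"
begin

(* Points of R^n: real^'n, with 'n a finite index type, n = CARD('n).
   h-vectors / h-covectors: alternating real tensors, given by their components
   on h-tuples (lists of length h) of coordinate indices. *)

type_synonym 'n mvec = "'n list \<Rightarrow> real"

definition alternating :: "nat \<Rightarrow> 'n mvec \<Rightarrow> bool" where
  "alternating h u \<longleftrightarrow>
     (\<forall>is. length is \<noteq> h \<longrightarrow> u is = 0) \<and>
     (\<forall>is a b. a < b \<and> b < length is \<longrightarrow> u (is[a := is ! b, b := is ! a]) = - u is)"

(* w 0 \<and> ... \<and> w (h-1): components are the h x h minors (Leibniz formula) *)
definition wedge :: "nat \<Rightarrow> (nat \<Rightarrow> real^'n::finite) \<Rightarrow> 'n mvec" where
  "wedge h w = (\<lambda>is. if length is = h then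
      (\<Sum>p | p permutes {..<h}. of_int (sign p) * (\<Prod>a<h. w a $ (is ! p a))) else 0)"

definition Lambda_h :: "nat \<Rightarrow> (real^'n::finite) set \<Rightarrow> 'n mvec set" where
  "Lambda_h h Z = {u. \<exists>(m::nat) c w. (\<forall>j<m. \<forall>i<h. w j i \<in> Z) \<and>
                            u = (\<lambda>is. \<Sum>j<m. c j * wedge h (w j) is)}"

definition mvspan :: "nat \<Rightarrow> 'n mvec \<Rightarrow> (real^'n) set" where
  "mvspan h u = \<Inter>{Z. subspace Z \<and> u \<in> Lambda_h h Z}"

definition pair :: "nat \<Rightarrow> 'n::finite mvec \<Rightarrow> 'n mvec \<Rightarrow> real" where
  "pair h a b = (\<Sum>is \<in> {is. length is = h}. a is * b is)"

definition mvnorm :: "nat \<Rightarrow> 'n::finite mvec \<Rightarrow> real" where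
  "mvnorm h u = sqrt (\<Sum>is \<in> {is. length is = h}. (u is)\<^sup>2)"

definition partial :: "'n \<Rightarrow> (real^'n \<Rightarrow> real) \<Rightarrow> real^'n \<Rightarrow> real" where
  "partial j f x = frechet_derivative f (at x) (axis j 1)"

fun iter_partial :: "'n list \<Rightarrow> (real^'n \<Rightarrow> real) \<Rightarrow> real^'n \<Rightarrow> real" where
  "iter_partial [] f = f"
| "iter_partial (j # js) f = partial j (iter_partial js f)"

definition smooth :: "(real^'n \<Rightarrow> real) \<Rightarrow> bool" where
  "smooth f \<longleftrightarrow> (\<forall>js. iter_partial js f differentiable_on UNIV)"

definition test_form :: "(real^'n) set \<Rightarrow> nat \<Rightarrow> (real^'n \<Rightarrow> 'n mvec) \<Rightarrow> bool" where
  "test_form \<Omega> h \<phi> \<longleftrightarrow>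
     (\<forall>x. alternating h (\<phi> x)) \<and> (\<forall>is. smooth (\<lambda>x. \<phi> x is)) \<and>
     compact (closure {x. \<exists>is. \<phi> x is \<noteq> 0}) \<and> closure {x. \<exists>is. \<phi> x is \<noteq> 0} \<subseteq> \<Omega>"

definition dform :: "nat \<Rightarrow> (real^'n \<Rightarrow> 'n mvec) \<Rightarrow> real^'n \<Rightarrow> 'n mvec" where
  "dform h \<phi> x = (\<lambda>is. if length is = h then
      (\<Sum>a<h. (-1) ^ a * partial (is ! a) (\<lambda>y. \<phi> y (take a is @ drop (Suc a) is)) x) else 0)"

definition C1_on :: "(real^'n) set \<Rightarrow> (real^'n \<Rightarrow> real^'n) \<Rightarrow> bool" where
  "C1_on \<Omega> w \<longleftrightarrow> (\<forall>x\<in>\<Omega>. w differentiable (at x)) \<and>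
     (\<forall>b\<in>Basis. continuous_on \<Omega> (\<lambda>x. frechet_derivative w (at x) b))"

definition lie :: "(real^'n \<Rightarrow> real^'n) \<Rightarrow> (real^'n \<Rightarrow> real^'n) \<Rightarrow> real^'n \<Rightarrow> real^'n" where
  "lie w w' x = frechet_derivative w (at x) (w' x) - frechet_derivative w' (at x) (w x)"

definition Vhat :: "(real^'n) set \<Rightarrow> (real^'n \<Rightarrow> (real^'n) set) \<Rightarrow> real^'n \<Rightarrow> (real^'n) set" where
  "Vhat \<Omega> V x = {a + b | a b. a \<in> V x \<and> b \<in> span {lie w w' x | w w'.
       C1_on \<Omega> w \<and> C1_on \<Omega> w' \<and> (\<forall>y\<in>\<Omega>. w y \<in> V y \<and> w' y \<in> V y)}}"

end

theory Submission
  imports Defs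
begin

text \<open>
  Let $\omega$ be a $C^1$ form of degree one annihilating $V$. Testing the boundary identity on
  $\omega\wedge\psi$ kills every derivative of $\psi$, because $v$ is tangent to $V$, and leaves an identity
  of measures: the contraction of $\tau'$ with $\omega$ times $\mu'$ equals, up to a constant, the contraction of
  $v$ with $\mathrm{d}\omega$ times $\mu$. Hence the first contraction vanishes $\mu'_s$-almost everywhere, and
  $\mu'_a$-almost everywhere it is a nonzero multiple of the second one, by a factor not depending on $\omega$.
  Since $\mathrm{d}\omega(w, w') = -\omega([w, w'])$ for fields $w, w'$ tangent to $V$, the span of $\tau'$ and the
  space of brackets have the same projection onto the orthogonal complement of $V$. The forms $\omega$ are the
  rows of that projection, which is $C^1$ by Gram--Schmidt. As they are only $C^1$, the boundary identity
  is first extended from smooth to $C^1$ test functions by mollification.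
\<close>

section \<open>Alternating tensors\<close>

text \<open>\<open>mvspan\<close> is an intersection over all admissible subspaces; it is first
  rewritten as the span of the slices of tau', the vectors left after fixing all but one index. With
  k = m + 2 these slices, and the contractions of v with d omega, are indexed by tuples of length m,
  so finitely many null sets suffice. \<open>Vhat\<close> in contrast runs over uncountably many
  fields. At a given point, however, the projected bracket depends only on the values of the two
  fields, bilinearly, so the brackets of the v_i generate it. One gap remains: a contraction mixes
  all pairs of the v_i, with products of coordinates as coefficients, and the independence of the
  v_i is what isolates a single pair. The factor relating the two sides is k sigma / D, where D is
  the density of mu'_a with respect to |mu|. It must not depend on omega, because the coordinates of
  one projected slice come from different forms. The number k is k! / (k-1)!, as pairings sum over
  all tuples of indices. Forms are controlled only inside Omega, so measures are compared on boxes
  with closed box in Omega, and countably many of these cover Omega.\<close>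

lemma alternating_swap:
  assumes "alternating h u" "length is = h" "a < h" "b < h" "a \<noteq> b"
  shows "u (is[a := is ! b, b := is ! a]) = - u is"
proof (cases "a < b")
  case True
  then show ?thesis using assms by (auto simp: alternating_def)
next
  case False
  then have "b < a" using assms by auto
  then have "u (is[b := is ! a, a := is ! b]) = - u is"
    using assms by (auto simp: alternating_def)
  then show ?thesis using assms(5) by (simp add: list_update_swap)
qed

lemma alternating_permute:
  assumes "alternating h u" "length is = h" "p permutes {..<h}"
  shows "u (map (\<lambda>a. is ! p a) [0..<h]) = of_int (sign p) * u is"
  using finite_lessThan assms(3)
proof (induction rule: permutes_rev_induct)
  case id
  then show ?case using assms(2) by (simp add: map_nth flip: assms(2))
next
  case (swap a b p)
  let ?L = "map (\<lambda>a. is ! p a) [0..<h]"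
  have "map (\<lambda>c. is ! (p \<circ> Transposition.transpose a b) c) [0..<h] = ?L[a := ?L ! b, b := ?L ! a]"
    using swap.hyps by (intro nth_equalityI) (auto simp: nth_list_update Transposition.transpose_def)
  moreover have "u (?L[a := ?L ! b, b := ?L ! a]) = - u ?L"
    using swap.hyps by (intro alternating_swap[OF assms(1)]) auto
  moreover have "sign (p \<circ> Transposition.transpose a b) = - sign p"
    using swap.hyps permutes_imp_permutation[OF finite_lessThan \<open>p permutes _\<close>]
    by (simp add: sign_compose sign_swap_id permutation_swap_id)
  ultimately show ?case using swap.IH by (simp del: o_apply add: comp_def[abs_def])
qed

text \<open>Reindexing by inverses lets the permutation act on the vectors and leaves the product
  indexed by slots. Fixing or summing one slot then affects a single factor.\<close>

lemma wedge_eq_sum_prod: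
  assumes "length is = h"
  shows "wedge h w is = (\<Sum>p | p permutes {..<h}. of_int (sign p) * (\<Prod>c<h. w (p c) $ (is ! c)))"
proof -
  have "wedge h w is = (\<Sum>p | p permutes {..<h}. of_int (sign p) * (\<Prod>a<h. w a $ (is ! p a)))"
    using assms by (simp add: wedge_def)
  also have "\<dots> = (\<Sum>p | p permutes {..<h}. of_int (sign (inv p)) * (\<Prod>a<h. w a $ (is ! inv p a)))"
    by (rule sum_permutations_inverse)
  also have "\<dots> = (\<Sum>p | p permutes {..<h}. of_int (sign p) * (\<Prod>c<h. w (p c) $ (is ! c)))"
  proof (intro sum.cong refl arg_cong2[where f = "(*)"])
    fix p assume "p \<in> {p. p permutes {..<h}}"
    then have p: "p permutes {..<h}" by simp
    show "of_int (sign (inv p)) = (of_int (sign p) :: real)"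
      using permutes_imp_permutation[OF finite_lessThan p] by (simp add: sign_inverse)
    show "(\<Prod>a<h. w a $ (is ! inv p a)) = (\<Prod>c<h. w (p c) $ (is ! c))"
      using prod.permute[OF p, of "\<lambda>a. w a $ (is ! inv p a)"] permutes_inverses[OF p]
      by (simp add: o_def)
  qed
  finally show ?thesis .
qed

text \<open>Swapping two entries amounts to composing every permutation with a transposition on the
  left, which reverses all signs.\<close>

lemma alternating_wedge: "alternating h (wedge h w)"
  unfolding alternating_def
proof (intro conjI allI impI)
  fix "is" :: "'a list" assume "length is \<noteq> h" then show "wedge h w is = 0" by (simp add: wedge_def)
next
  fix "is" :: "'a list" and a b assume ab: "a < b \<and> b < length is"
  let ?t = "Transposition.transpose a b"
  show "wedge h w (is[a := is ! b, b := is ! a]) = - wedge h w is"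
  proof (cases "length is = h")
    case False then show ?thesis by (simp add: wedge_def)
  next
    case len: True
    have t: "?t permutes {..<h}" using ab len by (intro permutes_swap_id) auto
    have "wedge h w is = (\<Sum>p | p permutes {..<h}. of_int (sign (?t \<circ> p)) * (\<Prod>c<h. w c $ (is ! (?t (p c)))))"
      using len unfolding wedge_def by (subst setum_permutations_compose_left[OF t]) (simp add: o_def)
    also have "\<dots> = (\<Sum>p | p permutes {..<h}. - of_int (sign p) * (\<Prod>c<h. w c $ (is[a := is ! b, b := is ! a] ! (p c))))"
    proof (intro sum.cong refl arg_cong2[where f = "(*)"] prod.cong)
      fix p assume "p \<in> {p. p permutes {..<h}}"
      then have p: "p permutes {..<h}" by simp
      show "of_int (sign (?t \<circ> p)) = (- of_int (sign p) :: real)"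
        using permutes_imp_permutation[OF finite_lessThan p] ab
        by (simp add: sign_compose sign_swap_id permutation_swap_id)
      fix c assume "c \<in> {..<h}"
      then have "p c < h" using permutes_in_image[OF p, of c] by auto
      then show "w c $ (is ! (?t (p c))) = w c $ (is[a := is ! b, b := is ! a] ! (p c))"
        using ab len by (auto simp: nth_list_update Transposition.transpose_def)
    qed
    finally show ?thesis using len by (simp add: wedge_def sum_negf)
  qed
qed

section \<open>Sums over tuples of indices and the pairing\<close>

lemma finite_lists_len [simp]: "finite {is :: 'n::finite list. length is = h}"
  using finite_lists_length_eq[of "UNIV :: 'n set" h] by simp

lemma sum_lists_Suc:
  fixes F :: "'n::finite list \<Rightarrow> 'b::comm_monoid_add"
  shows "(\<Sum>is | length is = Suc h. F is) = (\<Sum>i\<in>UNIV. \<Sum>js | length js = h. F (i # js))"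
proof -
  have "(\<Sum>is | length is = Suc h. F is) = (\<Sum>(i, js) \<in> UNIV \<times> {js. length js = h}. F (i # js))"
    by (rule sum.reindex_bij_witness[of _ "\<lambda>(i, js). i # js" "\<lambda>is. (hd is, tl is)"])
       (auto simp: length_Suc_conv)
  then show ?thesis by (simp add: sum.cartesian_product)
qed

lemma sum_lists_prod:
  fixes f :: "nat \<Rightarrow> 'n::finite \<Rightarrow> real"
  shows "(\<Sum>is | length is = h. \<Prod>a<h. f a (is ! a)) = (\<Prod>a<h. \<Sum>i\<in>UNIV. f a i)"
proof (induction h arbitrary: f)
  case (Suc h)
  show ?case
    unfolding sum_lists_Suc prod.lessThan_Suc_shift
    by (simp add: Suc[symmetric] sum_product del: prod.lessThan_Suc)
qed simp

text \<open>Each permutation contributes exactly one tuple, a rearrangement of \<open>js\<close>,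
  and its sign occurs twice. So all h! contributions are equal; the factorial appears because
  \<open>pair\<close> sums over all tuples and not only over increasing ones. Wedges of basis
  vectors thus serve as test covectors that read off single components.\<close>

lemma pair_wedge_axis:
  fixes u :: "'n::finite mvec"
  assumes u: "alternating h u" and js: "length js = h"
  shows "pair h (wedge h (\<lambda>a. axis (js ! a) 1)) u = fact h * u js"
proof -
  have "pair h (wedge h (\<lambda>a. axis (js ! a) 1)) u =
     (\<Sum>is | length is = h. \<Sum>p | p permutes {..<h}.
        of_int (sign p) * (\<Prod>a<h. axis (js ! p a) 1 $ (is ! a)) * u is)"
    unfolding pair_def by (intro sum.cong refl) (simp add: wedge_eq_sum_prod sum_distrib_right)
  also have "\<dots> = (\<Sum>p | p permutes {..<h}. \<Sum>is | length is = h.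
        of_int (sign p) * (\<Prod>a<h. axis (js ! p a) 1 $ (is ! a)) * u is)"
    by (rule sum.swap)
  also have "\<dots> = (\<Sum>p | p permutes {..<h}. u js)"
  proof (intro sum.cong refl)
    fix p assume "p \<in> {p. p permutes {..<h}}"
    then have p: "p permutes {..<h}" by simp
    let ?L = "map (\<lambda>a. js ! p a) [0..<h]"
    have "(\<Prod>a<h. axis (js ! p a) 1 $ (is ! a)) = (if is = ?L then 1 else 0 :: real)"
      if "length is = h" for "is"
    proof (cases "is = ?L")
      case True
      then have "(\<Prod>a<h. axis (js ! p a) 1 $ (is ! a)) = (\<Prod>a<h. (1::real))"
        by (intro prod.cong refl) (simp add: axis_def)
      then show ?thesis using True by (simp only: refl if_True prod.neutral_const)
    next
      case False
      moreover have "is = ?L" if "\<forall>a<h. is ! a = js ! p a"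
        using that \<open>length is = h\<close> by (intro nth_equalityI) simp_all
      ultimately obtain a where "a < h" "is ! a \<noteq> js ! p a" by blast
      then have "axis (js ! p a) 1 $ (is ! a) = (0::real)" by (simp add: axis_def)
      then show ?thesis using False \<open>a < h\<close> by (auto intro!: prod_zero)
    qed
    then have "(\<Sum>is | length is = h. of_int (sign p) * (\<Prod>a<h. axis (js ! p a) 1 $ (is ! a)) * u is)
        = (\<Sum>is | length is = h. if is = ?L then of_int (sign p) * u ?L else 0)"
      by (intro sum.cong) auto
    also have "\<dots> = of_int (sign p) * u ?L" by (subst sum.delta) auto
    also have "\<dots> = u js"
      unfolding alternating_permute[OF u js p] by (cases p rule: sign_cases) auto
    finally show "(\<Sum>is | length is = h. of_int (sign p) * (\<Prod>a<h. axis (js ! p a) 1 $ (is ! a)) * u is) = u js" .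
  qed
  also have "\<dots> = fact h * u js"
    using card_permutations[of "{..<h}" h] by simp
  finally show ?thesis .
qed

text \<open>Bringing slot a to the front takes a adjacent transpositions.\<close>

lemma alternating_move:
  assumes u: "alternating (Suc (length xs)) u" and "a \<le> length xs"
  shows "u (take a xs @ i # drop a xs) = (-1) ^ a * u (i # xs)"
  using assms(2)
proof (induction a)
  case (Suc a)
  let ?is = "take a xs @ i # drop a xs"
  have a: "a < length xs" using Suc.prems by simp
  have "take (Suc a) xs @ i # drop (Suc a) xs = ?is[a := ?is ! Suc a, Suc a := ?is ! a]"
    using a by (simp add: take_Suc_conv_app_nth nth_append list_update_append flip: Cons_nth_drop_Suc)
  moreover have "u (?is[a := ?is ! Suc a, Suc a := ?is ! a]) = - u ?is"
    using a by (intro alternating_swap[OF u]) auto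
  ultimately show ?case using Suc by simp
qed simp

lemma alternating_Cons:
  assumes "alternating (Suc h) u" shows "alternating h (\<lambda>is. u (i # is))"
  unfolding alternating_def
proof (intro conjI allI impI)
  fix "is" :: "'a list" assume "length is \<noteq> h"
  then show "u (i # is) = 0" using assms by (simp add: alternating_def)
next
  fix "is" :: "'a list" and a b assume ab: "a < b \<and> b < length is"
  then have "u ((i # is)[Suc a := (i # is) ! Suc b, Suc b := (i # is) ! Suc a]) = - u (i # is)"
    using assms unfolding alternating_def by (metis Suc_less_eq length_Cons)
  then show "u (i # is[a := is ! b, b := is ! a]) = - u (i # is)" by simp
qed

text \<open>The left side pairs \<open>u\<close> with the exterior product of the covector
  \<open>c\<close> and \<open>A\<close>, in the form in which \<open>dform\<close> produces it.
  Moving slot a of \<open>u\<close> to the front cancels the sign (-1)^a, so the h + 1 summands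
  coincide.\<close>

lemma pair_dform_const:
  fixes u A :: "'n::finite mvec"
  assumes u: "alternating (Suc h) u"
  shows "(\<Sum>is | length is = Suc h. (\<Sum>a<Suc h. (-1) ^ a * (c (is ! a) * A (take a is @ drop (Suc a) is))) * u is)
    = real (Suc h) * (\<Sum>i\<in>UNIV. c i * pair h A (\<lambda>js. u (i # js)))"
proof -
  have "(\<Sum>is | length is = Suc h. (\<Sum>a<Suc h. (-1) ^ a * (c (is ! a) * A (take a is @ drop (Suc a) is))) * u is)
    = (\<Sum>a<Suc h. \<Sum>is | length is = Suc h. (-1) ^ a * (c (is ! a) * A (take a is @ drop (Suc a) is)) * u is)"
    by (subst sum.swap) (simp only: sum_distrib_right)
  also have "\<dots> = (\<Sum>a<Suc h. \<Sum>i\<in>UNIV. c i * pair h A (\<lambda>js. u (i # js)))"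
  proof (intro sum.cong refl)
    fix a assume "a \<in> {..<Suc h}"
    then have a: "a \<le> h" by auto
    have "(\<Sum>is | length is = Suc h. (-1) ^ a * (c (is ! a) * A (take a is @ drop (Suc a) is)) * u is)
      = (\<Sum>(i, js) \<in> UNIV \<times> {js. length js = h}. c i * (A js * u (i # js)))"
    \<comment> \<open>A tuple of length h + 1 corresponds to its entry at position a together with
      the tuple that remains after deleting it.\<close>
    proof (rule sum.reindex_bij_witness[of _ "\<lambda>(i, js). take a js @ i # drop a js"
          "\<lambda>is. (is ! a, take a is @ drop (Suc a) is)"])
      fix "is" :: "'n list" assume "is \<in> {is. length is = Suc h}"
      then have len: "length is = Suc h" by simp
      let ?js = "take a is @ drop (Suc a) is"
      have lj: "length ?js = h" using len a by simp
      show *: "(case (is ! a, ?js) of (i, js) \<Rightarrow> take a js @ i # drop a js) = is"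
        using len a by (simp add: id_take_nth_drop[symmetric])
      have "u is = (-1) ^ a * u (is ! a # ?js)"
        using alternating_move[of ?js u a "is ! a"] u a * unfolding lj by simp
      then have "(-1) ^ a * u is = u (is ! a # ?js)"
        by simp
      then show "(case (is ! a, ?js) of (i, js) \<Rightarrow> c i * (A js * u (i # js))) =
         (-1) ^ a * (c (is ! a) * A ?js) * u is"
        by (simp add: mult_ac)
      show "(is ! a, ?js) \<in> UNIV \<times> {js. length js = h}" using lj by simp
    next
      fix b :: "'n \<times> 'n list" assume "b \<in> UNIV \<times> {js. length js = h}"
      then show "(\<lambda>is. (is ! a, take a is @ drop (Suc a) is)) (case b of (i, js) \<Rightarrow> take a js @ i # drop a js) = b"
        "(case b of (i, js) \<Rightarrow> take a js @ i # drop a js) \<in> {is. length is = Suc h}"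
        using a by (auto simp: nth_append)
    qed
    also have "\<dots> = (\<Sum>i\<in>UNIV. c i * pair h A (\<lambda>js. u (i # js)))"
      by (simp add: sum.cartesian_product[symmetric] pair_def sum_distrib_left)
    finally show "(\<Sum>is | length is = Suc h. (-1) ^ a * (c (is ! a) * A (take a is @ drop (Suc a) is)) * u is)
       = (\<Sum>i\<in>UNIV. c i * pair h A (\<lambda>js. u (i # js)))" .
  qed
  finally show ?thesis by simp
qed

section \<open>Slices of a multivector and its span\<close>

definition slice :: "'n::finite mvec \<Rightarrow> 'n list \<Rightarrow> real^'n" where
  "slice u J = (\<chi> j. u (j # J))"

text \<open>A slice leaves the first slot free and fixes the others. For a simple multivector it is
  therefore a combination of the factors, and so lies in any subspace containing them.\<close>

lemma slice_wedge:
  assumes "length J = m"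
  shows "slice (wedge (Suc m) w) J = (\<Sum>p | p permutes {..<Suc m}.
     (of_int (sign p) * (\<Prod>c<m. w (p (Suc c)) $ (J ! c))) *\<^sub>R w (p 0))"
proof (subst vec_eq_iff, intro allI)
  fix i
  have "slice (wedge (Suc m) w) J $ i
      = (\<Sum>p | p permutes {..<Suc m}. of_int (sign p) * (\<Prod>c<Suc m. w (p c) $ ((i # J) ! c)))"
    using assms by (simp only: slice_def vec_lambda_beta wedge_eq_sum_prod list.size)
  then show "slice (wedge (Suc m) w) J $ i = (\<Sum>p | p permutes {..<Suc m}.
     (of_int (sign p) * (\<Prod>c<m. w (p (Suc c)) $ (J ! c))) *\<^sub>R w (p 0)) $ i"
    unfolding prod.lessThan_Suc_shift by (simp add: mult_ac)
qed

lemma slice_in_subspace: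
  assumes Z: "subspace Z" and u: "u \<in> Lambda_h (Suc m) Z" and J: "length J = m"
  shows "slice u J \<in> Z"
proof -
  obtain r c w where w: "\<forall>j<(r::nat). \<forall>i<Suc m. w j i \<in> Z"
    and u_eq: "u = (\<lambda>is. \<Sum>j<r. c j * wedge (Suc m) (w j) is)"
    using u unfolding Lambda_h_def by blast
  have "slice u J = (\<Sum>j<r. c j *\<^sub>R slice (wedge (Suc m) (w j)) J)"
    unfolding u_eq by (simp add: slice_def vec_eq_iff)
  also have "\<dots> \<in> Z"
  proof (intro subspace_sum[OF Z] subspace_mul[OF Z])
    fix j assume "j \<in> {..<r}"
    then show "slice (wedge (Suc m) (w j)) J \<in> Z"
      unfolding slice_wedge[OF J] using w permutes_in_image[of _ "{..<Suc m}" 0]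
      by (intro subspace_sum[OF Z] subspace_mul[OF Z]) auto
  qed
  finally show ?thesis .
qed

text \<open>The matrix \<open>Q\<close> fixes \<open>u\<close> in the first slot, hence by
  antisymmetry in every slot, and the slots can be treated one after another. The prefix holds the
  slots already treated; it must be arbitrary because it absorbs each new summation index.\<close>

lemma alternating_expand:
  fixes u :: "'n::finite mvec"
  assumes u: "alternating h u"
    and Q: "\<And>i J. Suc (length J) = h \<Longrightarrow> u (i # J) = (\<Sum>j\<in>UNIV. Q i j * u (j # J))"
    and "length (pre @ xs) = h"
  shows "u (pre @ xs) = (\<Sum>js | length js = length xs. (\<Prod>a<length xs. Q (xs ! a) (js ! a)) * u (pre @ js))"
  using assms(3)
proof (induction xs arbitrary: pre)
  case (Cons x xs)
  have h: "h = Suc (length (pre @ xs))" using Cons.prems by simp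
  have mv: "u (pre @ i # xs) = (-1) ^ length pre * u (i # pre @ xs)" for i
  proof -
    have take_drop: "take (length pre) (pre @ xs) = pre" "drop (length pre) (pre @ xs) = xs" by simp_all
    have "length pre \<le> length (pre @ xs)" by simp
    from alternating_move[OF u[unfolded h] this, of i] show ?thesis
      by (simp only: take_drop)
  qed
  have "u (pre @ x # xs) = (\<Sum>j\<in>UNIV. Q x j * u (pre @ j # xs))"
    unfolding mv using Cons.prems by (subst Q) (auto simp: sum_distrib_left mult_ac)
  also have "\<dots> = (\<Sum>j\<in>UNIV. Q x j *
     (\<Sum>js | length js = length xs. (\<Prod>a<length xs. Q (xs ! a) (js ! a)) * u (pre @ j # js)))"
    using Cons.IH[of "pre @ [_]"] Cons.prems by simp
  finally have *: "u (pre @ x # xs) = \<dots>" .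
  show ?case
    unfolding length_Cons sum_lists_Suc prod.lessThan_Suc_shift *
    by (simp add: sum_distrib_left mult.assoc)
qed simp

text \<open>Applying a projection onto \<open>Z\<close> to every slot does not change \<open>u\<close>; antisymmetrizing the result
  writes \<open>u\<close> as a combination of wedges of vectors in \<open>Z\<close>.\<close>

lemma alternating_in_Lambda_h:
  fixes u :: "'n::finite mvec"
  assumes u: "alternating (Suc m) u" and Z: "subspace Z"
    and slices: "\<And>J. length J = m \<Longrightarrow> slice u J \<in> Z"
  shows "u \<in> Lambda_h (Suc m) Z"
proof -
  let ?h = "Suc m"
  have "linear (\<lambda>x :: real^'n. x)" by (rule linear_ident)
  then obtain P where P: "P \<in> UNIV \<rightarrow> Z" "linear P" "\<forall>v\<in>Z. P v = v"
    using linear_exists_left_inverse_on[OF _ Z, of "\<lambda>x. x"] by auto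
  \<comment> \<open>The matrix of the projection \<open>P\<close>. Since \<open>P\<close> fixes
    every slice of \<open>u\<close>, it satisfies the hypothesis of
    \<open>alternating_expand\<close>.\<close>
  define Q where "Q i j = P (axis j 1) $ i" for i j
  have Q: "u (i # J) = (\<Sum>j\<in>UNIV. Q i j * u (j # J))" if "Suc (length J) = ?h" for i J
  proof -
    have "slice u J = (\<Sum>j\<in>UNIV. (slice u J $ j) *\<^sub>R axis j 1)"
      using basis_expansion[of "slice u J"] by (simp add: scalar_mult_eq_scaleR)
    from arg_cong[OF this, of P]
    have *: "P (slice u J) = (\<Sum>j\<in>UNIV. (slice u J $ j) *\<^sub>R P (axis j 1))"
      by (simp only: linear_sum[OF P(2)] linear_cmul[OF P(2)])
    have "P (slice u J) $ i = (\<Sum>j\<in>UNIV. slice u J $ j * P (axis j 1) $ i)"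
      unfolding * by simp
    then have "slice u J $ i = (\<Sum>j\<in>UNIV. slice u J $ j * P (axis j 1) $ i)"
      using P(3) slices that by simp
    then show ?thesis by (simp add: slice_def Q_def mult_ac)
  qed
  have expand: "fact ?h * u is = (\<Sum>js | length js = ?h. u js * wedge ?h (\<lambda>a. P (axis (js ! a) 1)) is)" for "is"
  proof (cases "length is = ?h")
    case False
    then show ?thesis using u by (simp add: alternating_def wedge_def)
  next
    case len: True
    have "fact ?h * u is = (\<Sum>p | p permutes {..<?h}. u is)"
      using card_permutations[of "{..<?h}" ?h] by (simp del: fact_Suc)
    also have "\<dots> = (\<Sum>p | p permutes {..<?h}. of_int (sign p) * u (map (\<lambda>a. is ! p a) [0..<?h]))"
    proof (intro sum.cong refl)
      fix p assume "p \<in> {p. p permutes {..<?h}}"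
      then have p: "p permutes {..<?h}" by simp
      show "u is = of_int (sign p) * u (map (\<lambda>a. is ! p a) [0..<?h])"
        unfolding alternating_permute[OF u len p] by (cases p rule: sign_cases) auto
    qed
    also have "\<dots> = (\<Sum>p | p permutes {..<?h}. \<Sum>js | length js = ?h.
        of_int (sign p) * (\<Prod>a<?h. Q (is ! p a) (js ! a)) * u js)"
    proof (intro sum.cong refl)
      fix p
      show "of_int (sign p) * u (map (\<lambda>a. is ! p a) [0..<?h]) = (\<Sum>js | length js = ?h.
        of_int (sign p) * (\<Prod>a<?h. Q (is ! p a) (js ! a)) * u js)"
        using alternating_expand[OF u Q, of "[]" "map (\<lambda>a. is ! p a) [0..<?h]"]
        by (simp add: sum_distrib_left mult_ac del: upt_Suc prod.lessThan_Suc)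
    qed
    also have "\<dots> = (\<Sum>js | length js = ?h. \<Sum>p | p permutes {..<?h}.
        of_int (sign p) * (\<Prod>a<?h. Q (is ! p a) (js ! a)) * u js)" by (rule sum.swap)
    finally show ?thesis
      using len by (simp add: wedge_def Q_def sum_distrib_left mult_ac del: prod.lessThan_Suc)
  qed
  \<comment> \<open>\<open>Lambda_h\<close> sums over an initial segment of the natural numbers, so
    the tuples have to be enumerated.\<close>
  obtain f where f: "bij_betw f {0..<card {js :: 'n list. length js = ?h}} {js :: 'n list. length js = ?h}"
    using ex_bij_betw_nat_finite[OF finite_lists_len] by blast
  let ?r = "card {js :: 'n list. length js = ?h}"
  have "u = (\<lambda>is. \<Sum>j<?r. (u (f j) / fact ?h) * wedge ?h (\<lambda>a. P (axis (f j ! a) 1)) is)"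
  proof
    fix "is"
    have "(\<Sum>j<?r. (u (f j) / fact ?h) * wedge ?h (\<lambda>a. P (axis (f j ! a) 1)) is)
      = (\<Sum>js | length js = ?h. (u js / fact ?h) * wedge ?h (\<lambda>a. P (axis (js ! a) 1)) is)"
      using sum.reindex_bij_betw[OF f, of "\<lambda>js. (u js / fact ?h) * wedge ?h (\<lambda>a. P (axis (js ! a) 1)) is"]
      by (simp add: atLeast0LessThan)
    also have "\<dots> = (fact ?h * u is) / fact ?h"
      unfolding expand by (simp add: sum_divide_distrib del: fact_Suc)
    finally show "u is = (\<Sum>j<?r. (u (f j) / fact ?h) * wedge ?h (\<lambda>a. P (axis (f j ! a) 1)) is)" 
      by (simp del: fact_Suc)
  qed
  moreover have "P x \<in> Z" for x using P(1) by (simp add: Pi_iff)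
  then have "\<forall>j<?r. \<forall>i<?h. P (axis (f j ! i) 1) \<in> Z" by blast
  ultimately show ?thesis
    unfolding Lambda_h_def mem_Collect_eq
    by - (rule exI[of _ ?r], rule exI[of _ "\<lambda>j. u (f j) / fact ?h"],
        rule exI[of _ "\<lambda>j a. P (axis (f j ! a) 1)"], rule conjI)
qed

text \<open>The span of the slices is itself admissible in the intersection, and every admissible
  subspace contains all slices. The smallest subspace thus gets explicit generators to which forms
  can be applied.\<close>

lemma mvspan_eq_span_slices:
  assumes "alternating (Suc m) u"
  shows "mvspan (Suc m) u = span {slice u J | J. length J = m}"
proof
  have "u \<in> Lambda_h (Suc m) (span {slice u J | J. length J = m})"
    by (intro alternating_in_Lambda_h[OF assms] subspace_span span_base) blast
  then show "mvspan (Suc m) u \<subseteq> span {slice u J | J. length J = m}"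
    unfolding mvspan_def by blast
  show "span {slice u J | J. length J = m} \<subseteq> mvspan (Suc m) u"
    unfolding mvspan_def
  proof (rule Inter_greatest)
    fix Z assume "Z \<in> {Z. subspace Z \<and> u \<in> Lambda_h (Suc m) Z}"
    then have Z: "subspace Z" "u \<in> Lambda_h (Suc m) Z" by simp_all
    show "span {slice u J | J. length J = m} \<subseteq> Z"
      using slice_in_subspace[OF Z] by (intro span_minimal[OF _ Z(1)]) blast
  qed
qed

section \<open>Contracting the first two slots of a simple multivector\<close>

lemma dual_family:
  fixes w :: "nat \<Rightarrow> 'a::euclidean_space"
  assumes "inj_on w {..<k}" "independent (w ` {..<k})"
  obtains \<theta> where "\<And>c d. c < k \<Longrightarrow> d < k \<Longrightarrow> w d \<bullet> \<theta> c = (if c = d then 1 else 0)"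
proof -
  have "\<exists>\<theta>. \<forall>d<k. w d \<bullet> \<theta> = (if c = d then 1 else 0)" if "c < k" for c
  proof -
    obtain g where g: "linear g" "\<forall>x\<in>w ` {..<k}. g x = (if x = w c then 1 else 0 :: real)"
      using linear_independent_extend[OF assms(2), of "\<lambda>x. if x = w c then 1 else 0 :: real"] by blast
    \<comment> \<open>\<open>adjoint g 1\<close> is the vector that represents the functional
      \<open>g\<close> through the inner product.\<close>
    have "w d \<bullet> adjoint g 1 = (if c = d then 1 else 0)" if "d < k" for d
      using g \<open>c < k\<close> that inj_onD[OF assms(1), of d c] by (auto simp: adjoint_works[OF g(1)])
    then show ?thesis by blast
  qed
  then show thesis using that by metis
qed

text \<open>In the application the l-th component of \<open>B i j\<close> is the i-th partial
  derivative of the j-th coefficient of a form omega_l. The l-th component of the value is then the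
  derivative of omega_l in direction y, paired with z; all forms are treated at once.\<close>

definition bform :: "('n::finite \<Rightarrow> 'n \<Rightarrow> real^'n) \<Rightarrow> real^'n \<Rightarrow> real^'n \<Rightarrow> real^'n" where
  "bform B y z = (\<Sum>i\<in>UNIV. \<Sum>j\<in>UNIV. (y $ i * z $ j) *\<^sub>R B i j)"

definition contract :: "('n::finite \<Rightarrow> 'n \<Rightarrow> real^'n) \<Rightarrow> 'n mvec \<Rightarrow> 'n list \<Rightarrow> real^'n" where
  "contract B u J = (\<Sum>i\<in>UNIV. \<Sum>j\<in>UNIV. u (i # j # J) *\<^sub>R B i j)"

lemma contract_wedge:
  assumes J: "length J = m"
  shows "contract B (wedge (Suc (Suc m)) w) J = (\<Sum>p | p permutes {..<Suc (Suc m)}.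
     (of_int (sign p) * (\<Prod>c<m. w (p (Suc (Suc c))) $ (J ! c))) *\<^sub>R bform B (w (p 0)) (w (p (Suc 0))))"
proof -
  have "contract B (wedge (Suc (Suc m)) w) J = (\<Sum>i\<in>UNIV. \<Sum>j\<in>UNIV. \<Sum>p | p permutes {..<Suc (Suc m)}.
     (of_int (sign p) * (\<Prod>c<m. w (p (Suc (Suc c))) $ (J ! c))) *\<^sub>R ((w (p 0) $ i * w (p (Suc 0)) $ j) *\<^sub>R B i j))"
    using J unfolding contract_def
    by (simp add: wedge_eq_sum_prod prod.lessThan_Suc_shift scaleR_sum_left mult_ac del: prod.lessThan_Suc)
  also have "\<dots> = (\<Sum>p | p permutes {..<Suc (Suc m)}. \<Sum>i\<in>UNIV. \<Sum>j\<in>UNIV. 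
     (of_int (sign p) * (\<Prod>c<m. w (p (Suc (Suc c))) $ (J ! c))) *\<^sub>R ((w (p 0) $ i * w (p (Suc 0)) $ j) *\<^sub>R B i j))"
    apply (subst sum.swap[of _ UNIV "{p. p permutes {..<Suc (Suc m)}}"])
    apply (subst sum.swap[of _ _ "{p. p permutes {..<Suc (Suc m)}}"])
    by (rule refl)
  finally show ?thesis by (simp add: bform_def scaleR_sum_right)
qed

text \<open>Precomposing with the transposition of 0 and 1 exchanges the two arguments of
  \<open>bform\<close>, reverses the sign and leaves the other factors alone. Adding both versions
  of the sum produces the antisymmetric part, whence the factor 2.\<close>

lemma contract_wedge_alt:
  assumes J: "length J = m"
  shows "2 *\<^sub>R contract B (wedge (Suc (Suc m)) w) J = (\<Sum>p | p permutes {..<Suc (Suc m)}.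
     (of_int (sign p) * (\<Prod>c<m. w (p (Suc (Suc c))) $ (J ! c))) *\<^sub>R
       (bform B (w (p 0)) (w (p (Suc 0))) - bform B (w (p (Suc 0))) (w (p 0))))"
proof -
  let ?S = "{p. p permutes {..<Suc (Suc m)}}" and ?t = "Transposition.transpose 0 (Suc 0)"
  define F where "F p = (of_int (sign p) * (\<Prod>c<m. w (p (Suc (Suc c))) $ (J ! c))) *\<^sub>R bform B (w (p 0)) (w (p (Suc 0)))" for p
  have t: "?t permutes {..<Suc (Suc m)}" by (intro permutes_swap_id) auto
  have "sum F ?S = (\<Sum>p\<in>?S. F (p \<circ> ?t))" by (rule sum_permutations_compose_right[OF t])
  also have "\<dots> = (\<Sum>p\<in>?S. - ((of_int (sign p) * (\<Prod>c<m. w (p (Suc (Suc c))) $ (J ! c))) *\<^sub>R bform B (w (p (Suc 0))) (w (p 0))))"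
  proof (intro sum.cong refl)
    fix p assume "p \<in> ?S"
    then have "permutation p" by (auto intro: permutes_imp_permutation)
    then have "sign (p \<circ> ?t) = - sign p" by (simp add: sign_compose sign_swap_id permutation_swap_id)
    then show "F (p \<circ> ?t) = - ((of_int (sign p) * (\<Prod>c<m. w (p (Suc (Suc c))) $ (J ! c))) *\<^sub>R bform B (w (p (Suc 0))) (w (p 0)))"
      unfolding F_def by (simp add: Transposition.transpose_def)
  qed
  finally have "sum F ?S + sum F ?S = (\<Sum>p\<in>?S. F p - (of_int (sign p) * (\<Prod>c<m. w (p (Suc (Suc c))) $ (J ! c))) *\<^sub>R bform B (w (p (Suc 0))) (w (p 0)))"
    by (simp add: sum.distrib sum_negf sum_subtractf)
  then show ?thesis
    unfolding contract_wedge[OF J] F_def scaleR_2 by (simp add: scaleR_diff_right)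
qed

lemma perm_with_prefix:
  assumes "a < k" "b < k" "a \<noteq> (b::nat)" 
  obtains q where "q permutes {..<k}" "q 0 = a" "q (Suc 0) = b"
proof -
  \<comment> \<open>The outer transposition in \<open>q\<close> sends \<open>b'\<close> back to
    \<open>b\<close>. Since a and b differ, \<open>b'\<close> is not 0, so the inner transposition
    leaves 0 in place.\<close>
  define b' where "b' = Transposition.transpose 0 a b"
  define q where "q = Transposition.transpose 0 a \<circ> Transposition.transpose (Suc 0) b'"
  have k: "0 < k" "Suc 0 < k" using assms by auto
  have b': "b' < k" "b' \<noteq> 0" using assms by (auto simp: b'_def Transposition.transpose_def)
  have "q permutes {..<k}"
    unfolding q_def using assms k b' by (intro permutes_compose permutes_swap_id) auto
  moreover have "q 0 = a" "q (Suc 0) = b"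
    unfolding q_def using b' assms(3) by (auto simp: Transposition.transpose_def b'_def)
  ultimately show thesis using that by blast
qed

text \<open>By injectivity, agreement from index 2 on forces the values at 0 and 1 to be the same
  two, in one order or the other. These are the two permutations that survive the pairing with a
  dual family.\<close>

lemma perm_suffix_cases:
  assumes p: "p permutes {..<Suc (Suc m)}" and q: "q permutes {..<Suc (Suc m)}"
    and eq: "\<forall>c<m. p (Suc (Suc c)) = q (Suc (Suc c))"
  shows "p = q \<or> p = q \<circ> Transposition.transpose 0 (Suc 0)"
proof -
  let ?I = "{..<Suc (Suc m)}"
  have 01: "p x \<in> {q 0, q (Suc 0)}" if "x < 2" for x
  proof -
    have "p x \<in> q ` ?I"
      unfolding permutes_image[OF q] permutes_in_image[OF p] using that by simp
    then obtain y where y: "y < Suc (Suc m)" "p x = q y" by blast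
    have "y < 2"
    proof (rule ccontr)
      assume *: "\<not> y < 2"
      then have c: "y = Suc (Suc (y - 2))" by simp
      then have "y - 2 < m" using y(1) by simp
      then have "p y = q y" using eq c by metis
      then have "y = x" using y(2) permutes_inj[OF p] by (metis injD)
      then show False using that * by simp
    qed
    then show ?thesis using y(2) by (auto simp: less_2_cases_iff)
  qed
  have ne: "p 0 \<noteq> p (Suc 0)" using permutes_inj[OF p] by (metis injD nat.distinct(1))
  have rest: "p x = q x" if "x \<noteq> 0" "x \<noteq> Suc 0" for x
  proof (cases "x < Suc (Suc m)")
    case True
    moreover have "x = Suc (Suc (x - 2))" using that by simp
    ultimately show ?thesis using eq by (metis Suc_less_eq)
  next
    case False
    then show ?thesis using permutes_not_in[OF p] permutes_not_in[OF q] by simp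
  qed
  show ?thesis
  proof (cases "p 0 = q 0")
    case True
    then have "p (Suc 0) = q (Suc 0)" using 01[of 0] 01[of "Suc 0"] ne by auto
    then have "p x = q x" for x using True rest[of x] by (cases "x = 0"; cases "x = Suc 0") simp_all
    then show ?thesis by blast
  next
    case False
    then have "p 0 = q (Suc 0)" "p (Suc 0) = q 0" using 01[of 0] 01[of "Suc 0"] ne by auto
    then have "p x = (q \<circ> Transposition.transpose 0 (Suc 0)) x" for x
      using rest[of x] by (cases "x = 0"; cases "x = Suc 0") (simp_all add: Transposition.transpose_def)
    then show ?thesis by blast
  qed
qed

text \<open>For the inclusion from right to left, pairing the remaining slots with a dual family isolates a
  single pair of vectors.\<close>

lemma span_contract_wedge:
  fixes w :: "nat \<Rightarrow> real^'n::finite"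
  assumes "inj_on w {..<Suc (Suc m)}" "independent (w ` {..<Suc (Suc m)})"
  shows "span {contract B (wedge (Suc (Suc m)) w) J | J. length J = m}
    = span {bform B (w a) (w b) - bform B (w b) (w a) | a b. a < Suc (Suc m) \<and> b < Suc (Suc m)}"
    (is "span ?C = span ?D")
proof (intro equalityI span_minimal subspace_span subsetI)
  let ?k = "Suc (Suc m)"
  fix x assume "x \<in> ?C"
  then obtain J where J: "length J = m" "x = contract B (wedge ?k w) J" by blast
  have "2 *\<^sub>R x \<in> span ?D"
    unfolding J(2) contract_wedge_alt[OF J(1)]
  proof (intro span_sum span_mul span_base)
    fix p assume "p \<in> {p. p permutes {..<?k}}"
    then have "p 0 < ?k" "p (Suc 0) < ?k" using permutes_in_image[of p "{..<?k}"] by auto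
    then show "bform B (w (p 0)) (w (p (Suc 0))) - bform B (w (p (Suc 0))) (w (p 0)) \<in> ?D" by blast
  qed
  then have "(1/2) *\<^sub>R (2 *\<^sub>R x) \<in> span ?D" by (rule span_mul)
  then show "x \<in> span ?D" by simp
next
  let ?k = "Suc (Suc m)" and ?t = "Transposition.transpose 0 (Suc 0) :: nat \<Rightarrow> nat"
  fix x assume "x \<in> ?D"
  then obtain a b where ab: "a < ?k" "b < ?k" "x = bform B (w a) (w b) - bform B (w b) (w a)" by blast
  show "x \<in> span ?C"
  proof (cases "a = b")
    case True then show ?thesis using ab by (simp add: span_zero)
  next
    case False
    obtain q where q: "q permutes {..<?k}" "q 0 = a" "q (Suc 0) = b"
      using perm_with_prefix[OF ab(1,2) False] .
    obtain \<theta> where \<theta>: "\<And>c d. c < ?k \<Longrightarrow> d < ?k \<Longrightarrow> w d \<bullet> \<theta> c = (if c = d then 1 else 0)"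
      using dual_family[OF assms] by blast
    \<comment> \<open>The components of the tensor product of the dual vectors belonging to
      \<open>q 2\<close>, \<open>q 3\<close> and so on. Summing against them over all
      \<open>J\<close> selects the permutations that agree with \<open>q\<close> beyond the first
      two indices.\<close>
    define R where "R J = (\<Prod>c<m. \<theta> (q (Suc (Suc c))) $ (J ! c))" for J
    have qt: "q \<circ> ?t permutes {..<?k}" using q(1) by (intro permutes_compose permutes_swap_id) auto
    have ne: "q \<noteq> q \<circ> ?t" using q False by (auto simp: fun_eq_iff intro!: exI[of _ 0])
    have "(\<Sum>J | length J = m. R J *\<^sub>R contract B (wedge ?k w) J) =
       (\<Sum>J | length J = m. \<Sum>p | p permutes {..<?k}. 
          (\<Prod>c<m. \<theta> (q (Suc (Suc c))) $ (J ! c) * w (p (Suc (Suc c))) $ (J ! c)) *\<^sub>R of_int (sign p) *\<^sub>R bform B (w (p 0)) (w (p (Suc 0))))"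
      by (intro sum.cong refl) (simp add: contract_wedge R_def scaleR_sum_right prod.distrib mult_ac)
    also have "\<dots> = (\<Sum>p | p permutes {..<?k}. \<Sum>J | length J = m.
          (\<Prod>c<m. \<theta> (q (Suc (Suc c))) $ (J ! c) * w (p (Suc (Suc c))) $ (J ! c)) *\<^sub>R of_int (sign p) *\<^sub>R bform B (w (p 0)) (w (p (Suc 0))))"
      by (rule sum.swap)
    also have "\<dots> = (\<Sum>p | p permutes {..<?k}. (if p \<in> {q, q \<circ> ?t} then of_int (sign p) *\<^sub>R bform B (w (p 0)) (w (p (Suc 0))) else 0))"
    proof (intro sum.cong refl)
      fix p assume "p \<in> {p. p permutes {..<?k}}"
      then have p: "p permutes {..<?k}" by simp
      have "(\<Sum>J | length J = m. \<Prod>c<m. \<theta> (q (Suc (Suc c))) $ (J ! c) * w (p (Suc (Suc c))) $ (J ! c))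
         = (\<Prod>c<m. \<Sum>i\<in>UNIV. \<theta> (q (Suc (Suc c))) $ i * w (p (Suc (Suc c))) $ i)"
        by (rule sum_lists_prod)
      also have "\<dots> = (\<Prod>c<m. if q (Suc (Suc c)) = p (Suc (Suc c)) then 1 else 0)"
      proof (intro prod.cong refl)
        fix c assume "c \<in> {..<m}"
        then have "q (Suc (Suc c)) < ?k" "p (Suc (Suc c)) < ?k"
          using permutes_in_image[OF q(1), of "Suc (Suc c)"] permutes_in_image[OF p, of "Suc (Suc c)"] by auto
        from \<theta>[OF this] show "(\<Sum>i\<in>UNIV. \<theta> (q (Suc (Suc c))) $ i * w (p (Suc (Suc c))) $ i) = (if q (Suc (Suc c)) = p (Suc (Suc c)) then 1 else 0)"
          by (simp add: inner_vec_def mult_ac)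
      qed
      also have "\<dots> = (if p \<in> {q, q \<circ> ?t} then 1 else 0)"
      proof (cases "\<forall>c<m. p (Suc (Suc c)) = q (Suc (Suc c))")
        case True
        then show ?thesis using perm_suffix_cases[OF p q(1) True] by auto
      next
        case F: False
        then have "p \<notin> {q, q \<circ> ?t}" by (auto simp: Transposition.transpose_def)
        moreover have "(\<Prod>c<m. if q (Suc (Suc c)) = p (Suc (Suc c)) then 1 else 0 :: real) = 0"
          using F by (intro prod_zero) (auto, metis lessThan_iff)
        ultimately show ?thesis by simp
      qed
      finally show "(\<Sum>J | length J = m.
          (\<Prod>c<m. \<theta> (q (Suc (Suc c))) $ (J ! c) * w (p (Suc (Suc c))) $ (J ! c)) *\<^sub>R of_int (sign p) *\<^sub>R bform B (w (p 0)) (w (p (Suc 0))))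
          = (if p \<in> {q, q \<circ> ?t} then of_int (sign p) *\<^sub>R bform B (w (p 0)) (w (p (Suc 0))) else 0)"
        by (simp only: scaleR_sum_left[symmetric]) simp
    qed
    also have "\<dots> = (\<Sum>p \<in> {q, q \<circ> ?t}. of_int (sign p) *\<^sub>R bform B (w (p 0)) (w (p (Suc 0))))"
      using q(1) qt by (intro sum.mono_neutral_cong_right) (auto simp: finite_permutations)
    \<comment> \<open>The two surviving terms carry opposite signs and so form the commutator
      \<open>x\<close>, up to the sign of \<open>q\<close>.\<close>
    also have "\<dots> = of_int (sign q) *\<^sub>R x"
    proof -
      have "permutation q" using q(1) by (auto intro: permutes_imp_permutation)
      then have "sign (q \<circ> ?t) = - sign q" by (simp add: sign_compose sign_swap_id permutation_swap_id)
      then show ?thesis using ne q ab(3) by (simp add: scaleR_diff_right)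
    qed
    finally have "x = of_int (sign q) *\<^sub>R (\<Sum>J | length J = m. R J *\<^sub>R contract B (wedge ?k w) J)"
      by (cases q rule: sign_cases) auto
    also have "\<dots> \<in> span ?C" by (intro span_mul span_sum span_base) blast
    finally show ?thesis .
  qed
qed

section \<open>Continuously differentiable functions\<close>

text \<open>Unlike \<open>C1_on\<close>, this covers scalar functions and lets a proof supply any
  convenient derivative. Continuity is asked one direction at a time, which in finite dimension is
  continuity of the derivative.\<close>

definition c1 :: "'a::euclidean_space set \<Rightarrow> ('a \<Rightarrow> 'b::real_normed_vector) \<Rightarrow> bool" where
  "c1 S f \<longleftrightarrow> (\<exists>f'. (\<forall>x\<in>S. (f has_derivative f' x) (at x)) \<and> (\<forall>h. continuous_on S (\<lambda>x. f' x h)))"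

lemma c1I:
  assumes "\<And>x. x \<in> S \<Longrightarrow> (f has_derivative f' x) (at x)" "\<And>h. continuous_on S (\<lambda>x. f' x h)"
  shows "c1 S f"
  unfolding c1_def using assms by blast

lemma c1_has_derivative:
  assumes "c1 S f" "x \<in> S"
  shows "(f has_derivative frechet_derivative f (at x)) (at x)"
proof -
  obtain f' where "(f has_derivative f') (at x)" using assms unfolding c1_def by blast
  then show ?thesis by (simp add: frechet_derivative_at[symmetric])
qed

lemma c1_differentiable: "c1 S f \<Longrightarrow> x \<in> S \<Longrightarrow> f differentiable (at x)"
  unfolding differentiable_def by (rule exI) (rule c1_has_derivative)

lemma c1_continuous_derivative:
  assumes "c1 S f"
  shows "continuous_on S (\<lambda>x. frechet_derivative f (at x) h)"
proof -
  obtain f' where f': "\<forall>x\<in>S. (f has_derivative f' x) (at x)" "\<forall>h. continuous_on S (\<lambda>x. f' x h)"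
    using assms unfolding c1_def by blast
  have "continuous_on S (\<lambda>x. f' x h)" using f'(2) by blast
  then show ?thesis
    by (rule continuous_on_eq) (simp add: frechet_derivative_at[OF f'(1)[rule_format], symmetric])
qed

lemma c1_continuous_on: "c1 S f \<Longrightarrow> continuous_on S f"
  by (rule has_derivative_continuous_on[OF has_derivative_at_withinI[OF c1_has_derivative]])

lemma c1_subset: "c1 S f \<Longrightarrow> T \<subseteq> S \<Longrightarrow> c1 T f"
  unfolding c1_def by (meson continuous_on_subset subsetD)

lemma C1_on_iff_c1: "C1_on S w \<longleftrightarrow> c1 S w"
proof
  assume w: "C1_on S w"
  then have d: "(w has_derivative frechet_derivative w (at x)) (at x)" if "x \<in> S" for x
    using that frechet_derivative_works unfolding C1_on_def by blast
  have "continuous_on S (\<lambda>x. frechet_derivative w (at x) h)" for h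
  proof (rule continuous_on_eq)
    show "continuous_on S (\<lambda>x. \<Sum>b\<in>Basis. (h \<bullet> b) *\<^sub>R frechet_derivative w (at x) b)"
      using w unfolding C1_on_def by (intro continuous_intros) blast
    fix x assume "x \<in> S"
    then have "linear (frechet_derivative w (at x))" using d has_derivative_linear by blast
    then have "frechet_derivative w (at x) (\<Sum>b\<in>Basis. (h \<bullet> b) *\<^sub>R b)
        = (\<Sum>b\<in>Basis. (h \<bullet> b) *\<^sub>R frechet_derivative w (at x) b)"
      by (simp add: linear_cmul linear_sum)
    then show "(\<Sum>b\<in>Basis. (h \<bullet> b) *\<^sub>R frechet_derivative w (at x) b) = frechet_derivative w (at x) h"
      by (simp add: euclidean_representation)
  qed
  then show "c1 S w" using d by (intro c1I)
next
  assume "c1 S w"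
  then show "C1_on S w"
    unfolding C1_on_def using c1_continuous_derivative c1_differentiable by blast
qed

lemma c1_const: "c1 S (\<lambda>x. c)"
  by (rule c1I[where f' = "\<lambda>x h. 0"]) auto

lemma c1_add: "c1 S f \<Longrightarrow> c1 S g \<Longrightarrow> c1 S (\<lambda>x. f x + g x)"
  by (rule c1I[where f' = "\<lambda>x h. frechet_derivative f (at x) h + frechet_derivative g (at x) h"])
     (intro derivative_intros continuous_intros c1_has_derivative c1_continuous_derivative; assumption)+

lemma c1_bounded_linear:
  assumes "bounded_linear L" "c1 S f" shows "c1 S (\<lambda>x. L (f x))"
  by (rule c1I[where f' = "\<lambda>x h. L (frechet_derivative f (at x) h)"])
     (intro bounded_linear.has_derivative[OF assms(1)] bounded_linear.continuous_on[OF assms(1)]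
       c1_has_derivative[OF assms(2)] c1_continuous_derivative[OF assms(2)]; assumption)+

lemma c1_diff: "c1 S f \<Longrightarrow> c1 S g \<Longrightarrow> c1 S (\<lambda>x. f x - g x)"
  using c1_add[OF _ c1_bounded_linear[OF bounded_linear_minus[OF bounded_linear_ident]], of S f g] by simp

lemma c1_sum: "(\<And>i. i \<in> I \<Longrightarrow> c1 S (f i)) \<Longrightarrow> c1 S (\<lambda>x. \<Sum>i\<in>I. f i x)"
  by (induction I rule: infinite_finite_induct) (auto intro: c1_const c1_add)

lemma c1_bounded_bilinear:
  assumes "bounded_bilinear B" "c1 S f" "c1 S g" shows "c1 S (\<lambda>x. B (f x) (g x))"
  by (rule c1I[where f' = "\<lambda>x h. B (f x) (frechet_derivative g (at x) h) + B (frechet_derivative f (at x) h) (g x)"])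
     (intro bounded_bilinear.FDERIV[OF assms(1)] continuous_on_add bounded_bilinear.continuous_on[OF assms(1)]
       c1_has_derivative[OF assms(2)] c1_continuous_derivative[OF assms(2)] c1_continuous_on[OF assms(2)]
       c1_has_derivative[OF assms(3)] c1_continuous_derivative[OF assms(3)] c1_continuous_on[OF assms(3)]; assumption)+

lemmas c1_mult = c1_bounded_bilinear[OF bounded_bilinear_mult]
lemmas c1_scaleR = c1_bounded_bilinear[OF bounded_bilinear_scaleR]
lemmas c1_inner = c1_bounded_bilinear[OF bounded_bilinear_inner]
lemmas c1_nth = c1_bounded_linear[OF bounded_linear_vec_nth]

lemma c1_inverse:
  fixes f :: "'a::euclidean_space \<Rightarrow> real"
  assumes "c1 S f" "\<And>x. x \<in> S \<Longrightarrow> f x \<noteq> 0" shows "c1 S (\<lambda>x. inverse (f x))"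
proof (rule c1I[where f' = "\<lambda>x h. - (inverse (f x) * frechet_derivative f (at x) h * inverse (f x))"])
  show "((\<lambda>x. inverse (f x)) has_derivative (\<lambda>h. - (inverse (f x) * frechet_derivative f (at x) h * inverse (f x)))) (at x)"
    if "x \<in> S" for x
    by (rule Deriv.has_derivative_inverse[OF assms(2)[OF that] c1_has_derivative[OF assms(1) that]])
  show "continuous_on S (\<lambda>x. - (inverse (f x) * frechet_derivative f (at x) h * inverse (f x)))" for h
    using assms by (intro continuous_intros c1_continuous_derivative c1_continuous_on) auto
qed

lemma c1_prod:
  fixes f :: "'i \<Rightarrow> 'a::euclidean_space \<Rightarrow> real"
  shows "(\<And>i. i \<in> I \<Longrightarrow> c1 S (f i)) \<Longrightarrow> c1 S (\<lambda>x. \<Prod>i\<in>I. f i x)"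
  by (induction I rule: infinite_finite_induct) (auto intro: c1_const c1_mult)

lemma c1_Un:
  assumes "open S" "open T" "c1 S f" "c1 T f" shows "c1 (S \<union> T) f"
  by (rule c1I[where f' = "\<lambda>x. frechet_derivative f (at x)"])
     (use assms c1_has_derivative in blast,
      intro continuous_on_open_Un c1_continuous_derivative assms)

text \<open>The open sets \<open>S\<close> and the complement of \<open>K\<close> cover the space,
  and the function is C^1 on each. This is how a cut-off times a form known only on Omega becomes a
  global test function.\<close>

lemma c1_extend_zero:
  assumes "open S" "closed K" "K \<subseteq> S" "c1 S f" "\<And>x. x \<notin> K \<Longrightarrow> f x = 0"
  shows "c1 UNIV f"
proof -
  have "c1 (- K) f"
  proof (rule c1I[where f' = "\<lambda>x h. 0"])
    fix x assume "x \<in> - K"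
    show "(f has_derivative (\<lambda>h. 0)) (at x)"
      by (rule has_derivative_transform_within_open[of "\<lambda>x. 0" _ _ _ "- K"])
         (use assms \<open>x \<in> - K\<close> in \<open>auto simp: open_Compl\<close>)
  qed auto
  then have "c1 (S \<union> - K) f" using assms by (intro c1_Un) (auto simp: open_Compl)
  moreover have "S \<union> - K = UNIV" using assms by auto
  ultimately show ?thesis by simp
qed

section \<open>Partial derivatives and differentiation under the integral sign\<close>

lemma frechet_eq_partials:
  fixes f :: "real^'n \<Rightarrow> real"
  assumes "f differentiable (at x)"
  shows "frechet_derivative f (at x) h = (\<Sum>j\<in>UNIV. h $ j * partial j f x)"
proof -
  have "linear (frechet_derivative f (at x))" using assms by (rule linear_frechet_derivative)
  then have "frechet_derivative f (at x) (\<Sum>j\<in>UNIV. (h $ j) *\<^sub>R axis j 1)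
     = (\<Sum>j\<in>UNIV. h $ j * frechet_derivative f (at x) (axis j 1))"
    by (simp add: linear_sum linear_cmul)
  then show ?thesis
    using basis_expansion[of h] by (simp add: scalar_mult_eq_scaleR partial_def)
qed

lemma continuous_on_partial: "c1 S f \<Longrightarrow> continuous_on S (partial j f)"
  using c1_continuous_derivative[of S f "axis j 1"] unfolding partial_def[abs_def] .

lemma partial_eqI: "(f has_derivative f') (at x) \<Longrightarrow> partial j f x = f' (axis j 1)"
  unfolding partial_def using frechet_derivative_at by metis

lemma partial_mult:
  assumes "f differentiable (at x)" "g differentiable (at x)"
  shows "partial j (\<lambda>y. f y * g y) x = f x * partial j g x + partial j f x * g x"
  unfolding partial_def[of j f] partial_def[of j g]
  by (rule partial_eqI) (use assms frechet_derivative_works in \<open>intro has_derivative_mult; blast\<close>)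

lemma partial_zero_outside:
  assumes "closed K" "\<And>x. x \<notin> K \<Longrightarrow> f x = 0" "x \<notin> K"
  shows "partial j f x = 0"
proof -
  have "(f has_derivative (\<lambda>h. 0)) (at x)"
    by (rule has_derivative_transform_within_open[of "\<lambda>x. 0" _ _ _ "- K"])
       (use assms in \<open>auto simp: open_Compl\<close>)
  from partial_eqI[OF this] show ?thesis by simp
qed

lemma has_derivative_gradient:
  fixes f :: "real^'n \<Rightarrow> real"
  assumes "f differentiable (at x)"
  shows "(f has_derivative (\<lambda>h. (\<chi> j. partial j f x) \<bullet> h)) (at x)"
proof -
  have "frechet_derivative f (at x) = (\<lambda>h. (\<chi> j. partial j f x) \<bullet> h)"
    using frechet_eq_partials[OF assms] by (auto simp: inner_vec_def mult.commute)
  then show ?thesis using assms frechet_derivative_works by metis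
qed

text \<open>Used twice for convolutions: with the derivative on the bump, for smoothness, and with
  the derivative on the mollified function, for convergence of the partial derivatives.\<close>

lemma has_derivative_integral_param:
  fixes f :: "'a::euclidean_space \<Rightarrow> 'b::euclidean_space \<Rightarrow> real"
  assumes f: "\<And>x t. ((\<lambda>x. f x t) has_derivative (\<lambda>h. G x t \<bullet> h)) (at x)"
    and G: "continuous_on UNIV (\<lambda>(x, t). G x t)"
    and int: "\<And>x. continuous_on (cbox a b) (f x)"
  shows "((\<lambda>x. integral (cbox a b) (f x)) has_derivative (\<lambda>h. integral (cbox a b) (\<lambda>t. G x t \<bullet> h))) (at x)"
proof -
  \<comment> \<open>\<open>leibniz_rule\<close> wants derivatives as bounded linear maps, so each
    gradient is encoded as the functional it represents.\<close>
  have cG: "continuous_on (UNIV \<times> cbox a b) (\<lambda>(x, t). blinfun_inner_right (G x t))"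
    using bounded_linear.continuous_on[OF bounded_linear_blinfun_inner_right continuous_on_subset[OF G]]
    by (auto simp: case_prod_beta)
  have "((\<lambda>x. integral (cbox a b) (f x)) has_derivative
      blinfun_apply (integral (cbox a b) (\<lambda>t. blinfun_inner_right (G x t)))) (at x within UNIV)"
    by (rule leibniz_rule) (use f cG int in \<open>auto intro: integrable_continuous\<close>)
  moreover have "(\<lambda>t. blinfun_inner_right (G x t)) integrable_on cbox a b"
  proof (intro integrable_continuous)
    have "continuous_on (cbox a b) ((\<lambda>(x, t). blinfun_inner_right (G x t)) \<circ> (\<lambda>t. (x, t)))"
      by (intro continuous_on_compose continuous_intros continuous_on_subset[OF cG]) auto
    then show "continuous_on (cbox a b) (\<lambda>t. blinfun_inner_right (G x t))" by (simp add: o_def)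
  qed
  then have "blinfun_apply (integral (cbox a b) (\<lambda>t. blinfun_inner_right (G x t)))
      = (\<lambda>h. integral (cbox a b) (\<lambda>t. G x t \<bullet> h))"
    by (intro ext) (simp add: blinfun_apply_integral)
  ultimately show ?thesis by (simp only:)
qed

section \<open>Mollification\<close>

text \<open>The family \<open>bump1\<close> contains the standard bump function (\<open>p = 1\<close>, \<open>m = 0\<close>) and is closed under
  differentiation; this is what gives smoothness.\<close>

definition bump1 :: "real poly \<Rightarrow> nat \<Rightarrow> real \<Rightarrow> real" where
  "bump1 p m t = (if \<bar>t\<bar> < 1 then poly p t * inverse (1 - t\<^sup>2) ^ m * exp (- inverse (1 - t\<^sup>2)) else 0)"

text \<open>With r = 1 / (1 - t^2), the derivative is p' r^m + 2 m t p r^(m+1) - 2 t p r^(m+2) times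
  the exponential. This polynomial is the numerator after r^(m+2) is factored out, since r (1 - t^2)
  = 1.\<close>

definition bump1_deriv :: "real poly \<Rightarrow> nat \<Rightarrow> real poly" where
  "bump1_deriv p m = pderiv p * [:1, 0, -1:]\<^sup>2 + smult (2 * real m) ([:0, 1:] * p * [:1, 0, -1:]) - smult 2 ([:0, 1:] * p)"

lemma poly_bump1_deriv:
  "poly (bump1_deriv p m) t = poly (pderiv p) t * (1 - t\<^sup>2)\<^sup>2 + 2 * real m * t * poly p t * (1 - t\<^sup>2) - 2 * t * poly p t"
  by (simp add: bump1_deriv_def power2_eq_square algebra_simps)

text \<open>Meant for the points -1 and 1, where the formula for \<open>bump1\<close> on one side
  meets the zero function on the other.\<close>

lemma DERIV_zero_of_quadratic_bound:
  fixes f :: "real \<Rightarrow> real"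
  assumes "\<And>y. \<bar>f y - f x\<bar> \<le> C * (y - x)\<^sup>2"
  shows "(f has_real_derivative 0) (at x)"
  unfolding has_field_derivative_iff
proof (rule Lim_null_comparison)
  show "\<forall>\<^sub>F y in at x. norm ((f y - f x) / (y - x)) \<le> C * \<bar>y - x\<bar>"
  proof (rule eventually_at_topological[THEN iffD2], intro exI[of _ UNIV] conjI ballI impI)
    fix y assume "y \<noteq> x"
    then show "norm ((f y - f x) / (y - x)) \<le> C * \<bar>y - x\<bar>"
      using assms[of y] by (simp add: divide_le_eq abs_mult_self_eq power2_eq_square mult.assoc flip: abs_mult)
  qed auto
  show "((\<lambda>y. C * \<bar>y - x\<bar>) \<longlongrightarrow> 0) (at x)"
    by (rule tendsto_eq_intros refl | simp)+
qed

text \<open>The term of degree m + 2 of the exponential series bounds \<open>exp r\<close> from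
  below. Its two extra powers give the quadratic decay wanted at the endpoints of the bump.\<close>

lemma power_times_exp_minus_le:
  fixes r :: real assumes "0 < r"
  shows "r ^ m * exp (- r) \<le> fact (m + 2) * (inverse r)\<^sup>2"
proof -
  have "r ^ (m + 2) / fact (m + 2) \<le> exp r"
  proof -
    have "(\<Sum>n\<in>{m + 2}. r ^ n /\<^sub>R fact n) \<le> exp r"
      using sums_unique[OF exp_converges[of r]] assms
        sum_le_suminf[OF sums_summable[OF exp_converges[of r]], of "{m + 2}"] by auto
    then show ?thesis by (simp add: divide_inverse mult.commute)
  qed
  then have "r ^ (m + 2) \<le> fact (m + 2) * exp r" by (simp add: divide_le_eq mult.commute del: fact_Suc)
  then have "r ^ m * r\<^sup>2 * exp (- r) \<le> fact (m + 2) * exp r * exp (- r)"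
    by (intro mult_right_mono) (auto simp: power_add power2_eq_square mult_ac simp del: fact_Suc)
  then have "r ^ m * r\<^sup>2 * exp (- r) \<le> fact (m + 2)"
    by (simp only: mult.assoc exp_minus_inverse mult_1_right)
  then have "(r ^ m * exp (- r)) * r\<^sup>2 \<le> fact (m + 2)"
    by (simp only: mult_ac)
  then show ?thesis using assms
    by (simp add: power_inverse divide_simps del: fact_Suc)
qed

text \<open>By the preceding bound with r = 1 / (1 - y^2), the bump is at most a constant times (1 -
  y^2)^2. Of the factors 1 - y and 1 + y, one is y - t0 up to sign and the other is at most 2,
  whence the 4.\<close>

lemma bump1_quadratic_bound:
  assumes "\<bar>t0\<bar> = 1"
  obtains C where "\<And>y. \<bar>bump1 p m y - bump1 p m t0\<bar> \<le> C * (y - t0)\<^sup>2"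
proof -
  have "compact (poly p ` {-1..1})" by (intro compact_continuous_image continuous_intros) auto
  then obtain C0 where C0: "\<And>y. y \<in> {-1..1} \<Longrightarrow> \<bar>poly p y\<bar> \<le> C0"
    using compact_imp_bounded bounded_iff by (metis imageI real_norm_def)
  have C0_pos: "0 \<le> C0" using C0[of 0] by auto
  have "\<bar>bump1 p m y - bump1 p m t0\<bar> \<le> (C0 * fact (m + 2) * 4) * (y - t0)\<^sup>2" for y
  proof (cases "\<bar>y\<bar> < 1")
    case False
    then show ?thesis using assms C0_pos by (simp add: bump1_def)
  next
    case True
    then have s: "0 < 1 - y\<^sup>2" by (simp add: abs_square_less_1)
    have "t0 = 1 \<or> t0 = -1" using assms by auto
    then have y: "(1 - y\<^sup>2)\<^sup>2 \<le> 4 * (y - t0)\<^sup>2"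
    proof
      assume t0: "t0 = 1"
      have "(1 - y\<^sup>2)\<^sup>2 = (1 + y)\<^sup>2 * (y - t0)\<^sup>2" unfolding t0 by algebra
      moreover have "(1 + y)\<^sup>2 \<le> 2\<^sup>2" using True by (intro power_mono) auto
      ultimately show ?thesis by (simp add: mult_right_mono)
    next
      assume t0: "t0 = -1"
      have "(1 - y\<^sup>2)\<^sup>2 = (1 - y)\<^sup>2 * (y - t0)\<^sup>2" unfolding t0 by algebra
      moreover have "(1 - y)\<^sup>2 \<le> 2\<^sup>2" using True by (intro power_mono) auto
      ultimately show ?thesis by (simp add: mult_right_mono)
    qed
    have "\<bar>bump1 p m y - bump1 p m t0\<bar> = \<bar>poly p y\<bar> * (inverse (1 - y\<^sup>2) ^ m * exp (- inverse (1 - y\<^sup>2)))"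
      using True assms s by (simp add: bump1_def abs_mult)
    also have "\<dots> \<le> C0 * (fact (m + 2) * (1 - y\<^sup>2)\<^sup>2)"
    proof (rule mult_mono)
      show "\<bar>poly p y\<bar> \<le> C0" using True by (intro C0) auto
      show "inverse (1 - y\<^sup>2) ^ m * exp (- inverse (1 - y\<^sup>2)) \<le> fact (m + 2) * (1 - y\<^sup>2)\<^sup>2"
        using power_times_exp_minus_le[of "inverse (1 - y\<^sup>2)" m] s by (simp del: fact_Suc)
    qed (use s C0_pos in auto)
    also have "\<dots> \<le> C0 * (fact (m + 2) * (4 * (y - t0)\<^sup>2))"
      using y C0_pos by (intro mult_left_mono) auto
    finally show ?thesis by (simp add: mult_ac del: fact_Suc)
  qed
  then show thesis by (rule that)
qed

lemma DERIV_bump1: "(bump1 p m has_real_derivative bump1 (bump1_deriv p m) (m + 2) t) (at t)"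
proof -
  consider "\<bar>t\<bar> < 1" | "\<bar>t\<bar> = 1" | "\<bar>t\<bar> > 1" by linarith
  then show ?thesis
  proof cases
    case 1
    define r where "r = inverse (1 - t\<^sup>2)"
    have s: "0 < 1 - t\<^sup>2" using 1 by (simp add: abs_square_less_1)
    have rs: "r * (1 - t\<^sup>2) = 1" using s by (simp add: r_def)
    have dr: "((\<lambda>t. inverse (1 - t\<^sup>2)) has_real_derivative 2 * t * r\<^sup>2) (at t)"
      using s unfolding r_def
      by (auto intro!: derivative_eq_intros simp: power2_eq_square)
    have drm: "((\<lambda>t. inverse (1 - t\<^sup>2) ^ m) has_real_derivative 2 * real m * t * r ^ (m + 1)) (at t)"
    \<comment> \<open>The power rule yields the exponent \<open>m - Suc 0\<close>, a truncated
      subtraction. For m = 0 the function is constant and is treated separately.\<close>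
    proof (cases m)
      case (Suc n)
      have rm: "r ^ (m + 1) = r ^ (m - Suc 0) * r\<^sup>2" by (simp add: Suc power2_eq_square)
      show ?thesis
        by (rule DERIV_cong[OF DERIV_power[OF dr]]) (simp only: rm r_def[symmetric] mult_ac)
    qed simp
    have dE: "((\<lambda>t. exp (- inverse (1 - t\<^sup>2))) has_real_derivative exp (- r) * - (2 * t * r\<^sup>2)) (at t)"
      using DERIV_fun_exp[OF DERIV_minus[OF dr]] by (simp add: r_def)
    have "((\<lambda>t. poly p t * inverse (1 - t\<^sup>2) ^ m * exp (- inverse (1 - t\<^sup>2))) has_real_derivative
       (poly p t * r ^ m) * (exp (- r) * - (2 * t * r\<^sup>2)) + (poly p t * (2 * real m * t * r ^ (m + 1)) + poly (pderiv p) t * r ^ m) * exp (- r)) (at t)"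
      using DERIV_mult'[OF DERIV_mult'[OF poly_DERIV drm] dE] by (simp add: r_def)
    moreover have "(poly p t * r ^ m) * (exp (- r) * - (2 * t * r\<^sup>2)) + (poly p t * (2 * real m * t * r ^ (m + 1)) + poly (pderiv p) t * r ^ m) * exp (- r)
       = poly (bump1_deriv p m) t * r ^ (m + 2) * exp (- r)"
    proof -
      have R: "r ^ (m + 2) = r ^ (m + 1) * r" "r ^ (m + 1) = r ^ m * r" by simp_all
      have 1: "r ^ (m + 2) * (1 - t\<^sup>2) = r ^ (m + 1)"
        unfolding R(1) mult.assoc rs by simp
      have "r ^ (m + 2) * (1 - t\<^sup>2)\<^sup>2 = (r ^ (m + 2) * (1 - t\<^sup>2)) * (1 - t\<^sup>2)"
        by (simp only: power2_eq_square[of "1 - t\<^sup>2"] mult.assoc)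
      then have 2: "r ^ (m + 2) * (1 - t\<^sup>2)\<^sup>2 = r ^ m"
        unfolding 1 unfolding R(2) mult.assoc rs by simp
      have distr: "(a * s\<^sup>2 + b * s - c) * q = a * (q * s\<^sup>2) + b * (q * s) - c * q" for a b c s q :: real
        by algebra
      have "poly (bump1_deriv p m) t * r ^ (m + 2) = poly (pderiv p) t * r ^ m
        + 2 * real m * t * poly p t * r ^ (m + 1) - 2 * t * poly p t * (r ^ m * r\<^sup>2)"
        unfolding poly_bump1_deriv distr 1 2 by (simp only: power_add)
      moreover have "(P * a) * (E * - (2 * t * r\<^sup>2)) + (P * (2 * real m * t * b) + P' * a) * E
        = (P' * a + 2 * real m * t * P * b - 2 * t * P * (a * r\<^sup>2)) * E" for P P' a b E :: real
        by algebra
      ultimately show ?thesis by simp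
    qed
    ultimately have "((\<lambda>t. poly p t * inverse (1 - t\<^sup>2) ^ m * exp (- inverse (1 - t\<^sup>2))) has_real_derivative
        bump1 (bump1_deriv p m) (m + 2) t) (at t)"
      using 1 by (simp add: bump1_def r_def)
    then show ?thesis
      by (rule has_field_derivative_transform_within_open[of _ _ _ "{-1<..<1}"])
         (use 1 in \<open>auto simp: bump1_def\<close>)
  next
    case 2
    then obtain C where "\<And>y. \<bar>bump1 p m y - bump1 p m t\<bar> \<le> C * (y - t)\<^sup>2"
      using bump1_quadratic_bound by blast
    then have "(bump1 p m has_real_derivative 0) (at t)" by (rule DERIV_zero_of_quadratic_bound)
    then show ?thesis using 2 by (simp add: bump1_def)
  next
    case 3
    have "((\<lambda>_. 0) has_real_derivative 0) (at t)" by simp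
    then have "(bump1 p m has_real_derivative 0) (at t)"
      by (rule has_field_derivative_transform_within_open[of _ _ _ "- {-1..1}"])
         (use 3 in \<open>auto simp: bump1_def open_Compl\<close>)
    then show ?thesis using 3 by (simp add: bump1_def)
  qed
qed

definition bump :: "('n::finite \<Rightarrow> real poly) \<Rightarrow> ('n \<Rightarrow> nat) \<Rightarrow> real^'n \<Rightarrow> real" where
  "bump p m x = (\<Prod>i\<in>UNIV. bump1 (p i) (m i) (x $ i))"

definition bump_partial :: "'n \<Rightarrow> ('n::finite \<Rightarrow> real poly) \<Rightarrow> ('n \<Rightarrow> nat) \<Rightarrow> real^'n \<Rightarrow> real" where
  "bump_partial j p m = bump (p(j := bump1_deriv (p j) (m j))) (m(j := m j + 2))"

lemma has_derivative_bump:
  "(bump p m has_derivative (\<lambda>h. (\<chi> j. bump_partial j p m x) \<bullet> h)) (at x)"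
proof -
  have "((\<lambda>x. bump1 (p i) (m i) (x $ i)) has_derivative (\<lambda>h. bump1 (bump1_deriv (p i) (m i)) (m i + 2) (x $ i) * h $ i)) (at x)" for i
    using has_derivative_compose[OF bounded_linear_imp_has_derivative[OF bounded_linear_vec_nth]
        DERIV_bump1[unfolded has_field_derivative_def]] .
  then have "(bump p m has_derivative (\<lambda>h. \<Sum>i\<in>UNIV. (bump1 (bump1_deriv (p i) (m i)) (m i + 2) (x $ i) * h $ i) *
      (\<Prod>j\<in>UNIV - {i}. bump1 (p j) (m j) (x $ j)))) (at x)"
    unfolding bump_def[abs_def] by (intro has_derivative_prod) auto
  moreover have "bump_partial i p m x = bump1 (bump1_deriv (p i) (m i)) (m i + 2) (x $ i) * (\<Prod>j\<in>UNIV - {i}. bump1 (p j) (m j) (x $ j))" for i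
    unfolding bump_partial_def bump_def by (subst prod.remove[of _ i]) auto
  ultimately show ?thesis by (simp add: inner_vec_def mult_ac)
qed

lemma continuous_on_bump: "continuous_on S (bump p m)"
  using has_derivative_continuous_on[OF has_derivative_at_withinI[OF has_derivative_bump]] .

lemma bump_eq_0:
  assumes "x \<notin> cbox (-1) 1" shows "bump p m x = 0"
proof -
  obtain i where "\<not> (-1 \<le> x $ i \<and> x $ i \<le> 1)" using assms by (auto simp: mem_box_cart)
  then have "bump1 (p i) (m i) (x $ i) = 0" by (auto simp: bump1_def)
  then show ?thesis unfolding bump_def by (intro prod_zero) auto
qed

text \<open>\<open>smooth\<close> speaks of all iterated partial derivatives at once; a class of
  functions closed under partial derivatives replaces an explicit formula for them.\<close>

lemma smooth_coinduct:
  assumes "C f" and "\<And>g x. C g \<Longrightarrow> g differentiable (at x)" and "\<And>g j. C g \<Longrightarrow> C (partial j g)"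
  shows "smooth f"
proof -
  have "C (iter_partial js f)" for js using assms(1,3) by (induction js) auto
  then show ?thesis unfolding smooth_def differentiable_on_def using assms(2) by simp
qed

lemma smooth_mult_const:
  fixes f :: "real^'n \<Rightarrow> real"
  assumes "smooth f" shows "smooth (\<lambda>x. f x * c)"
proof -
  have d: "iter_partial js f differentiable (at x)" for js x
    using assms unfolding smooth_def differentiable_on_def by auto
  show ?thesis
  proof (rule smooth_coinduct[of "\<lambda>g. \<exists>js. g = (\<lambda>x. iter_partial js f x * c)"])
    show "\<exists>js. (\<lambda>x. f x * c) = (\<lambda>x. iter_partial js f x * c)" by (rule exI[of _ "[]"]) simp
  next
    fix g x assume "\<exists>js. g = (\<lambda>x. iter_partial js f x * c)"
    then show "g differentiable (at x)" using d by auto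
  next
    fix g j assume "\<exists>js. g = (\<lambda>x. iter_partial js f x * c)"
    then obtain js where g: "g = (\<lambda>x. iter_partial js f x * c)" by blast
    have *: "partial j (\<lambda>x :: real^'n. c) x = 0" for x by (rule partial_eqI[OF has_derivative_const])
    have "partial j g = (\<lambda>x. iter_partial (j # js) f x * c)"
      using partial_mult[OF d differentiable_const] * unfolding g by (intro ext) simp
    then show "\<exists>js. partial j g = (\<lambda>x. iter_partial js f x * c)" by blast
  qed
qed

lemma has_derivative_integral_bump:
  fixes f :: "real^'n \<Rightarrow> real"
  assumes f: "continuous_on UNIV f"
  shows "((\<lambda>x. integral (cbox a b) (\<lambda>y. f y * bump p m (e *\<^sub>R (x - y)))) has_derivative
     (\<lambda>h. integral (cbox a b) (\<lambda>y. ((f y * e) *\<^sub>R (\<chi> j. bump_partial j p m (e *\<^sub>R (x - y)))) \<bullet> h))) (at x)"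
proof (rule has_derivative_integral_param)
  fix x y :: "real^'n"
  have "((\<lambda>x. e *\<^sub>R (x - y)) has_derivative (\<lambda>h. e *\<^sub>R h)) (at x)"
    by (auto intro!: derivative_eq_intros)
  from has_derivative_mult_right[OF has_derivative_compose[OF this has_derivative_bump]]
  have "((\<lambda>x. f y * bump p m (e *\<^sub>R (x - y))) has_derivative
     (\<lambda>h. f y * ((\<chi> j. bump_partial j p m (e *\<^sub>R (x - y))) \<bullet> (e *\<^sub>R h)))) (at x)" .
  then show "((\<lambda>x. f y * bump p m (e *\<^sub>R (x - y))) has_derivative
     (\<lambda>h. ((f y * e) *\<^sub>R (\<chi> j. bump_partial j p m (e *\<^sub>R (x - y)))) \<bullet> h)) (at x)"
    by (simp add: mult_ac)
next
  show "continuous_on (cbox a b) (\<lambda>y. f y * bump p m (e *\<^sub>R (x - y)))" for x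
    by (intro continuous_intros continuous_on_subset[OF f] continuous_on_compose2[OF continuous_on_bump[of UNIV]]) auto
  show "continuous_on UNIV (\<lambda>(x, y). (f y * e) *\<^sub>R (\<chi> j. bump_partial j p m (e *\<^sub>R (x - y))))"
    unfolding case_prod_beta bump_partial_def
    by (intro continuous_intros continuous_on_compose2[OF f] continuous_on_compose2[OF continuous_on_bump[of UNIV]]
        continuous_on_vec_lambda) auto
qed

text \<open>The invariant class consists of all such integrals with arbitrary constant, polynomials
  and exponents. A partial derivative multiplies the constant by \<open>e\<close> and changes the
  polynomial and the exponent of one coordinate.\<close>

lemma smooth_integral_bump:
  fixes f :: "real^'n \<Rightarrow> real"
  assumes f: "continuous_on UNIV f"
  shows "smooth (\<lambda>x. c * integral (cbox a b) (\<lambda>y. f y * bump p m (e *\<^sub>R (x - y))))"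
proof (rule smooth_coinduct[of "\<lambda>g. \<exists>c p m. g = (\<lambda>x. c * integral (cbox a b) (\<lambda>y. f y * bump p m (e *\<^sub>R (x - y))))"])
  show "\<exists>c' p' m'. (\<lambda>x. c * integral (cbox a b) (\<lambda>y. f y * bump p m (e *\<^sub>R (x - y)))) =
     (\<lambda>x. c' * integral (cbox a b) (\<lambda>y. f y * bump p' m' (e *\<^sub>R (x - y))))" by blast
next
  fix g :: "real^'n \<Rightarrow> real" and x
  assume "\<exists>c p m. g = (\<lambda>x. c * integral (cbox a b) (\<lambda>y. f y * bump p m (e *\<^sub>R (x - y))))"
  then show "g differentiable (at x)"
    using has_derivative_mult_right[OF has_derivative_integral_bump[OF f]] differentiableI by blast
next
  fix g :: "real^'n \<Rightarrow> real" and j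
  assume "\<exists>c p m. g = (\<lambda>x. c * integral (cbox a b) (\<lambda>y. f y * bump p m (e *\<^sub>R (x - y))))"
  then obtain c p m where g: "g = (\<lambda>x. c * integral (cbox a b) (\<lambda>y. f y * bump p m (e *\<^sub>R (x - y))))" by blast
  have "partial j g = (\<lambda>x. (c * e) * integral (cbox a b) (\<lambda>y. f y * bump (p(j := bump1_deriv (p j) (m j))) (m(j := m j + 2)) (e *\<^sub>R (x - y))))"
  proof
    fix x
    have "partial j g x = c * integral (cbox a b) (\<lambda>y. ((f y * e) *\<^sub>R (\<chi> j. bump_partial j p m (e *\<^sub>R (x - y)))) \<bullet> axis j 1)"
      unfolding g by (rule partial_eqI) (rule has_derivative_mult_right[OF has_derivative_integral_bump[OF f]])
    also have "\<dots> = c * integral (cbox a b) (\<lambda>y. e * (f y * bump_partial j p m (e *\<^sub>R (x - y))))"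
      by (simp add: inner_axis mult_ac)
    finally show "partial j g x = (c * e) * integral (cbox a b) (\<lambda>y. f y * bump (p(j := bump1_deriv (p j) (m j))) (m(j := m j + 2)) (e *\<^sub>R (x - y)))"
      unfolding bump_partial_def by simp
  qed
  then show "\<exists>c p m. partial j g = (\<lambda>x. c * integral (cbox a b) (\<lambda>y. f y * bump p m (e *\<^sub>R (x - y))))" by blast
qed

section \<open>Convolution with the normalized bump\<close>

definition std_bump :: "real^'n::finite \<Rightarrow> real" where
  "std_bump = bump (\<lambda>_. 1) (\<lambda>_. 0)"

lemma continuous_on_std_bump: "continuous_on S std_bump"
  unfolding std_bump_def by (rule continuous_on_bump)

lemma std_bump_nonneg: "0 \<le> std_bump x"
  unfolding std_bump_def bump_def by (intro prod_nonneg) (auto simp: bump1_def)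

lemma integral_std_bump_pos: "0 < integral (cbox (-1) 1) (std_bump :: real^'n::finite \<Rightarrow> real)"
proof -
  let ?\<eta> = "std_bump :: real^'n \<Rightarrow> real"
  have "0 \<in> box (-1) (1 :: real^'n)" by (simp add: mem_box_cart)
  then have "box (-1) (1 :: real^'n) \<noteq> {}" by blast
  moreover have "?\<eta> 0 \<noteq> 0" unfolding std_bump_def bump_def by (simp add: bump1_def)
  moreover have "0 \<in> cbox (-1) (1 :: real^'n)" by (simp add: mem_box_cart)
  ultimately have "integral (cbox (-1) 1) ?\<eta> \<noteq> 0"
    using integral_cbox_eq_0_iff[OF continuous_on_std_bump _ std_bump_nonneg] by blast
  moreover have "0 \<le> integral (cbox (-1) 1) ?\<eta>"
    by (intro integral_nonneg integrable_continuous continuous_on_std_bump std_bump_nonneg)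
  ultimately show ?thesis by simp
qed

definition mollify :: "real \<Rightarrow> (real^'n::finite \<Rightarrow> real) \<Rightarrow> real^'n \<Rightarrow> real" where
  "mollify e f x = integral (cbox (-1) 1) (\<lambda>t. f (x - e *\<^sub>R t) * std_bump t) / integral (cbox (-1) 1) (std_bump :: real^'n \<Rightarrow> real)"

lemma continuous_on_mollify_integrand:
  fixes f :: "real^'n::finite \<Rightarrow> real"
  assumes "continuous_on UNIV f"
  shows "continuous_on S (\<lambda>t. f (x - e *\<^sub>R t) * std_bump t)"
  by (intro continuous_intros continuous_on_compose2[OF assms] continuous_on_std_bump) auto

text \<open>The integral depends continuously on the scale even at 0, where normalization gives back
  \<open>f x\<close>. Convergence is thus continuity in a parameter.\<close>

lemma mollify_tendsto:
  fixes f :: "real^'n::finite \<Rightarrow> real"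
  assumes f: "continuous_on UNIV f" and e: "e \<longlonglongrightarrow> 0"
  shows "(\<lambda>n. mollify (e n) f x) \<longlonglongrightarrow> f x"
proof -
  let ?F = "\<lambda>e. integral (cbox (-1) 1) (\<lambda>t. f (x - e *\<^sub>R t) * std_bump t)"
  have "continuous_on UNIV ?F"
    by (intro integral_continuous_on_param)
       (auto simp: case_prod_beta intro!: continuous_intros continuous_on_compose2[OF f] continuous_on_compose2[OF continuous_on_std_bump[of UNIV]])
  then have "isCont ?F 0" by (simp add: continuous_on_eq_continuous_at)
  then have "(\<lambda>n. ?F (e n)) \<longlonglongrightarrow> ?F 0" using e by (rule isCont_tendsto_compose)
  then have "(\<lambda>n. mollify (e n) f x) \<longlonglongrightarrow> ?F 0 / integral (cbox (-1) 1) (std_bump :: real^'n \<Rightarrow> real)"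
    unfolding mollify_def using integral_std_bump_pos[where 'n = 'n] by (intro tendsto_divide) auto
  then show ?thesis using integral_std_bump_pos[where 'n = 'n] by simp
qed

text \<open>Mollification averages with nonnegative weights of total mass one.\<close>

lemma mollify_bound:
  fixes f :: "real^'n::finite \<Rightarrow> real"
  assumes f: "continuous_on UNIV f" and C: "\<And>x. \<bar>f x\<bar> \<le> C"
  shows "\<bar>mollify e f x\<bar> \<le> C"
proof -
  let ?I = "integral (cbox (-1) 1) (std_bump :: real^'n \<Rightarrow> real)"
  have "norm (integral (cbox (-1) 1) (\<lambda>t. f (x - e *\<^sub>R t) * std_bump t)) \<le> integral (cbox (-1) 1) (\<lambda>t :: real^'n. C * std_bump t)"
  proof (rule integral_norm_bound_integral)
    fix t :: "real^'n"
    show "norm (f (x - e *\<^sub>R t) * std_bump t) \<le> C * std_bump t"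
      using C std_bump_nonneg[of t] by (simp add: abs_mult mult_right_mono)
  qed (intro integrable_continuous continuous_on_mollify_integrand f continuous_intros continuous_on_std_bump)+
  then have "\<bar>integral (cbox (-1) 1) (\<lambda>t. f (x - e *\<^sub>R t) * std_bump t)\<bar> \<le> C * ?I" by simp
  then show ?thesis
    unfolding mollify_def using integral_std_bump_pos[where 'n = 'n] by (simp add: abs_divide divide_le_eq)
qed

text \<open>In the definition the derivatives fall on \<open>f\<close>, in the convolution form below on the bump.\<close>

lemma mollify_eq_convolution:
  fixes f :: "real^'n::finite \<Rightarrow> real"
  assumes f: "continuous_on UNIV f" and e: "e > 0" and supp: "\<And>x. x \<notin> cbox a b \<Longrightarrow> f x = 0"
  shows "mollify e f x = (inverse (e ^ CARD('n)) / integral (cbox (-1) 1) (std_bump :: real^'n \<Rightarrow> real)) *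
     integral (cbox a b) (\<lambda>y. f y * std_bump (inverse e *\<^sub>R (x - y)))"
proof -
  define h where "h y = f y * std_bump (inverse e *\<^sub>R (x - y))" for y
  \<comment> \<open>The image of the unit cube under the substitution y = x - e t. The integrand
    vanishes outside this box and outside \<open>cbox a b\<close>, so either one can be the domain
    of integration.\<close>
  let ?B = "cbox (x - e *\<^sub>R 1) (x + e *\<^sub>R 1)"
  have ch: "continuous_on S h" for S
    unfolding h_def by (intro continuous_intros continuous_on_subset[OF f] continuous_on_compose2[OF continuous_on_std_bump[of UNIV]]) auto
  have zero1: "h y = 0" if "y \<notin> ?B" for y
  proof -
    have "inverse e *\<^sub>R (x - y) \<notin> cbox (-1) 1"
    proof
      assume "inverse e *\<^sub>R (x - y) \<in> cbox (-1) 1"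
      then have "\<bar>inverse e * (x $ i - y $ i)\<bar> \<le> 1" for i by (auto simp: mem_box_cart abs_le_iff)
      then have "\<bar>x $ i - y $ i\<bar> \<le> e" for i
        using e by (auto simp: abs_mult divide_simps)
      then have "x $ i - e \<le> y $ i \<and> y $ i \<le> x $ i + e" for i by (smt (verit))
      then show False using that by (auto simp: mem_box_cart)
    qed
    then show ?thesis unfolding h_def std_bump_def by (simp add: bump_eq_0)
  qed
  have zero2: "h y = 0" if "y \<notin> cbox a b" for y using supp[OF that] by (simp add: h_def)
  have "integral ?B h = integral UNIV (\<lambda>y. if y \<in> ?B then h y else 0)" by (rule integral_restrict_UNIV[symmetric])
  also have "(\<lambda>y. if y \<in> ?B then h y else 0) = (\<lambda>y. if y \<in> cbox a b then h y else 0)"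
    using zero1 zero2 by auto
  also have "integral UNIV \<dots> = integral (cbox a b) h" by (rule integral_restrict_UNIV)
  finally have eq: "integral ?B h = integral (cbox a b) h" .
  have "(h has_integral integral ?B h) ?B" by (intro integrable_integral integrable_continuous ch)
  from has_integral_affinity[OF this, of "- e" x]
  have "((\<lambda>t. h (- e *\<^sub>R t + x)) has_integral (1 / e ^ CARD('n)) *\<^sub>R integral ?B h)
     ((\<lambda>y. (1 / - e) *\<^sub>R y + - ((1 / - e) *\<^sub>R x)) ` ?B)"
    using e by simp
  also have "(\<lambda>y. (1 / - e) *\<^sub>R y + - ((1 / - e) *\<^sub>R x)) ` ?B = cbox (-1) 1"
  proof -
    have "(1 / - e) *\<^sub>R (x + e *\<^sub>R 1) + - ((1 / - e) *\<^sub>R x) = -1"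
      "(1 / - e) *\<^sub>R (x - e *\<^sub>R 1) + - ((1 / - e) *\<^sub>R x) = 1"
      using e by (simp_all add: vec_eq_iff field_simps)
    moreover have "?B \<noteq> {}"
    proof -
      have "x \<in> ?B" using e by (simp add: mem_box_cart)
      then show ?thesis by blast
    qed
    moreover have "\<not> 0 \<le> 1 / - e" using e by (simp add: field_simps)
    ultimately show ?thesis unfolding image_affinity_cbox by (simp only: if_False)
  qed
  also have "(\<lambda>t. h (- e *\<^sub>R t + x)) = (\<lambda>t. f (x - e *\<^sub>R t) * std_bump t)"
    using e by (simp add: h_def)
  finally have "integral (cbox (-1) 1) (\<lambda>t. f (x - e *\<^sub>R t) * std_bump t) = (1 / e ^ CARD('n)) *\<^sub>R integral ?B h"
    by (rule integral_unique)
  then show ?thesis unfolding mollify_def eq unfolding h_def by (simp add: divide_inverse mult_ac)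
qed

lemma smooth_mollify:
  fixes f :: "real^'n::finite \<Rightarrow> real"
  assumes f: "continuous_on UNIV f" and e: "e > 0" and supp: "\<And>x. x \<notin> cbox a b \<Longrightarrow> f x = 0"
  shows "smooth (mollify e f)"
proof -
  have "mollify e f = (\<lambda>x. (inverse (e ^ CARD('n)) / integral (cbox (-1) 1) (std_bump :: real^'n \<Rightarrow> real)) *
     integral (cbox a b) (\<lambda>y. f y * bump (\<lambda>_. 1) (\<lambda>_. 0) (inverse e *\<^sub>R (x - y))))"
    using mollify_eq_convolution[OF f e, of a b] supp by (intro ext) (simp only: std_bump_def not_False_eq_True)
  then show ?thesis by (simp only: smooth_integral_bump[OF f])
qed

lemma partial_mollify:
  fixes f :: "real^'n::finite \<Rightarrow> real"
  assumes f: "c1 UNIV f"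
  shows "partial j (mollify e f) x = mollify e (partial j f) x"
proof -
  have "((\<lambda>x. integral (cbox (-1) 1) (\<lambda>t. f (x - e *\<^sub>R t) * std_bump t)) has_derivative
    (\<lambda>h. integral (cbox (-1) 1) (\<lambda>t. (std_bump t *\<^sub>R (\<chi> j. partial j f (x - e *\<^sub>R t))) \<bullet> h))) (at x)"
  proof (rule has_derivative_integral_param)
    fix x t :: "real^'n"
    have "((\<lambda>x. x - e *\<^sub>R t) has_derivative (\<lambda>h. h)) (at x)" by (auto intro!: derivative_eq_intros)
    from has_derivative_mult_left[OF has_derivative_compose[OF this has_derivative_gradient[OF c1_differentiable[OF f UNIV_I]]]]
    have "((\<lambda>x. f (x - e *\<^sub>R t) * std_bump t) has_derivative
      (\<lambda>h. ((\<chi> j. partial j f (x - e *\<^sub>R t)) \<bullet> h) * std_bump t)) (at x)" .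
    then show "((\<lambda>x. f (x - e *\<^sub>R t) * std_bump t) has_derivative
      (\<lambda>h. (std_bump t *\<^sub>R (\<chi> j. partial j f (x - e *\<^sub>R t))) \<bullet> h)) (at x)"
      by (simp add: mult_ac)
  next
    show "continuous_on (cbox (-1) 1) (\<lambda>t. f (x - e *\<^sub>R t) * std_bump t)" for x
      by (rule continuous_on_mollify_integrand[OF c1_continuous_on[OF f]])
    show "continuous_on UNIV (\<lambda>(x, t). std_bump t *\<^sub>R (\<chi> j. partial j f (x - e *\<^sub>R t)))"
      unfolding case_prod_beta
      by (intro continuous_intros continuous_on_vec_lambda continuous_on_compose2[OF continuous_on_partial[OF f]]
          continuous_on_compose2[OF continuous_on_std_bump[of UNIV]]) auto
  qed
  from partial_eqI[OF has_derivative_mult_right[OF this], of j "inverse (integral (cbox (-1) 1) (std_bump :: real^'n \<Rightarrow> real))"]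
  show ?thesis
    unfolding mollify_def[abs_def] divide_inverse
    by (simp only: inner_axis vector_scaleR_component vec_lambda_beta inner_real_def real_scaleR_def mult_1_left mult_1_right mult.commute)
qed

text \<open>Points of the cube have l1-norm, hence Euclidean norm, at most the dimension; this is
  the origin of the factor \<open>CARD('n)\<close>.\<close>

lemma mollify_eq_0:
  fixes f :: "real^'n::finite \<Rightarrow> real" and e :: real
  assumes e: "e > 0" and supp: "\<And>x. x \<notin> K \<Longrightarrow> f x = 0" and K: "K \<noteq> {}"
    and x: "infdist x K > e * CARD('n)"
  shows "mollify e f x = 0"
proof -
  have zero: "f (x - e *\<^sub>R t) = 0" if "t \<in> cbox (-1) 1" for t
  proof (rule supp, rule notI)
    assume "x - e *\<^sub>R t \<in> K"
    then have "infdist x K \<le> dist x (x - e *\<^sub>R t)" by (rule infdist_le)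
    also have "\<dots> = e * norm t" using e by (simp add: dist_norm)
    also have "norm t \<le> (\<Sum>i\<in>UNIV. \<bar>t $ i\<bar>)" by (rule norm_le_l1_cart)
    also have "\<dots> \<le> (\<Sum>i\<in>(UNIV :: 'n set). 1)"
      using that by (intro sum_mono) (auto simp: mem_box_cart abs_le_iff)
    finally show False using x e by simp
  qed
  have "integral (cbox (-1) 1) (\<lambda>t. f (x - e *\<^sub>R t) * std_bump t) = integral (cbox (-1) 1) (\<lambda>t :: real^'n. 0)"
    by (rule Henstock_Kurzweil_Integration.integral_cong) (simp add: zero)
  then show ?thesis unfolding mollify_def by simp
qed

lemma bounded_of_compact_support:
  fixes f :: "'a::topological_space \<Rightarrow> real"
  assumes "continuous_on UNIV f" "compact K" "\<And>x. x \<notin> K \<Longrightarrow> f x = 0"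
  obtains C where "\<And>x. \<bar>f x\<bar> \<le> C"
proof -
  have "bounded (f ` K)"
    by (intro compact_imp_bounded compact_continuous_image continuous_on_subset[OF assms(1)] assms(2)) simp
  then obtain C where C: "\<And>x. x \<in> K \<Longrightarrow> \<bar>f x\<bar> \<le> C" unfolding bounded_iff by auto
  have "\<bar>f x\<bar> \<le> max C 0" for x using C[of x] assms(3)[of x] by (cases "x \<in> K") auto
  then show thesis by (rule that)
qed

text \<open>The bounds uniform in n are there for dominated convergence. They hold because
  mollification is an average that commutes with partial derivatives.\<close>

lemma smooth_approximation:
  fixes f :: "real^'n::finite \<Rightarrow> real"
  assumes f: "c1 UNIV f" and supp: "\<forall>x. x \<notin> cbox a b \<longrightarrow> f x = 0"
    and \<Omega>: "open \<Omega>" "cbox a b \<subseteq> \<Omega>"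
  obtains F C where "\<And>n. smooth (F n)"
    "\<And>n :: nat. compact (closure {x. F n x \<noteq> 0})" "\<And>n. closure {x. F n x \<noteq> 0} \<subseteq> \<Omega>"
    "\<And>x. (\<lambda>n. F n x) \<longlonglongrightarrow> f x" "\<And>x j. (\<lambda>n. partial j (F n) x) \<longlonglongrightarrow> partial j f x"
    "\<And>n x. \<bar>F n x\<bar> \<le> C" "\<And>n x j. \<bar>partial j (F n) x\<bar> \<le> C"
proof (cases "cbox a b = {}")
  \<comment> \<open>\<open>infdist\<close> to the empty set is 0 by convention, so the neighbourhood
    argument used for the other case says nothing here.\<close>
  case True
  then have f0: "f = (\<lambda>x. 0)" using supp by auto
  have p0: "partial j (\<lambda>x :: real^'n. 0) x = 0" for j x by (rule partial_eqI[OF has_derivative_const])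
  have "smooth (\<lambda>x :: real^'n. 0)"
    by (rule smooth_coinduct[of "\<lambda>g. g = (\<lambda>x. 0)"]) (auto simp: p0)
  then show thesis by (intro that[of "\<lambda>n x. 0" 0]) (auto simp: f0 p0)
next
  case ne: False
  let ?K = "cbox a b"
  have cf: "continuous_on UNIV f" using c1_continuous_on[OF f] .
  obtain d where d: "d > 0" "(\<Union>x\<in>?K. ball x d) \<subseteq> \<Omega>"
    using compact_subset_open_imp_ball_epsilon_subset[OF compact_cbox \<Omega>] by blast
  \<comment> \<open>Chosen so that scale times dimension is at most d / 2. All mollified functions
    are then supported in the closed d / 2 neighbourhood of the box, which is compact and inside
    Omega.\<close>
  define c where "c = d / (2 * real CARD('n))"
  have c: "c > 0" "c * real CARD('n) = d / 2" using d(1) by (simp_all add: c_def)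
  define e where "e n = c * inverse (real (Suc n))" for n
  have e: "e n > 0" for n unfolding e_def using c(1) by (intro mult_pos_pos) simp_all
  have e_le: "e n * real CARD('n) \<le> d / 2" for n
  proof -
    have "e n * real CARD('n) = (d / 2) * inverse (real (Suc n))"
      unfolding e_def c(2)[symmetric] by (simp only: mult_ac)
    also have "\<dots> \<le> (d / 2) * 1" using d(1) by (intro mult_left_mono) (simp_all add: inverse_le_1_iff)
    finally show ?thesis by simp
  qed
  have e0: "e \<longlonglongrightarrow> 0"
  proof -
    have "e \<longlonglongrightarrow> c * 0"
      unfolding e_def[abs_def] by (rule tendsto_mult_left[OF LIMSEQ_inverse_real_of_nat])
    then show ?thesis by simp
  qed
  define K' where "K' = {x. infdist x ?K \<le> d / 2}"
  have K': "compact K'" unfolding K'_def by (rule compact_infdist_le) (use ne d in auto)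
  have K'_sub: "K' \<subseteq> \<Omega>"
  proof
    fix x assume "x \<in> K'"
    obtain y where y: "y \<in> ?K" "infdist x ?K = dist x y"
      using infdist_attains_inf[of ?K x] ne by auto
    then have "x \<in> ball y d" using \<open>x \<in> K'\<close> d by (simp add: K'_def dist_commute)
    then show "x \<in> \<Omega>" using d y by blast
  qed
  have "{x. mollify (e n) f x \<noteq> 0} \<subseteq> K'" for n
  proof
    fix x assume "x \<in> {x. mollify (e n) f x \<noteq> 0}"
    moreover have "mollify (e n) f x = 0" if "e n * CARD('n) < infdist x ?K"
      by (rule mollify_eq_0[OF e _ ne that]) (rule supp[rule_format])
    ultimately have "\<not> e n * CARD('n) < infdist x ?K" by blast
    then show "x \<in> K'" using e_le[of n] unfolding K'_def by simp
  qed
  then have cl: "closure {x. mollify (e n) f x \<noteq> 0} \<subseteq> K'" for n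
    using K' by (intro closure_minimal compact_imp_closed)
  obtain C0 where C0: "\<And>x. \<bar>f x\<bar> \<le> C0"
    by (rule bounded_of_compact_support[OF cf compact_cbox[of a b]]) (use supp in auto)
  have "\<exists>C. \<forall>x. \<bar>partial j f x\<bar> \<le> C" for j
  proof -
    have "partial j f x = 0" if "x \<notin> ?K" for x
      by (rule partial_zero_outside[OF closed_cbox _ that]) (rule supp[rule_format])
    then show ?thesis
      using bounded_of_compact_support[OF continuous_on_partial[OF f, of j] compact_cbox[of a b]] by metis
  qed
  then obtain C1 where C1: "\<And>j x. \<bar>partial j f x\<bar> \<le> C1 j" by metis
  have C1_nonneg: "0 \<le> C1 j" for j using C1[of j 0] by linarith
  have C1': "\<bar>partial j f x\<bar> \<le> (\<Sum>j\<in>UNIV. C1 j)" for j x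
    by (rule order_trans[OF C1]) (intro member_le_sum C1_nonneg; simp)
  let ?C = "C0 + (\<Sum>j\<in>UNIV. C1 j)"
  have C0_nonneg: "0 \<le> C0" using C0[of 0] by linarith
  have sC1: "0 \<le> (\<Sum>j\<in>UNIV. C1 j)" by (intro sum_nonneg C1_nonneg)
  show thesis
  proof (rule that[of "\<lambda>n. mollify (e n) f" ?C])
    fix n :: nat and x j
    show "smooth (mollify (e n) f)" by (rule smooth_mollify[OF cf e]) (rule supp[rule_format])
    show "compact (closure {x. mollify (e n) f x \<noteq> 0})"
      using compact_Int_closed[OF K' closed_closure] cl[of n] by (metis inf.absorb2)
    show "closure {x. mollify (e n) f x \<noteq> 0} \<subseteq> \<Omega>" using cl K'_sub by blast
    show "(\<lambda>n. mollify (e n) f x) \<longlonglongrightarrow> f x" by (rule mollify_tendsto[OF cf e0])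
    show "(\<lambda>n. partial j (mollify (e n) f) x) \<longlonglongrightarrow> partial j f x"
      unfolding partial_mollify[OF f] by (rule mollify_tendsto[OF continuous_on_partial[OF f] e0])
    show "\<bar>mollify (e n) f x\<bar> \<le> ?C" 
      by (rule order_trans[OF mollify_bound[OF cf C0]]) (use sC1 in simp)
    show "\<bar>partial j (mollify (e n) f) x\<bar> \<le> ?C"
      unfolding partial_mollify[OF f]
      by (rule order_trans[OF mollify_bound[OF continuous_on_partial[OF f] C1']]) (use C0_nonneg in simp)
  qed
qed

section \<open>The boundary identity\<close>

lemma c1_wedge:
  assumes "\<And>i. i < k \<Longrightarrow> c1 S (v i)"
  shows "c1 S (\<lambda>x. wedge k (\<lambda>i. v i x) is)"
  using assms by (cases "length is = k")
    (auto simp: wedge_def intro!: c1_const c1_sum c1_mult c1_prod c1_nth)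

lemma component_le_mvnorm:
  assumes "length is = h" shows "\<bar>u is\<bar> \<le> mvnorm h u"
proof -
  have "(u is)\<^sup>2 \<le> (\<Sum>is | length is = h. (u is)\<^sup>2)"
    using assms by (intro member_le_sum) auto
  then show ?thesis unfolding mvnorm_def by (rule real_le_rsqrt[of "\<bar>_\<bar>", simplified])
qed

lemma mvnorm_nonneg: "0 \<le> mvnorm h u"
  unfolding mvnorm_def by (intro real_sqrt_ge_zero sum_nonneg) auto

lemma alternating_cmult:
  assumes "alternating h u" shows "alternating h (\<lambda>is. c * u is)"
  unfolding alternating_def
proof (intro conjI allI impI)
  fix "is" :: "'a list" assume "length is \<noteq> h"
  then have "u is = 0" using assms unfolding alternating_def by blast
  then show "c * u is = 0" by simp
next
  fix "is" :: "'a list" and a b assume "a < b \<and> b < length is"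
  then have "u (is[a := is ! b, b := is ! a]) = - u is" using assms unfolding alternating_def by blast
  then show "c * u (is[a := is ! b, b := is ! a]) = - (c * u is)" by simp
qed

text \<open>The parameter is the degree h = k - 1 of the boundary, which avoids subtraction.
  \<open>M\<close> and \<open>\<sigma>\<close> are the total variation and the sign of mu;
  \<open>M'\<close> and \<open>\<tau>\<close> are mu' and tau'.\<close>

locale normal_current =
  fixes h :: nat and \<Omega> :: "(real^'n::finite) set"
    and v :: "nat \<Rightarrow> real^'n \<Rightarrow> real^'n"
    and M :: "(real^'n) measure" and \<sigma> :: "real^'n \<Rightarrow> real"
    and M' :: "(real^'n) measure" and \<tau> :: "real^'n \<Rightarrow> 'n mvec"
  assumes open_\<Omega>: "open \<Omega>"
    and v_c1: "\<And>i. i < Suc h \<Longrightarrow> c1 \<Omega> (v i)"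
    and sets_M [measurable_cong, simp]: "sets M = sets borel" and finite_M: "finite_measure M"
    and \<sigma> [measurable]: "\<sigma> \<in> borel_measurable borel" and \<sigma>_abs: "\<And>x. \<bar>\<sigma> x\<bar> = 1"
    and sets_M' [measurable_cong, simp]: "sets M' = sets borel" and finite_M': "finite_measure M'"
    and \<tau>_alt: "\<And>x. alternating h (\<tau> x)"
    and \<tau> [measurable]: "\<And>is. (\<lambda>x. \<tau> x is) \<in> borel_measurable borel"
    and int_M: "set_integrable M \<Omega> (\<lambda>x. mvnorm (Suc h) (wedge (Suc h) (\<lambda>i. v i x)))"
    and int_M': "set_integrable M' \<Omega> (\<lambda>x. mvnorm h (\<tau> x))"
    and bdry: "\<And>\<phi>. test_form \<Omega> h \<phi> \<Longrightarrow>
         (\<integral>x\<in>\<Omega>. \<sigma> x * pair (Suc h) (dform (Suc h) \<phi> x) (wedge (Suc h) (\<lambda>i. v i x)) \<partial>M)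
       = (\<integral>x\<in>\<Omega>. pair h (\<phi> x) (\<tau> x) \<partial>M')"
begin

definition V :: "real^'n \<Rightarrow> 'n mvec" where "V x = wedge (Suc h) (\<lambda>i. v i x)"

lemma alternating_V: "alternating (Suc h) (V x)"
  unfolding V_def by (rule alternating_wedge)

lemma continuous_on_V: "continuous_on \<Omega> (\<lambda>x. V x is)"
  unfolding V_def by (intro c1_continuous_on c1_wedge v_c1)

lemma measurable_on_\<Omega>:
  fixes f :: "real^'n \<Rightarrow> real"
  shows "continuous_on \<Omega> f \<Longrightarrow> (\<lambda>x. indicator \<Omega> x * f x) \<in> borel_measurable borel"
  using borel_measurable_continuous_on_indicator[of \<Omega> f] open_\<Omega> by simp

text \<open>Up to the factor (h + 1)!, the pairing of v with d(f A), where \<open>A\<close> is the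
  wedge of the basis vectors given by \<open>js\<close>.\<close>

definition bdry_density :: "(real^'n \<Rightarrow> real) \<Rightarrow> 'n list \<Rightarrow> real^'n \<Rightarrow> real" where
  "bdry_density f js x = (\<Sum>i\<in>UNIV. partial i f x * V x (i # js))"

text \<open>The test form is f times a constant h-covector. The left side acquires h! from
  \<open>pair_wedge_axis\<close> and h + 1 from \<open>pair_dform_const\<close>, the right side only
  h!. Hence the constant h + 1 that is carried from here on.\<close>

lemma boundary_smooth:
  assumes f: "smooth f" and supp: "compact (closure {x. f x \<noteq> 0})" "closure {x. f x \<noteq> 0} \<subseteq> \<Omega>"
    and js: "length js = h"
  shows "real (Suc h) * (\<integral>x\<in>\<Omega>. \<sigma> x * bdry_density f js x \<partial>M) = (\<integral>x\<in>\<Omega>. f x * \<tau> x js \<partial>M')"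
proof -
  define A :: "'n mvec" where "A = wedge h (\<lambda>a. axis (js ! a) 1)"
  define \<phi> where "\<phi> x = (\<lambda>is. f x * A is)" for x
  have alt: "alternating h A" unfolding A_def by (rule alternating_wedge)
  have sub: "{x. \<exists>is. \<phi> x is \<noteq> 0} \<subseteq> {x. f x \<noteq> 0}" by (auto simp: \<phi>_def)
  have cl: "closure {x. \<exists>is. \<phi> x is \<noteq> 0} \<subseteq> closure {x. f x \<noteq> 0}" by (rule closure_mono[OF sub])
  have "test_form \<Omega> h \<phi>"
    unfolding test_form_def
  proof (intro conjI allI)
    show "alternating h (\<phi> x)" for x
      unfolding \<phi>_def by (rule alternating_cmult[OF alt])
    show "smooth (\<lambda>x. \<phi> x is)" for "is" unfolding \<phi>_def by (rule smooth_mult_const[OF f])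
    show "compact (closure {x. \<exists>is. \<phi> x is \<noteq> 0})"
      using compact_Int_closed[OF supp(1) closed_closure[of "{x. \<exists>is. \<phi> x is \<noteq> 0}"]] cl by (simp add: Int_absorb1)
    show "closure {x. \<exists>is. \<phi> x is \<noteq> 0} \<subseteq> \<Omega>" using cl supp(2) by blast
  qed
  then have "(\<integral>x\<in>\<Omega>. \<sigma> x * pair (Suc h) (dform (Suc h) \<phi> x) (V x) \<partial>M) = (\<integral>x\<in>\<Omega>. pair h (\<phi> x) (\<tau> x) \<partial>M')"
    unfolding V_def by (rule bdry)
  moreover have "pair (Suc h) (dform (Suc h) \<phi> x) (V x) = fact h * (real (Suc h) * bdry_density f js x)" for x
  proof -
    have "f differentiable (at x)" using f[unfolded smooth_def, rule_format, of "[]"] by (simp add: differentiable_on_def)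
    then have p: "partial j (\<lambda>y. f y * c) x = partial j f x * c" for j c
      using partial_mult[of f x "\<lambda>_. c" j] partial_eqI[OF has_derivative_const, of j c x] by simp
    have d: "dform (Suc h) \<phi> x is = (\<Sum>a<Suc h. (-1) ^ a * (partial (is ! a) f x * A (take a is @ drop (Suc a) is)))"
      if "length is = Suc h" for "is"
      using that by (simp only: dform_def \<phi>_def p if_True refl)
    have "pair (Suc h) (dform (Suc h) \<phi> x) (V x) = (\<Sum>is | length is = Suc h.
        (\<Sum>a<Suc h. (-1) ^ a * (partial (is ! a) f x * A (take a is @ drop (Suc a) is))) * V x is)"
      unfolding pair_def by (intro sum.cong refl) (simp only: d mem_Collect_eq)
    also have "\<dots> = real (Suc h) * (\<Sum>i\<in>UNIV. partial i f x * pair h A (\<lambda>js. V x (i # js)))"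
      by (rule pair_dform_const[OF alternating_V])
    finally have "pair (Suc h) (dform (Suc h) \<phi> x) (V x)
        = real (Suc h) * (\<Sum>i\<in>UNIV. partial i f x * pair h A (\<lambda>js. V x (i # js)))" .
    moreover have "pair h A (\<lambda>js. V x (i # js)) = fact h * V x (i # js)" for i
      unfolding A_def by (rule pair_wedge_axis[OF alternating_Cons[OF alternating_V] js])
    ultimately have "pair (Suc h) (dform (Suc h) \<phi> x) (V x)
        = real (Suc h) * (\<Sum>i\<in>UNIV. fact h * (partial i f x * V x (i # js)))"
      by (simp only: mult.left_commute)
    then show ?thesis
      by (simp only: bdry_density_def sum_distrib_left[symmetric] mult.left_commute)
  qed
  moreover have "pair h (\<phi> x) (\<tau> x) = fact h * (f x * \<tau> x js)" for x
  proof -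
    have "pair h (\<phi> x) (\<tau> x) = f x * pair h A (\<tau> x)"
      unfolding pair_def \<phi>_def by (simp add: sum_distrib_left mult.assoc)
    also have "pair h A (\<tau> x) = fact h * \<tau> x js" unfolding A_def by (rule pair_wedge_axis[OF \<tau>_alt js])
    finally show ?thesis by simp
  qed
  moreover have "\<sigma> x * (fact h * (real (Suc h) * c)) = fact h * (real (Suc h) * (\<sigma> x * c))" for x c
    by (simp only: mult_ac)
  ultimately have "(\<integral>x\<in>\<Omega>. fact h * (real (Suc h) * (\<sigma> x * bdry_density f js x)) \<partial>M) = (\<integral>x\<in>\<Omega>. fact h * (f x * \<tau> x js) \<partial>M')"
    by (simp only:)
  moreover have "(\<integral>x\<in>\<Omega>. c * F x \<partial>N) = c * (\<integral>x\<in>\<Omega>. F x \<partial>N)" for c :: real and F and N :: "(real^'n) measure"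
    by (simp only: set_lebesgue_integral_def mult_scaleR_right[symmetric] integral_mult_right_zero)
  ultimately show ?thesis by (simp only: mult_cancel_left fact_nonzero simp_thms)
qed

lemma bdry_density_bound:
  fixes C :: real
  assumes "length js = h" "\<And>j. \<bar>partial j f x\<bar> \<le> C"
  shows "\<bar>\<sigma> x * bdry_density f js x\<bar> \<le> real CARD('n) * C * mvnorm (Suc h) (V x)"
proof -
  have "\<bar>bdry_density f js x\<bar> \<le> (\<Sum>i\<in>UNIV. \<bar>partial i f x * V x (i # js)\<bar>)"
    unfolding bdry_density_def by (rule sum_abs)
  also have "\<dots> \<le> (\<Sum>i\<in>(UNIV :: 'n set). C * mvnorm (Suc h) (V x))"
    using assms order_trans[OF abs_ge_zero assms(2)] unfolding abs_mult
    by (intro sum_mono mult_mono component_le_mvnorm) auto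
  finally show ?thesis using \<sigma>_abs[of x] by (simp add: abs_mult mult_ac)
qed

lemma measurable_bdry_density:
  assumes "\<And>i. continuous_on UNIV (partial i f)"
  shows "(\<lambda>x. indicator \<Omega> x *\<^sub>R (\<sigma> x * bdry_density f js x)) \<in> borel_measurable M"
proof -
  have "(\<lambda>x. indicator \<Omega> x * bdry_density f js x) \<in> borel_measurable borel"
    unfolding bdry_density_def
    by (intro measurable_on_\<Omega> continuous_intros continuous_on_V continuous_on_subset[OF assms]) auto
  then have "(\<lambda>x. \<sigma> x * (indicator \<Omega> x * bdry_density f js x)) \<in> borel_measurable borel" by measurable
  then show ?thesis by (simp add: mult.left_commute measurable_cong_sets[OF sets_M refl])
qed

text \<open>The identity involves first derivatives only, so bounded approximants with converging
  values and partial derivatives suffice. The norms of v and tau', integrable because the current is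
  normal, supply the majorants.\<close>

lemma boundary_c1:
  assumes f: "c1 UNIV f" and supp: "\<forall>x. x \<notin> cbox a b \<longrightarrow> f x = 0" and ab: "cbox a b \<subseteq> \<Omega>"
    and js: "length js = h"
  shows "set_integrable M \<Omega> (\<lambda>x. \<sigma> x * bdry_density f js x)"
    and "set_integrable M' \<Omega> (\<lambda>x. f x * \<tau> x js)"
    and "real (Suc h) * (\<integral>x\<in>\<Omega>. \<sigma> x * bdry_density f js x \<partial>M) = (\<integral>x\<in>\<Omega>. f x * \<tau> x js \<partial>M')"
proof -
  obtain F C where F: "\<And>n. smooth (F n)"
    "\<And>n :: nat. compact (closure {x. F n x \<noteq> 0})" "\<And>n. closure {x. F n x \<noteq> 0} \<subseteq> \<Omega>"
    "\<And>x. (\<lambda>n. F n x) \<longlonglongrightarrow> f x" "\<And>x j. (\<lambda>n. partial j (F n) x) \<longlonglongrightarrow> partial j f x"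
    and C: "\<And>n x. \<bar>F n x\<bar> \<le> C" "\<And>n x j. \<bar>partial j (F n) x\<bar> \<le> C"
    using smooth_approximation[OF f supp open_\<Omega> ab] by metis
  have C': "\<bar>f x\<bar> \<le> C" "\<bar>partial j f x\<bar> \<le> C" for x j
    using LIMSEQ_le_const2[OF tendsto_rabs[OF F(4)]] LIMSEQ_le_const2[OF tendsto_rabs[OF F(5)]] C by blast+
  have cF: "continuous_on UNIV (partial j (F n))" "continuous_on UNIV (F n)" for j n
    using F(1)[of n, unfolded smooth_def, rule_format, of "[j]"] F(1)[of n, unfolded smooth_def, rule_format, of "[]"]
    by (auto intro: differentiable_imp_continuous_on)
  let ?w = "\<lambda>x. indicator \<Omega> x *\<^sub>R (real CARD('n) * C * mvnorm (Suc h) (V x))"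
  let ?w' = "\<lambda>x. indicator \<Omega> x *\<^sub>R (C * mvnorm h (\<tau> x))"
  have w: "integrable M ?w" "integrable M' ?w'"
    using set_integrable_mult_right[OF int_M[folded V_def], of "real CARD('n) * C"] set_integrable_mult_right[OF int_M', of C]
    unfolding set_integrable_def by simp_all
  have bound: "norm (indicator \<Omega> x *\<^sub>R (\<sigma> x * bdry_density g js x)) \<le> ?w x"
    if "\<And>j. \<bar>partial j g x\<bar> \<le> C" for g x
    using bdry_density_bound[OF js that] by (auto simp: indicator_def)
  have bound': "norm (indicator \<Omega> x *\<^sub>R (g x * \<tau> x js)) \<le> ?w' x" if "\<bar>g x\<bar> \<le> C" for g x
    using mult_mono[OF that component_le_mvnorm[OF js, of "\<tau> x"]] order_trans[OF abs_ge_zero that]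
    by (auto simp: indicator_def abs_mult)
  have meas': "(\<lambda>x. indicator \<Omega> x *\<^sub>R (g x * \<tau> x js)) \<in> borel_measurable M'" if "continuous_on UNIV g" for g
  proof -
    have [measurable]: "g \<in> borel_measurable borel" using that by (rule borel_measurable_continuous_onI)
    have [measurable]: "\<Omega> \<in> sets borel" using open_\<Omega> by simp
    have "(\<lambda>x. indicator \<Omega> x *\<^sub>R (g x * \<tau> x js)) \<in> borel_measurable borel" by measurable
    then show ?thesis by (simp only: measurable_cong_sets[OF sets_M' refl])
  qed
  have meas: "(\<lambda>x. indicator \<Omega> x *\<^sub>R (\<sigma> x * bdry_density f js x)) \<in> borel_measurable M"
    by (intro measurable_bdry_density continuous_on_partial[OF f])
  show "set_integrable M \<Omega> (\<lambda>x. \<sigma> x * bdry_density f js x)"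
    unfolding set_integrable_def
    by (rule Bochner_Integration.integrable_bound[OF w(1) meas]) (use bound C' in \<open>auto intro!: AE_I2 order_trans[OF _ abs_ge_self]\<close>)
  show "set_integrable M' \<Omega> (\<lambda>x. f x * \<tau> x js)"
    unfolding set_integrable_def
    by (rule Bochner_Integration.integrable_bound[OF w(2) meas'[OF c1_continuous_on[OF f]]])
       (use bound' C' in \<open>auto intro!: AE_I2 order_trans[OF _ abs_ge_self]\<close>)
  have "(\<lambda>n. \<integral>x. indicator \<Omega> x *\<^sub>R (\<sigma> x * bdry_density (F n) js x) \<partial>M) \<longlonglongrightarrow> (\<integral>x. indicator \<Omega> x *\<^sub>R (\<sigma> x * bdry_density f js x) \<partial>M)"
  proof (rule integral_dominated_convergence[OF meas measurable_bdry_density w(1)])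
    show "continuous_on UNIV (partial i (F n))" for i n by (rule cF)
    show "AE x in M. (\<lambda>n. indicator \<Omega> x *\<^sub>R (\<sigma> x * bdry_density (F n) js x)) \<longlonglongrightarrow> indicator \<Omega> x *\<^sub>R (\<sigma> x * bdry_density f js x)"
      unfolding bdry_density_def by (intro AE_I2 tendsto_intros F(5))
    show "AE x in M. norm (indicator \<Omega> x *\<^sub>R (\<sigma> x * bdry_density (F n) js x)) \<le> ?w x" for n
      by (intro AE_I2 bound C)
  qed
  then have "(\<lambda>n. real (Suc h) * (\<integral>x\<in>\<Omega>. \<sigma> x * bdry_density (F n) js x \<partial>M)) \<longlonglongrightarrow> real (Suc h) * (\<integral>x\<in>\<Omega>. \<sigma> x * bdry_density f js x \<partial>M)"
    unfolding set_lebesgue_integral_def by (rule tendsto_mult_left)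
  moreover have "(\<lambda>n. \<integral>x. indicator \<Omega> x *\<^sub>R (F n x * \<tau> x js) \<partial>M') \<longlonglongrightarrow> (\<integral>x. indicator \<Omega> x *\<^sub>R (f x * \<tau> x js) \<partial>M')"
  proof (rule integral_dominated_convergence[OF meas'[OF c1_continuous_on[OF f]] meas'[OF cF(2)] w(2)])
    show "AE x in M'. (\<lambda>n. indicator \<Omega> x *\<^sub>R (F n x * \<tau> x js)) \<longlonglongrightarrow> indicator \<Omega> x *\<^sub>R (f x * \<tau> x js)"
      by (intro AE_I2 tendsto_intros F(4))
    show "AE x in M'. norm (indicator \<Omega> x *\<^sub>R (F n x * \<tau> x js)) \<le> ?w' x" for n
      by (intro AE_I2 bound' C)
  qed
  ultimately show "real (Suc h) * (\<integral>x\<in>\<Omega>. \<sigma> x * bdry_density f js x \<partial>M) = (\<integral>x\<in>\<Omega>. f x * \<tau> x js \<partial>M')"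
    unfolding boundary_smooth[OF F(1-3) js] unfolding set_lebesgue_integral_def by (rule LIMSEQ_unique)
qed

text \<open>A $1$-form $\omega$ is represented by the vector field of its coefficients.\<close>

definition d_contract :: "(real^'n \<Rightarrow> real^'n) \<Rightarrow> 'n list \<Rightarrow> real^'n \<Rightarrow> real" where
  "d_contract \<omega> J x = (\<Sum>i\<in>UNIV. \<Sum>j\<in>UNIV. partial i (\<lambda>y. \<omega> y $ j) x * V x (i # j # J))"

text \<open>Swapping two indices turns the sum, up to sign, into the inner product of
  \<open>w\<close> with a slice of v, and such a slice is a combination of the v_i.\<close>

lemma annihilator_contraction:
  assumes ann: "\<And>i. i < Suc h \<Longrightarrow> w \<bullet> v i x = 0" and J: "Suc (length J) = h"
  shows "(\<Sum>j\<in>UNIV. w $ j * V x (i # j # J)) = 0"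
proof -
  have "(\<Sum>j\<in>UNIV. w $ j * V x (i # j # J)) = - (\<Sum>j\<in>UNIV. w $ j * V x (j # i # J))"
  proof -
    have "V x (i # j # J) = - V x (j # i # J)" for j
      using alternating_swap[OF alternating_V, of "j # i # J" 0 1] J by simp
    then show ?thesis by (simp add: sum_negf)
  qed
  also have "(\<Sum>j\<in>UNIV. w $ j * V x (j # i # J)) = w \<bullet> slice (V x) (i # J)"
    by (simp add: slice_def inner_vec_def)
  also have "\<dots> = 0"
  proof -
    have "length (i # J) = h" using J by simp
    have "p 0 < Suc h" if "p permutes {..<Suc h}" for p using permutes_in_image[OF that, of 0] by auto
    then show ?thesis
      unfolding V_def slice_wedge[OF \<open>length (i # J) = h\<close>] inner_sum_right inner_scaleR_right
      by (intro sum.neutral) (simp add: ann)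
  qed
  finally show ?thesis by simp
qed

text \<open>Applied to $g\,\omega$ with $\omega$ annihilating the distribution, the boundary identity loses its
  derivatives of $g$, since $\mathrm{d}g\wedge\omega$ vanishes on the tangent $k$-vector.\<close>

lemma boundary_annihilator:
  assumes \<omega>: "c1 \<Omega> \<omega>" and ann: "\<And>x i. x \<in> \<Omega> \<Longrightarrow> i < Suc h \<Longrightarrow> \<omega> x \<bullet> v i x = 0"
    and g: "c1 UNIV g" and supp: "\<forall>x. x \<notin> cbox a b \<longrightarrow> g x = 0" and ab: "cbox a b \<subseteq> \<Omega>"
    and J: "Suc (length J) = h"
  shows "real (Suc h) * (\<integral>x\<in>\<Omega>. g x * (\<sigma> x * d_contract \<omega> J x) \<partial>M) = (\<integral>x\<in>\<Omega>. g x * (\<omega> x \<bullet> slice (\<tau> x) J) \<partial>M')"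
proof -
  \<comment> \<open>The form g omega, wedged with dx_J, is the sum over j of f_j dx_j wedged with
    dx_J. The identity for C^1 functions is applied to each f_j with the tuple \<open>j # J\<close>
    and then summed.\<close>
  define f where "f j x = g x * \<omega> x $ j" for j x
  have f: "c1 UNIV (f j)" for j
    by (rule c1_extend_zero[OF open_\<Omega> closed_cbox ab])
       (use supp in \<open>auto simp: f_def[abs_def] intro!: c1_mult c1_nth \<omega> c1_subset[OF g]\<close>)
  have fs: "\<forall>x. x \<notin> cbox a b \<longrightarrow> f j x = 0" for j using supp by (simp add: f_def)
  have len: "length (j # J) = h" for j using J by simp
  note B = boundary_c1[OF f fs ab len]
  have "(\<Sum>j\<in>UNIV. \<sigma> x * bdry_density (f j) (j # J) x) = g x * (\<sigma> x * d_contract \<omega> J x)" if x: "x \<in> \<Omega>" for x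
  proof -
    have "partial i (f j) x = g x * partial i (\<lambda>y. \<omega> y $ j) x + partial i g x * \<omega> x $ j" for i j
      unfolding f_def[abs_def]
      by (rule partial_mult) (use c1_differentiable[OF g] c1_differentiable[OF c1_nth[OF \<omega>] x] in auto)
    then have "(\<Sum>j\<in>UNIV. bdry_density (f j) (j # J) x) =
       (\<Sum>j\<in>UNIV. \<Sum>i\<in>UNIV. g x * (partial i (\<lambda>y. \<omega> y $ j) x * V x (i # j # J)) + partial i g x * (\<omega> x $ j * V x (i # j # J)))"
      unfolding bdry_density_def by (intro sum.cong refl) (simp add: algebra_simps)
    also have "\<dots> = (\<Sum>i\<in>UNIV. \<Sum>j\<in>UNIV. g x * (partial i (\<lambda>y. \<omega> y $ j) x * V x (i # j # J)) + partial i g x * (\<omega> x $ j * V x (i # j # J)))"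
      by (rule sum.swap)
    also have "\<dots> = g x * d_contract \<omega> J x + (\<Sum>i\<in>UNIV. partial i g x * (\<Sum>j\<in>UNIV. \<omega> x $ j * V x (i # j # J)))"
      by (simp only: sum.distrib d_contract_def sum_distrib_left)
    also have "\<dots> = g x * d_contract \<omega> J x"
      using annihilator_contraction[OF ann[OF x] J] by simp
    finally show ?thesis by (simp only: sum_distrib_left[symmetric] mult.left_commute)
  qed
  then have "(\<integral>x\<in>\<Omega>. g x * (\<sigma> x * d_contract \<omega> J x) \<partial>M) = (\<integral>x\<in>\<Omega>. (\<Sum>j\<in>UNIV. \<sigma> x * bdry_density (f j) (j # J) x) \<partial>M)"
    unfolding set_lebesgue_integral_def by (intro Bochner_Integration.integral_cong refl) (simp add: indicator_def)
  also have "\<dots> = (\<Sum>j\<in>UNIV. \<integral>x\<in>\<Omega>. \<sigma> x * bdry_density (f j) (j # J) x \<partial>M)"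
    using B(1) unfolding set_lebesgue_integral_def set_integrable_def scaleR_sum_right
    by (intro Bochner_Integration.integral_sum) auto
  finally have "real (Suc h) * (\<integral>x\<in>\<Omega>. g x * (\<sigma> x * d_contract \<omega> J x) \<partial>M) = (\<Sum>j\<in>UNIV. \<integral>x\<in>\<Omega>. f j x * \<tau> x (j # J) \<partial>M')"
    using B(3) by (simp add: sum_distrib_left del: of_nat_Suc)
  also have "\<dots> = (\<integral>x\<in>\<Omega>. (\<Sum>j\<in>UNIV. f j x * \<tau> x (j # J)) \<partial>M')"
    using B(2) unfolding set_lebesgue_integral_def set_integrable_def scaleR_sum_right
    by (intro Bochner_Integration.integral_sum[symmetric]) auto
  also have "(\<lambda>x. \<Sum>j\<in>UNIV. f j x * \<tau> x (j # J)) = (\<lambda>x. g x * (\<omega> x \<bullet> slice (\<tau> x) J))"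
    by (simp add: f_def slice_def inner_vec_def sum_distrib_left mult.assoc)
  finally show ?thesis .
qed

end

section \<open>From test functions to measures\<close>

lemma c1_bump1_affine: "c1 UNIV (\<lambda>x :: real^'n::finite. bump1 p m (\<alpha> * x $ i + \<beta>))"
proof (rule c1I)
  fix x :: "real^'n"
  have "((\<lambda>x :: real^'n. \<alpha> * x $ i + \<beta>) has_derivative (\<lambda>h. \<alpha> * h $ i + 0)) (at x)"
    by (intro has_derivative_add has_derivative_mult_right has_derivative_const
        bounded_linear_imp_has_derivative bounded_linear_vec_nth)
  then have "((\<lambda>x :: real^'n. \<alpha> * x $ i + \<beta>) has_derivative (\<lambda>h. \<alpha> * h $ i)) (at x)" by simp
  from has_derivative_compose[OF this DERIV_bump1[unfolded has_field_derivative_def]]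
  show "((\<lambda>x :: real^'n. bump1 p m (\<alpha> * x $ i + \<beta>)) has_derivative
     (\<lambda>h. bump1 (bump1_deriv p m) (m + 2) (\<alpha> * x $ i + \<beta>) * (\<alpha> * h $ i))) (at x)" .
next
  have cont: "continuous_on UNIV (bump1 q r)" for q r
    by (rule DERIV_continuous_on[OF has_field_derivative_at_within[OF DERIV_bump1]])
  have aff: "continuous_on UNIV (\<lambda>x :: real^'n. \<alpha> * x $ i + \<beta>)" by (intro continuous_intros)
  show "continuous_on UNIV (\<lambda>x :: real^'n. bump1 (bump1_deriv p m) (m + 2) (\<alpha> * x $ i + \<beta>) * (\<alpha> * h $ i))" for h
    by (intro continuous_on_mult_right continuous_on_compose2[OF cont aff] subset_UNIV)
qed

lemma c1_positive_on_box:
  fixes a b :: "real^'n::finite"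
  obtains q :: "real^'n \<Rightarrow> real" where "c1 UNIV q" "\<And>x. x \<in> box a b \<Longrightarrow> 0 < q x" "\<And>x. x \<notin> box a b \<Longrightarrow> q x = 0"
proof (cases "box a b = {}")
  case True
  then show thesis using that[of "\<lambda>x. 0"] c1_const by auto
next
  case False
  then obtain z where "z \<in> box a b" by blast
  then have ab: "a $ i < b $ i" for i unfolding mem_box_cart using less_trans by blast
  \<comment> \<open>The map t -> alpha t + beta takes the i-th side of the box onto (-1, 1), where
    the one-dimensional bump is positive.\<close>
  define \<alpha> where "\<alpha> i = 2 / (b $ i - a $ i)" for i
  define \<beta> where "\<beta> i = - (a $ i + b $ i) / (b $ i - a $ i)" for i
  define q where "q x = (\<Prod>i\<in>UNIV. bump1 1 0 (\<alpha> i * x $ i + \<beta> i))" for x :: "real^'n"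
  have "c1 UNIV q" unfolding q_def[abs_def] by (intro c1_prod c1_bump1_affine)
  moreover have iff: "\<bar>\<alpha> i * t + \<beta> i\<bar> < 1 \<longleftrightarrow> a $ i < t \<and> t < b $ i" for i t
  proof -
    have "\<alpha> i * t + \<beta> i = (2 * t - a $ i - b $ i) / (b $ i - a $ i)"
      unfolding \<alpha>_def \<beta>_def by (simp add: diff_divide_distrib add_divide_distrib)
    moreover have "\<bar>(2 * t - a $ i - b $ i) / (b $ i - a $ i)\<bar> < 1 \<longleftrightarrow> \<bar>2 * t - a $ i - b $ i\<bar> < b $ i - a $ i"
      using ab[of i] by (simp add: abs_divide)
    ultimately show ?thesis by (auto simp: abs_less_iff)
  qed
  moreover have "0 < q x" if "x \<in> box a b" for x
    unfolding q_def using that by (intro prod_pos) (auto simp: bump1_def iff mem_box_cart)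
  moreover have "q x = 0" if x: "x \<notin> box a b" for x
  proof -
    obtain i where "\<not> (a $ i < x $ i \<and> x $ i < b $ i)" using x by (auto simp: mem_box_cart)
    then have "bump1 1 0 (\<alpha> i * x $ i + \<beta> i) = 0" unfolding bump1_def iff by simp
    then show ?thesis unfolding q_def by (intro prod_zero) auto
  qed
  ultimately show thesis using that by blast
qed

lemma c1_approx_indicator_box:
  fixes a b :: "real^'n::finite"
  obtains g :: "nat \<Rightarrow> real^'n \<Rightarrow> real" where "\<And>n. c1 UNIV (g n)" "\<And>n x. x \<notin> cbox a b \<Longrightarrow> g n x = 0"
    "\<And>n x. \<bar>g n x\<bar> \<le> 1" "\<And>x. (\<lambda>n. g n x) \<longlonglongrightarrow> indicator (box a b) x"
proof -
  obtain q :: "real^'n \<Rightarrow> real" where q: "c1 UNIV q" "\<And>x. x \<in> box a b \<Longrightarrow> 0 < q x" "\<And>x. x \<notin> box a b \<Longrightarrow> q x = 0"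
    using c1_positive_on_box by blast
  have q0: "0 \<le> q x" for x using q(2,3)[of x] by (cases "x \<in> box a b") auto
  \<comment> \<open>This is n q / (1 + n q): it lies in [0, 1), vanishes where q does and tends to 1
    where q is positive.\<close>
  define g where "g n x = 1 - inverse (1 + real n * q x)" for n x
  have pos: "1 \<le> 1 + real n * q x" for n x using q0[of x] by simp
  show thesis
  proof
    fix n x
    show "c1 UNIV (g n)" unfolding g_def[abs_def]
    proof (intro c1_diff c1_const c1_inverse c1_add c1_mult q(1))
      show "1 + real n * q x \<noteq> 0" for x using pos[of n x] by linarith
    qed
    show "g n x = 0" if "x \<notin> cbox a b"
    proof -
      have "x \<notin> box a b" using that box_subset_cbox by blast
      then show ?thesis by (simp add: g_def q(3))
    qed
    have "inverse (1 + real n * q x) \<le> 1" "0 \<le> inverse (1 + real n * q x)"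
      using pos[of n x] by (simp_all add: inverse_le_1_iff)
    then show "\<bar>g n x\<bar> \<le> 1" unfolding g_def by linarith
  next
    fix x
    show "(\<lambda>n. g n x) \<longlonglongrightarrow> indicator (box a b) x"
    proof (cases "x \<in> box a b")
      case False
      then show ?thesis by (simp add: g_def q(3))
    next
      case True
      have "filterlim (\<lambda>n. real n * q x) at_top sequentially"
        by (rule filterlim_at_top_mult_tendsto_pos[OF tendsto_const q(2)[OF True] filterlim_real_sequentially])
      then have "filterlim (\<lambda>n. 1 + real n * q x) at_top sequentially"
        by (rule filterlim_tendsto_add_at_top[OF tendsto_const])
      then have "(\<lambda>n. inverse (1 + real n * q x)) \<longlonglongrightarrow> 0" by (rule tendsto_inverse_0_at_top)
      then have "(\<lambda>n. 1 - inverse (1 + real n * q x)) \<longlonglongrightarrow> 1 - 0" by (intro tendsto_intros)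
      then show ?thesis using True by (simp add: g_def)
    qed
  qed
qed

text \<open>Open boxes are stable under intersection and generate the Borel sets, so Dynkin's
  argument applies. Equality of the total integrals closes the class under complements.\<close>

lemma set_integral_eq_of_boxes:
  fixes M M' :: "'a::euclidean_space measure" and F G :: "'a \<Rightarrow> real"
  assumes sM: "sets M = sets borel" and sM': "sets M' = sets borel"
    and F: "integrable M F" and G: "integrable M' G"
    and total: "(\<integral>x. F x \<partial>M) = (\<integral>x. G x \<partial>M')"
    and boxes: "\<And>c d. (\<integral>x\<in>box c d. F x \<partial>M) = (\<integral>x\<in>box c d. G x \<partial>M')"
    and A: "A \<in> sets borel"
  shows "(\<integral>x\<in>A. F x \<partial>M) = (\<integral>x\<in>A. G x \<partial>M')"
proof -
  have SI: "set_integrable M B F" "set_integrable M' B G" if "B \<in> sets borel" for B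
    unfolding set_integrable_def
    using integrable_mult_indicator[OF _ F, of B] integrable_mult_indicator[OF _ G, of B] that sM sM' by blast+
  let ?X = "range (\<lambda>(a, b). box a b :: 'a set)"
  have X_Pow: "?X \<subseteq> Pow UNIV" by simp
  have "Int_stable ?X"
  proof (rule Int_stableI_image)
    fix i j :: "'a \<times> 'a" 
    obtain a b c d where "i = (a, b)" "j = (c, d)" by fastforce
    then show "\<exists>k\<in>UNIV. (case i of (a, b) \<Rightarrow> box a b) \<inter> (case j of (a, b) \<Rightarrow> box a b) = (case k of (a, b) \<Rightarrow> box a b)"
      by (simp add: box_Int_box) blast
  qed
  moreover note X_Pow
  moreover have "A \<in> sigma_sets UNIV ?X" using A unfolding borel_eq_box by simp
  ultimately show ?thesis
  proof (induction rule: sigma_sets_induct_disjoint)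
    case (basic B)
    then show ?case using boxes by auto
  next
    case empty
    show ?case by (simp add: set_lebesgue_integral_def)
  next
    case (compl B)
    then have B: "B \<in> sets borel" unfolding borel_eq_box by simp
    then have "UNIV - B \<in> sets borel" by auto
    have "(\<integral>x. F x \<partial>M) = (\<integral>x\<in>B. F x \<partial>M) + (\<integral>x\<in>UNIV - B. F x \<partial>M)"
      "(\<integral>x. G x \<partial>M') = (\<integral>x\<in>B. G x \<partial>M') + (\<integral>x\<in>UNIV - B. G x \<partial>M')"
      using set_integral_Un[OF _ SI(1)[OF B] SI(1)[OF \<open>UNIV - B \<in> sets borel\<close>]]
        set_integral_Un[OF _ SI(2)[OF B] SI(2)[OF \<open>UNIV - B \<in> sets borel\<close>]]
      by (simp_all add: set_lebesgue_integral_def)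
    then show ?case using compl.IH total by simp
  next
    case (union B)
    then have B: "B i \<in> sets borel" for i unfolding borel_eq_box by auto
    then have UB: "(\<Union>i. B i) \<in> sets borel" by auto
    have "(\<integral>x\<in>(\<Union>i. B i). F x \<partial>M) = (\<Sum>i. \<integral>x\<in>B i. F x \<partial>M)"
      using B sM union.hyps(1) by (intro lebesgue_integral_countable_add SI UB) (auto simp: disjoint_family_on_def)
    also have "\<dots> = (\<Sum>i. \<integral>x\<in>B i. G x \<partial>M')" using union.IH by simp
    also have "\<dots> = (\<integral>x\<in>(\<Union>i. B i). G x \<partial>M')"
      using B sM' union.hyps(1) by (intro lebesgue_integral_countable_add[symmetric] SI UB) (auto simp: disjoint_family_on_def)
    finally show ?case .
  qed
qed

text \<open>\<open>D\<close> is the density of \<open>Ma\<close> with respect to \<open>M\<close>,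
  obtained before \<open>F\<close> and \<open>G\<close> are given, so that one function serves all
  pairs. The set \<open>N\<close> separates the two statements: on it \<open>M\<close> is null and G
  must vanish, while off it \<open>M'\<close> equals \<open>Ma\<close> = D M and densities can be
  compared.\<close>

lemma lebesgue_decomposition_densities:
  fixes M M' Ma Ms :: "'a::euclidean_space measure"
  assumes sets: "sets M = sets borel" "sets M' = sets borel" "sets Ma = sets borel" "sets Ms = sets borel"
    and fin: "finite_measure M" "finite_measure M'"
    and split: "\<And>A. A \<in> sets borel \<Longrightarrow> emeasure M' A = emeasure Ma A + emeasure Ms A"
    and ac: "absolutely_continuous M Ma"
    and N: "N \<in> sets borel" "emeasure M N = 0" "emeasure Ms (- N) = 0"
  obtains D where "AE x in Ma. 0 < D x"
    "\<And>F G :: 'a \<Rightarrow> real. integrable M F \<Longrightarrow> integrable M' G \<Longrightarrow>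
      \<forall>A\<in>sets borel. (\<integral>x\<in>A. F x \<partial>M) = (\<integral>x\<in>A. G x \<partial>M') \<Longrightarrow>
      (AE x in Ms. G x = 0) \<and> (AE x in Ma. D x * G x = F x)"
proof -
  interpret M: finite_measure M by fact
  interpret M': finite_measure M' by fact
  note [measurable_cong] = sets
  have sp: "space M = UNIV" "space M' = UNIV" "space Ma = UNIV" "space Ms = UNIV"
    using sets[THEN sets_eq_imp_space_eq] by simp_all
  have finMa: "finite_measure Ma"
  proof (rule finite_measureI)
    have "emeasure Ma UNIV \<le> emeasure M' UNIV" using split[of UNIV] by simp
    then show "emeasure Ma (space Ma) \<noteq> \<infinity>" using M'.emeasure_finite[of UNIV] sp by (auto simp: top_unique)
  qed
  obtain D where D: "D \<in> borel_measurable M" "AE x in M. RN_deriv M Ma x = ennreal (D x)"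
    "AE x in Ma. 0 < D x" "\<And>x. 0 \<le> D x"
    using M.real_RN_deriv[OF finMa ac] sets by auto
  have Ma: "Ma = density M (\<lambda>x. ennreal (D x))"
  proof -
    have "Ma = density M (RN_deriv M Ma)" using M.density_RN_deriv[OF ac] sets by simp
    also have "\<dots> = density M (\<lambda>x. ennreal (D x))"
      by (rule density_cong) (use D(1,2) in auto)
    finally show ?thesis .
  qed
  have nN: "- N \<in> sets borel" using N(1) by auto
  have MN: "AE x in M. x \<notin> N" using N(1,2) sets(1) by (intro AE_not_in) (auto simp: null_sets_def)
  have MaN: "AE x in Ma. x \<notin> N" by (rule absolutely_continuous_AE[OF _ ac MN]) (simp add: sets)
  have MsN: "AE x in Ms. x \<in> N" using AE_not_in[of "- N" Ms] nN N(3) sets(4) by (auto simp: null_sets_def)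
  \<comment> \<open>By the splitting, a set that is null for \<open>M'\<close> is null for
    \<open>Ms\<close>.\<close>
  have AE_Ms: "AE x in Ms. P x" if ae: "AE x in M'. P x" for P
  proof -
    obtain Z where Z: "{x \<in> space M'. \<not> P x} \<subseteq> Z" "emeasure M' Z = 0" "Z \<in> sets M'"
      using AE_E[OF ae] by blast
    then have "emeasure Ms Z = 0" using split[of Z] sets by auto
    then show ?thesis using Z sets sp by (intro AE_I[of _ _ Z]) auto
  qed
  \<comment> \<open>The singular part has no mass off \<open>N\<close>, so \<open>M'\<close> and
    \<open>Ma\<close> coincide there.\<close>
  have dens: "density M' (indicator (- N)) = density Ma (indicator (- N))"
  proof (rule measure_eqI)
    fix A assume "A \<in> sets (density M' (indicator (- N)))"
    then have A: "A \<in> sets borel" using sets by simp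
    have "emeasure Ms (- N \<inter> A) \<le> emeasure Ms (- N)" using nN sets by (intro emeasure_mono) auto
    then have "emeasure M' (- N \<inter> A) = emeasure Ma (- N \<inter> A)" using split[of "- N \<inter> A"] nN A N(3) by auto
    moreover have "emeasure (density M' (indicator (- N))) A = emeasure M' (- N \<inter> A)"
      "emeasure (density Ma (indicator (- N))) A = emeasure Ma (- N \<inter> A)"
      using nN A sets by (auto intro!: emeasure_restricted)
    ultimately show "emeasure (density M' (indicator (- N))) A = emeasure (density Ma (indicator (- N))) A" by simp
  qed (simp add: sets)
  show thesis
  proof (rule that[OF D(3)])
    fix F G :: "'a \<Rightarrow> real"
    assume F: "integrable M F" and G: "integrable M' G"
      and eq: "\<forall>A\<in>sets borel. (\<integral>x\<in>A. F x \<partial>M) = (\<integral>x\<in>A. G x \<partial>M')"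
    have GN: "integrable M' (\<lambda>x. indicator B x *\<^sub>R G x)" if "B \<in> sets borel" for B
      using G that sets by (intro integrable_mult_indicator) auto
    \<comment> \<open>Integrals of \<open>G\<close> over parts of \<open>N\<close> equal integrals
      of \<open>F\<close> over an \<open>M\<close>-null set, hence vanish.\<close>
    have "AE x in M'. indicator N x *\<^sub>R G x = 0"
    proof (rule M'.density_zero[OF GN[OF N(1)]])
      fix A assume "A \<in> sets M'"
      then have A: "A \<in> sets borel" using sets by simp
      have "(\<integral>x\<in>A. indicator N x *\<^sub>R G x \<partial>M') = (\<integral>x\<in>A \<inter> N. G x \<partial>M')"
        unfolding set_lebesgue_integral_def by (simp add: indicator_inter_arith mult.assoc)
      also have "\<dots> = (\<integral>x\<in>A \<inter> N. F x \<partial>M)" using eq A N(1) by auto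
      also have "\<dots> = (\<integral>x. 0 \<partial>M)"
        unfolding set_lebesgue_integral_def
        using MN F A N(1) sets by (intro integral_cong_AE) (auto simp: indicator_def elim!: eventually_mono)
      finally show "(\<integral>x\<in>A. indicator N x *\<^sub>R G x \<partial>M') = 0" by simp
    qed
    from AE_Ms[OF this] MsN have 1: "AE x in Ms. G x = 0" by eventually_elim simp
    have Gm [measurable]: "G \<in> borel_measurable borel" using G sets(2) by (auto dest!: borel_measurable_integrable simp: measurable_cong_sets[OF sets(2) refl])
    have Dm [measurable]: "D \<in> borel_measurable borel" using D(1) by (simp add: measurable_cong_sets[OF sets(1) refl])
    \<comment> \<open>Off \<open>N\<close>, integrating against \<open>M'\<close> means integrating
      against \<open>Ma\<close>, that is, against \<open>M\<close> with weight
      \<open>D\<close>.\<close>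
    have transfer: "integrable M (\<lambda>x. D x * (indicator (- N) x * g x))"
      "(\<integral>x. indicator (- N) x * g x \<partial>M') = (\<integral>x. D x * (indicator (- N) x * g x) \<partial>M)"
      if g: "integrable M' g" "g \<in> borel_measurable borel" for g :: "'a \<Rightarrow> real"
    proof -
      note [measurable] = g(2)
      have nNM: "- N \<in> sets M'" "- N \<in> sets Ma" using nN sets by auto
      have ind: "(\<lambda>x. ennreal (indicator (- N) x)) = indicator (- N)" by (auto simp: indicator_def)
      have 1: "integrable (density M' (\<lambda>x. ennreal (indicator (- N) x))) g \<longleftrightarrow> integrable M' (\<lambda>x. indicator (- N) x *\<^sub>R g x)"
        using nN by (intro integrable_density) (auto simp: sets measurable_cong_sets[OF sets(2) refl])
      have 2: "integrable (density Ma (\<lambda>x. ennreal (indicator (- N) x))) g \<longleftrightarrow> integrable Ma (\<lambda>x. indicator (- N) x *\<^sub>R g x)"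
        using nN by (intro integrable_density) (auto simp: sets measurable_cong_sets[OF sets(3) refl])
      have 3: "(\<integral>x. g x \<partial>density M' (\<lambda>x. ennreal (indicator (- N) x))) = (\<integral>x. indicator (- N) x *\<^sub>R g x \<partial>M')"
        using nN by (intro integral_density) (auto simp: sets measurable_cong_sets[OF sets(2) refl])
      have 4: "(\<integral>x. g x \<partial>density Ma (\<lambda>x. ennreal (indicator (- N) x))) = (\<integral>x. indicator (- N) x *\<^sub>R g x \<partial>Ma)"
        using nN by (intro integral_density) (auto simp: sets measurable_cong_sets[OF sets(3) refl])
      have m: "(\<lambda>x. indicator (- N) x *\<^sub>R g x) \<in> borel_measurable M" using nN by (auto simp: measurable_cong_sets[OF sets(1) refl])
      have i: "integrable M' (\<lambda>x. indicator (- N) x *\<^sub>R g x)" using g(1) nNM(1) by (rule integrable_mult_indicator[rotated])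
      have "integrable Ma (\<lambda>x. indicator (- N) x *\<^sub>R g x)" using i 1 2 unfolding ind dens by simp
      then show "integrable M (\<lambda>x. D x * (indicator (- N) x * g x))"
        using integrable_density[OF m D(1)] D(4) unfolding Ma by simp
      have "(\<integral>x. indicator (- N) x * g x \<partial>M') = (\<integral>x. indicator (- N) x *\<^sub>R g x \<partial>Ma)"
        using 3 4 unfolding ind dens by simp
      also have "\<dots> = (\<integral>x. D x *\<^sub>R (indicator (- N) x *\<^sub>R g x) \<partial>M)"
        unfolding Ma by (rule integral_density[OF m D(1)]) (simp add: D(4))
      finally show "(\<integral>x. indicator (- N) x * g x \<partial>M') = (\<integral>x. D x * (indicator (- N) x * g x) \<partial>M)" by simp
    qed
    have "AE x in M. D x * (indicator (- N) x * G x) = F x"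
    proof (rule M.density_unique_banach[OF transfer(1)[OF G Gm] F])
      fix A assume "A \<in> sets M"
      then have A: "A \<in> sets borel" using sets by simp
      have gA: "integrable M' (\<lambda>x. indicator A x * G x)" using GN[OF A] by simp
      have "(\<integral>x\<in>A. D x * (indicator (- N) x * G x) \<partial>M) = (\<integral>x. D x * (indicator (- N) x * (indicator A x * G x)) \<partial>M)"
        unfolding set_lebesgue_integral_def by (simp add: mult_ac)
      also have "\<dots> = (\<integral>x. indicator (- N) x * (indicator A x * G x) \<partial>M')"
        by (rule transfer(2)[symmetric, OF gA]) (use A in measurable)
      also have "\<dots> = (\<integral>x\<in>- N \<inter> A. G x \<partial>M')"
        unfolding set_lebesgue_integral_def by (simp add: indicator_inter_arith mult.assoc)
      also have "\<dots> = (\<integral>x\<in>- N \<inter> A. F x \<partial>M)" using eq A nN by auto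
      also have "\<dots> = (\<integral>x\<in>A. F x \<partial>M)"
        unfolding set_lebesgue_integral_def
      proof (rule integral_cong_AE)
        show "(\<lambda>x. indicator (- N \<inter> A) x *\<^sub>R F x) \<in> borel_measurable M"
          "(\<lambda>x. indicator A x *\<^sub>R F x) \<in> borel_measurable M"
          using A nN sets(1) by (intro borel_measurable_integrable integrable_mult_indicator F; auto)+
        show "AE x in M. indicator (- N \<inter> A) x *\<^sub>R F x = indicator A x *\<^sub>R F x"
          using MN by eventually_elim (simp add: indicator_def)
      qed
      finally show "(\<integral>x\<in>A. D x * (indicator (- N) x * G x) \<partial>M) = (\<integral>x\<in>A. F x \<partial>M)" .
    qed
    then have "AE x in Ma. D x * (indicator (- N) x * G x) = F x" by (rule absolutely_continuous_AE[OF _ ac, rotated]) (simp add: sets)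
    with MaN have 2: "AE x in Ma. D x * G x = F x" by eventually_elim simp
    from 1 2 show "(AE x in Ms. G x = 0) \<and> (AE x in Ma. D x * G x = F x)" ..
  qed
qed

section \<open>The identity of measures for an annihilating form\<close>

context normal_current
begin

lemma continuous_on_d_contract: "c1 \<Omega> \<omega> \<Longrightarrow> continuous_on \<Omega> (d_contract \<omega> J)"
  unfolding d_contract_def[abs_def]
  by (intro continuous_on_sum continuous_on_mult continuous_on_V continuous_on_partial c1_nth)

context
  fixes \<omega> :: "real^'n \<Rightarrow> real^'n" and J :: "'n list"
  assumes \<omega>: "c1 \<Omega> \<omega>" and ann: "\<And>x i. x \<in> \<Omega> \<Longrightarrow> i < Suc h \<Longrightarrow> \<omega> x \<bullet> v i x = 0"
    and J: "Suc (length J) = h"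
begin

text \<open>The form is controlled on Omega only, so measurability is claimed after multiplication
  by the indicator of Omega.\<close>

lemma measurable_cutoff:
  assumes [measurable]: "g \<in> borel_measurable borel"
  shows "(\<lambda>x. indicator \<Omega> x *\<^sub>R (g x * (\<sigma> x * d_contract \<omega> J x))) \<in> borel_measurable M"
    and "(\<lambda>x. indicator \<Omega> x *\<^sub>R (g x * (\<omega> x \<bullet> slice (\<tau> x) J))) \<in> borel_measurable M'"
proof -
  have [measurable]: "(\<lambda>x. indicator \<Omega> x * d_contract \<omega> J x) \<in> borel_measurable borel"
    by (intro measurable_on_\<Omega> continuous_on_d_contract \<omega>)
  have "(\<lambda>x. g x * \<sigma> x * (indicator \<Omega> x * d_contract \<omega> J x)) \<in> borel_measurable borel" by measurable
  then show "(\<lambda>x. indicator \<Omega> x *\<^sub>R (g x * (\<sigma> x * d_contract \<omega> J x))) \<in> borel_measurable M"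
    by (simp add: mult_ac measurable_cong_sets[OF sets_M refl])
  have [measurable]: "(\<lambda>x. indicator \<Omega> x * \<omega> x $ j) \<in> borel_measurable borel" for j
    by (intro measurable_on_\<Omega> c1_continuous_on c1_nth \<omega>)
  have "(\<lambda>x. g x * (\<Sum>j\<in>UNIV. (indicator \<Omega> x * \<omega> x $ j) * \<tau> x (j # J))) \<in> borel_measurable borel" by measurable
  also have "(\<lambda>x. g x * (\<Sum>j\<in>UNIV. (indicator \<Omega> x * \<omega> x $ j) * \<tau> x (j # J)))
     = (\<lambda>x. indicator \<Omega> x *\<^sub>R (g x * (\<omega> x \<bullet> slice (\<tau> x) J)))"
    by (simp add: inner_vec_def slice_def mult.assoc sum_distrib_left[symmetric] mult.left_commute)
  finally show "(\<lambda>x. indicator \<Omega> x *\<^sub>R (g x * (\<omega> x \<bullet> slice (\<tau> x) J))) \<in> borel_measurable M'"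
    by (simp only: measurable_cong_sets[OF sets_M' refl])
qed

text \<open>The majorants do not depend on \<open>g\<close>, so they serve a whole sequence of
  cut-offs and its limit. On the compact box the form and its derivatives are bounded;
  \<open>M\<close> is finite, and the norm of tau' is integrable.\<close>

lemma cutoff_bounds:
  assumes ab: "cbox a b \<subseteq> \<Omega>"
  obtains W W' where "integrable M W" "integrable M' W'"
    "\<And>(g :: real^'n \<Rightarrow> real) x. \<bar>g x\<bar> \<le> 1 \<Longrightarrow> (x \<notin> cbox a b \<longrightarrow> g x = 0) \<Longrightarrow>
       norm (indicator \<Omega> x *\<^sub>R (g x * (\<sigma> x * d_contract \<omega> J x))) \<le> W x"
    "\<And>(g :: real^'n \<Rightarrow> real) x. \<bar>g x\<bar> \<le> 1 \<Longrightarrow> (x \<notin> cbox a b \<longrightarrow> g x = 0) \<Longrightarrow>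
       norm (indicator \<Omega> x *\<^sub>R (g x * (\<omega> x \<bullet> slice (\<tau> x) J))) \<le> W' x"
proof -
  have bd: "\<exists>C\<ge>0. \<forall>x\<in>cbox a b. \<bar>f x\<bar> \<le> C" if "continuous_on \<Omega> f" for f :: "real^'n \<Rightarrow> real"
  proof -
    have "bounded (f ` cbox a b)"
      by (intro compact_imp_bounded compact_continuous_image compact_cbox continuous_on_subset[OF that ab])
    then obtain C where C: "\<forall>y\<in>f ` cbox a b. norm y \<le> C" unfolding bounded_iff by blast
    have "\<bar>f x\<bar> \<le> max C 0" if "x \<in> cbox a b" for x
    proof -
      have "norm (f x) \<le> C" using C that by blast
      then show ?thesis by simp
    qed
    then show ?thesis by (intro exI[of _ "max C 0"]) simp
  qed
  obtain C where C: "C \<ge> 0" "\<forall>x\<in>cbox a b. \<bar>d_contract \<omega> J x\<bar> \<le> C"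
    using bd[OF continuous_on_d_contract[OF \<omega>]] by blast
  obtain C' where C': "C' \<ge> 0" "\<forall>x\<in>cbox a b. \<bar>\<Sum>j\<in>UNIV. \<bar>\<omega> x $ j\<bar>\<bar> \<le> C'"
  proof -
    have "continuous_on \<Omega> (\<lambda>x. \<Sum>j\<in>UNIV. \<bar>\<omega> x $ j\<bar>)"
      by (intro continuous_on_sum continuous_on_rabs c1_continuous_on c1_nth \<omega>)
    from bd[OF this] show ?thesis using that by blast
  qed
  show thesis
  proof (rule that[of "\<lambda>x. C" "\<lambda>x. indicator \<Omega> x *\<^sub>R (C' * mvnorm h (\<tau> x))"])
    interpret finite_measure M by (rule finite_M)
    show "integrable M (\<lambda>x. C)" by simp
    show "integrable M' (\<lambda>x. indicator \<Omega> x *\<^sub>R (C' * mvnorm h (\<tau> x)))"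
      using set_integrable_mult_right[OF int_M', of C'] unfolding set_integrable_def by simp
    fix g :: "real^'n \<Rightarrow> real" and x
    assume g: "\<bar>g x\<bar> \<le> 1" "x \<notin> cbox a b \<longrightarrow> g x = 0"
    show "norm (indicator \<Omega> x *\<^sub>R (g x * (\<sigma> x * d_contract \<omega> J x))) \<le> C"
    proof (cases "x \<in> cbox a b")
      case True
      have "\<bar>g x\<bar> * \<bar>d_contract \<omega> J x\<bar> \<le> 1 * C" using g(1) C True by (intro mult_mono) auto
      then show ?thesis using C(1) \<sigma>_abs[of x] by (simp add: abs_mult indicator_def)
    next
      case False
      then show ?thesis using g C(1) by simp
    qed
    show "norm (indicator \<Omega> x *\<^sub>R (g x * (\<omega> x \<bullet> slice (\<tau> x) J))) \<le> indicator \<Omega> x *\<^sub>R (C' * mvnorm h (\<tau> x))"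
    proof (cases "x \<in> cbox a b")
      case True
      have "\<bar>\<omega> x \<bullet> slice (\<tau> x) J\<bar> \<le> (\<Sum>j\<in>UNIV. \<bar>\<omega> x $ j * \<tau> x (j # J)\<bar>)"
        by (simp add: inner_vec_def slice_def sum_abs)
      also have "\<dots> \<le> (\<Sum>j\<in>UNIV. \<bar>\<omega> x $ j\<bar> * mvnorm h (\<tau> x))"
        unfolding abs_mult using J by (intro sum_mono mult_left_mono component_le_mvnorm) auto
      also have "\<dots> = (\<Sum>j\<in>UNIV. \<bar>\<omega> x $ j\<bar>) * mvnorm h (\<tau> x)" by (simp add: sum_distrib_right)
      also have "\<dots> \<le> C' * mvnorm h (\<tau> x)"
        using C' True by (intro mult_right_mono mvnorm_nonneg) auto
      finally have "\<bar>\<omega> x \<bullet> slice (\<tau> x) J\<bar> \<le> C' * mvnorm h (\<tau> x)" .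
      then have "\<bar>g x\<bar> * \<bar>\<omega> x \<bullet> slice (\<tau> x) J\<bar> \<le> 1 * (C' * mvnorm h (\<tau> x))"
        using g(1) by (intro mult_mono) auto
      then show ?thesis by (simp add: abs_mult indicator_def)
    next
      case False
      then show ?thesis using g C'(1) mvnorm_nonneg[of h "\<tau> x"] by (simp add: indicator_def)
    qed
  qed
qed

text \<open>Limit of the identity for C^1 cut-offs that converge to the indicator of the open
  box.\<close>

lemma box_identity:
  assumes ab: "cbox a b \<subseteq> \<Omega>"
  shows "integrable M (\<lambda>x. indicator (box a b) x * (real (Suc h) * (\<sigma> x * d_contract \<omega> J x)))"
    and "integrable M' (\<lambda>x. indicator (box a b) x * (\<omega> x \<bullet> slice (\<tau> x) J))"
    and "(\<integral>x. indicator (box a b) x * (real (Suc h) * (\<sigma> x * d_contract \<omega> J x)) \<partial>M)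
       = (\<integral>x. indicator (box a b) x * (\<omega> x \<bullet> slice (\<tau> x) J) \<partial>M')"
proof -
  let ?D = "\<lambda>x. \<sigma> x * d_contract \<omega> J x" and ?s = "\<lambda>x. \<omega> x \<bullet> slice (\<tau> x) J"
  let ?i = "indicator (box a b) :: real^'n \<Rightarrow> real"
  obtain W W' where W: "integrable M W" "integrable M' W'"
    "\<And>(g :: real^'n \<Rightarrow> real) x. \<bar>g x\<bar> \<le> 1 \<Longrightarrow> (x \<notin> cbox a b \<longrightarrow> g x = 0) \<Longrightarrow>
       norm (indicator \<Omega> x *\<^sub>R (g x * ?D x)) \<le> W x"
    "\<And>(g :: real^'n \<Rightarrow> real) x. \<bar>g x\<bar> \<le> 1 \<Longrightarrow> (x \<notin> cbox a b \<longrightarrow> g x = 0) \<Longrightarrow>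
       norm (indicator \<Omega> x *\<^sub>R (g x * ?s x)) \<le> W' x"
    using cutoff_bounds[OF ab] by blast
  obtain g :: "nat \<Rightarrow> real^'n \<Rightarrow> real" where g: "\<And>n. c1 UNIV (g n)" "\<And>n x. x \<notin> cbox a b \<Longrightarrow> g n x = 0"
    "\<And>n x. \<bar>g n x\<bar> \<le> 1" "\<And>x. (\<lambda>n. g n x) \<longlonglongrightarrow> ?i x"
    using c1_approx_indicator_box by blast
  have gm: "g n \<in> borel_measurable borel" for n
    by (rule borel_measurable_continuous_onI[OF c1_continuous_on[OF g(1)]])
  have im: "?i \<in> borel_measurable borel" by simp
  have sub: "box a b \<subseteq> \<Omega>" using ab box_subset_cbox by blast
  have ind: "indicator \<Omega> x *\<^sub>R (?i x * c) = ?i x * c" for x c using sub by (auto simp: indicator_def)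
  have ib: "\<bar>?i x\<bar> \<le> 1" "x \<notin> cbox a b \<longrightarrow> ?i x = 0" for x
    using box_subset_cbox[of a b] by (auto simp: indicator_def)
  have "(\<lambda>n. \<integral>x. indicator \<Omega> x *\<^sub>R (g n x * ?D x) \<partial>M) \<longlonglongrightarrow> (\<integral>x. indicator \<Omega> x *\<^sub>R (?i x * ?D x) \<partial>M)"
    by (rule integral_dominated_convergence[OF measurable_cutoff(1)[OF im] measurable_cutoff(1)[OF gm] W(1)])
       (intro AE_I2 tendsto_intros g(4), intro AE_I2 W(3) g(3) impI g(2))
  then have "(\<lambda>n. real (Suc h) * (\<integral>x. indicator \<Omega> x *\<^sub>R (g n x * ?D x) \<partial>M)) \<longlonglongrightarrow> real (Suc h) * (\<integral>x. indicator \<Omega> x *\<^sub>R (?i x * ?D x) \<partial>M)"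
    by (rule tendsto_mult_left)
  moreover have "(\<lambda>n. \<integral>x. indicator \<Omega> x *\<^sub>R (g n x * ?s x) \<partial>M') \<longlonglongrightarrow> (\<integral>x. indicator \<Omega> x *\<^sub>R (?i x * ?s x) \<partial>M')"
    by (rule integral_dominated_convergence[OF measurable_cutoff(2)[OF im] measurable_cutoff(2)[OF gm] W(2)])
       (intro AE_I2 tendsto_intros g(4), intro AE_I2 W(4) g(3) impI g(2))
  moreover have "real (Suc h) * (\<integral>x. indicator \<Omega> x *\<^sub>R (g n x * ?D x) \<partial>M) = (\<integral>x. indicator \<Omega> x *\<^sub>R (g n x * ?s x) \<partial>M')" for n
  proof -
    have "\<forall>x. x \<notin> cbox a b \<longrightarrow> g n x = 0" using g(2) by blast
    from boundary_annihilator[OF \<omega> ann g(1) this ab J] show ?thesis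
      unfolding set_lebesgue_integral_def .
  qed
  ultimately have "real (Suc h) * (\<integral>x. indicator \<Omega> x *\<^sub>R (?i x * ?D x) \<partial>M) = (\<integral>x. indicator \<Omega> x *\<^sub>R (?i x * ?s x) \<partial>M')"
    by (simp only: LIMSEQ_unique)
  then have eq: "real (Suc h) * (\<integral>x. ?i x * ?D x \<partial>M) = (\<integral>x. ?i x * ?s x \<partial>M')" unfolding ind .
  have "integrable M (\<lambda>x. indicator \<Omega> x *\<^sub>R (?i x * ?D x))"
    by (rule Bochner_Integration.integrable_bound[OF W(1) measurable_cutoff(1)[OF im]])
       (intro AE_I2 order_trans[OF W(3)[where g = ?i, OF ib]], simp)
  then have "integrable M (\<lambda>x. real (Suc h) * (?i x * ?D x))" unfolding ind by (rule integrable_mult_right)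
  then show "integrable M (\<lambda>x. ?i x * (real (Suc h) * ?D x))" by (simp only: mult.left_commute)
  have "integrable M' (\<lambda>x. indicator \<Omega> x *\<^sub>R (?i x * ?s x))"
    by (rule Bochner_Integration.integrable_bound[OF W(2) measurable_cutoff(2)[OF im]])
       (intro AE_I2 order_trans[OF W(4)[where g = ?i, OF ib]], simp)
  then show "integrable M' (\<lambda>x. ?i x * ?s x)" unfolding ind .
  have "(\<integral>x. ?i x * (real (Suc h) * ?D x) \<partial>M) = (\<integral>x. real (Suc h) * (?i x * ?D x) \<partial>M)"
    by (simp only: mult.left_commute)
  also have "\<dots> = real (Suc h) * (\<integral>x. ?i x * ?D x \<partial>M)" by (rule integral_mult_right_zero)
  finally show "(\<integral>x. ?i x * (real (Suc h) * ?D x) \<partial>M) = (\<integral>x. ?i x * ?s x \<partial>M')" using eq by simp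
qed

lemma box_set_integral:
  assumes ab: "cbox a b \<subseteq> \<Omega>" and A: "A \<in> sets borel"
  shows "(\<integral>x\<in>A. indicator (box a b) x * (real (Suc h) * (\<sigma> x * d_contract \<omega> J x)) \<partial>M)
       = (\<integral>x\<in>A. indicator (box a b) x * (\<omega> x \<bullet> slice (\<tau> x) J) \<partial>M')"
proof (rule set_integral_eq_of_boxes[OF sets_M sets_M' box_identity[OF ab] _ A])
  fix c d :: "real^'n"
  \<comment> \<open>One pair of corners describes both intersections, so the closed box belonging to
    the open intersection still lies in Omega.\<close>
  obtain e f where ef: "box c d \<inter> box a b = box e f" "cbox c d \<inter> cbox a b = cbox e f"
    unfolding box_Int_box Int_interval by blast
  have "cbox e f \<subseteq> \<Omega>" using ab ef(2) by blast
  from box_identity(3)[OF this]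
  show "(\<integral>x\<in>box c d. indicator (box a b) x * (real (Suc h) * (\<sigma> x * d_contract \<omega> J x)) \<partial>M)
       = (\<integral>x\<in>box c d. indicator (box a b) x * (\<omega> x \<bullet> slice (\<tau> x) J) \<partial>M')"
    unfolding ef(1)[symmetric] indicator_inter_arith set_lebesgue_integral_def by (simp only: mult.assoc real_scaleR_def)
qed

end

text \<open>\<open>D\<close> precedes \<open>\<omega>\<close> and \<open>J\<close>, so the same
  function works for every form. Identities are available on boxes whose closed box lies in Omega;
  by Lindelof countably many of these cover Omega, and their null sets can be united.\<close>

lemma annihilator_AE:
  assumes sets: "sets Ma = sets borel" "sets Ms = sets borel"
    and split: "\<And>A. A \<in> sets borel \<Longrightarrow> emeasure M' A = emeasure Ma A + emeasure Ms A"
    and ac: "absolutely_continuous M Ma"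
    and N: "N \<in> sets borel" "emeasure M N = 0" "emeasure Ms (- N) = 0"
  obtains D where "AE x in Ma. 0 < D x"
    "\<And>\<omega> J. c1 \<Omega> \<omega> \<Longrightarrow> \<forall>x\<in>\<Omega>. \<forall>i<Suc h. \<omega> x \<bullet> v i x = 0 \<Longrightarrow> Suc (length J) = h \<Longrightarrow>
      (AE x in Ms. x \<in> \<Omega> \<longrightarrow> \<omega> x \<bullet> slice (\<tau> x) J = 0) \<and>
      (AE x in Ma. x \<in> \<Omega> \<longrightarrow> D x * (\<omega> x \<bullet> slice (\<tau> x) J) = real (Suc h) * (\<sigma> x * d_contract \<omega> J x))"
proof -
  obtain D where D: "AE x in Ma. 0 < D x"
    "\<And>F G :: real^'n \<Rightarrow> real. integrable M F \<Longrightarrow> integrable M' G \<Longrightarrow>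
      \<forall>A\<in>sets borel. (\<integral>x\<in>A. F x \<partial>M) = (\<integral>x\<in>A. G x \<partial>M') \<Longrightarrow>
      (AE x in Ms. G x = 0) \<and> (AE x in Ma. D x * G x = F x)"
    using lebesgue_decomposition_densities[OF sets_M sets_M' sets finite_M finite_M' split ac N] by blast
  let ?F = "{box a b | a b. cbox a b \<subseteq> \<Omega>}"
  have op: "open B" if "B \<in> ?F" for B using that open_box by blast
  obtain \<B> where \<B>: "\<B> \<subseteq> ?F" "countable \<B>" "\<Union>\<B> = \<Union>?F"
    by (rule Lindelof[of ?F]) (rule op, assumption, rule that)
  have cover: "\<exists>B\<in>\<B>. x \<in> B" if x: "x \<in> \<Omega>" for x
  proof -
    obtain a b where "x \<in> box a b" "cbox a b \<subseteq> \<Omega>" by (rule open_contains_cbox[OF open_\<Omega> x])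
    then have "x \<in> \<Union>?F" by blast
    then show ?thesis using \<B>(3) by blast
  qed
  show thesis
  proof (rule that[OF D(1)])
    fix \<omega> :: "real^'n \<Rightarrow> real^'n" and J :: "'n list"
    assume \<omega>: "c1 \<Omega> \<omega>" "\<forall>x\<in>\<Omega>. \<forall>i<Suc h. \<omega> x \<bullet> v i x = 0" and J: "Suc (length J) = h"
    have *: "(AE x in Ms. x \<in> B \<longrightarrow> \<omega> x \<bullet> slice (\<tau> x) J = 0) \<and>
      (AE x in Ma. x \<in> B \<longrightarrow> D x * (\<omega> x \<bullet> slice (\<tau> x) J) = real (Suc h) * (\<sigma> x * d_contract \<omega> J x))"
      if BB: "B \<in> \<B>" for B
    proof -
      obtain a b where B: "B = box a b" and ab: "cbox a b \<subseteq> \<Omega>" using BB \<B>(1) by blast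
      have ann: "\<omega> x \<bullet> v i x = 0" if "x \<in> \<Omega>" "i < Suc h" for x i using \<omega>(2) that by blast
      have "(AE x in Ms. indicator (box a b) x * (\<omega> x \<bullet> slice (\<tau> x) J) = 0) \<and>
        (AE x in Ma. D x * (indicator (box a b) x * (\<omega> x \<bullet> slice (\<tau> x) J)) = indicator (box a b) x * (real (Suc h) * (\<sigma> x * d_contract \<omega> J x)))"
        by (rule D(2)[OF box_identity(1)[OF \<omega>(1) _ J ab] box_identity(2)[OF \<omega>(1) _ J ab]])
           (use ann in blast, use ann in blast, intro ballI box_set_integral[OF \<omega>(1) ann J ab])
      then show ?thesis unfolding B by (auto elim!: eventually_mono simp: indicator_def)
    qed
    have "AE x in Ms. \<forall>B\<in>\<B>. x \<in> B \<longrightarrow> \<omega> x \<bullet> slice (\<tau> x) J = 0"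
      unfolding AE_ball_countable[OF \<B>(2)] using * by blast
    then have 1: "AE x in Ms. x \<in> \<Omega> \<longrightarrow> \<omega> x \<bullet> slice (\<tau> x) J = 0"
      by eventually_elim (use cover in blast)
    have "AE x in Ma. \<forall>B\<in>\<B>. x \<in> B \<longrightarrow> D x * (\<omega> x \<bullet> slice (\<tau> x) J) = real (Suc h) * (\<sigma> x * d_contract \<omega> J x)"
      unfolding AE_ball_countable[OF \<B>(2)] using * by blast
    then have 2: "AE x in Ma. x \<in> \<Omega> \<longrightarrow> D x * (\<omega> x \<bullet> slice (\<tau> x) J) = real (Suc h) * (\<sigma> x * d_contract \<omega> J x)"
      by eventually_elim (use cover in blast)
    from 1 2 show "(AE x in Ms. x \<in> \<Omega> \<longrightarrow> \<omega> x \<bullet> slice (\<tau> x) J = 0) \<and>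
      (AE x in Ma. x \<in> \<Omega> \<longrightarrow> D x * (\<omega> x \<bullet> slice (\<tau> x) J) = real (Suc h) * (\<sigma> x * d_contract \<omega> J x))" ..
  qed
qed

end

section \<open>Forms annihilating the distribution\<close>

text \<open>Gram-Schmidt without normalization: only reciprocals of nonvanishing C^1 functions
  occur, and no square roots.\<close>

lemma c1_orthogonal_frame:
  fixes v :: "nat \<Rightarrow> 'a::euclidean_space \<Rightarrow> 'b::euclidean_space"
  assumes "\<And>i. i < k \<Longrightarrow> c1 S (v i)"
    and "\<And>x. x \<in> S \<Longrightarrow> inj_on (\<lambda>i. v i x) {..<k}"
    and "\<And>x. x \<in> S \<Longrightarrow> independent ((\<lambda>i. v i x) ` {..<k})"
  shows "\<exists>e. (\<forall>i<k. c1 S (e i)) \<and> (\<forall>x\<in>S. (\<forall>i<k. e i x \<noteq> 0) \<and>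
     (\<forall>i<k. \<forall>j<k. i \<noteq> j \<longrightarrow> e i x \<bullet> e j x = 0) \<and> span ((\<lambda>i. e i x) ` {..<k}) = span ((\<lambda>i. v i x) ` {..<k}))"
  using assms
proof (induction k)
  case 0
  then show ?case by simp
next
  case (Suc k)
  have "\<exists>e. (\<forall>i<k. c1 S (e i)) \<and> (\<forall>x\<in>S. (\<forall>i<k. e i x \<noteq> 0) \<and>
     (\<forall>i<k. \<forall>j<k. i \<noteq> j \<longrightarrow> e i x \<bullet> e j x = 0) \<and> span ((\<lambda>i. e i x) ` {..<k}) = span ((\<lambda>i. v i x) ` {..<k}))"
  proof (rule Suc.IH)
    show "c1 S (v i)" if "i < k" for i using Suc.prems(1) that by simp
    show "inj_on (\<lambda>i. v i x) {..<k}" if "x \<in> S" for x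
      using Suc.prems(2)[OF that] by (rule inj_on_subset) auto
    show "independent ((\<lambda>i. v i x) ` {..<k})" if "x \<in> S" for x
      using Suc.prems(3)[OF that] by (rule independent_mono) auto
  qed
  then obtain e where E: "(\<forall>i<k. c1 S (e i)) \<and> (\<forall>x\<in>S. (\<forall>i<k. e i x \<noteq> 0) \<and>
     (\<forall>i<k. \<forall>j<k. i \<noteq> j \<longrightarrow> e i x \<bullet> e j x = 0) \<and> span ((\<lambda>i. e i x) ` {..<k}) = span ((\<lambda>i. v i x) ` {..<k}))" ..
  then have e: "\<And>i. i < k \<Longrightarrow> c1 S (e i)" "\<And>x i. x \<in> S \<Longrightarrow> i < k \<Longrightarrow> e i x \<noteq> 0"
    "\<And>x i j. x \<in> S \<Longrightarrow> i < k \<Longrightarrow> j < k \<Longrightarrow> i \<noteq> j \<Longrightarrow> e i x \<bullet> e j x = 0"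
    "\<And>x. x \<in> S \<Longrightarrow> span ((\<lambda>i. e i x) ` {..<k}) = span ((\<lambda>i. v i x) ` {..<k})"
    by simp_all
  define c where "c x = (\<Sum>j<k. ((v k x \<bullet> e j x) * inverse (e j x \<bullet> e j x)) *\<^sub>R e j x)" for x
  \<comment> \<open>The part of v_k orthogonal to the earlier frame. It does not vanish, because v_k
    lies outside the span of its predecessors.\<close>
  define u where "u x = v k x - c x" for x
  have vk: "c1 S (v k)" using Suc.prems(1) by simp
  have "c1 S c" unfolding c_def[abs_def]
    by (intro c1_sum c1_scaleR c1_mult c1_inverse c1_inner e vk) (use e(2) in auto)
  then have u: "c1 S u" unfolding u_def[abs_def] by (intro c1_diff vk)
  have cs: "c x \<in> span ((\<lambda>i. v i x) ` {..<k})" if x: "x \<in> S" for x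
    unfolding e(4)[OF x, symmetric] c_def by (intro span_sum span_mul span_base) auto
  have u0: "u x \<noteq> 0" if x: "x \<in> S" for x
  proof
    assume "u x = 0"
    then have *: "v k x \<in> span ((\<lambda>i. v i x) ` {..<k})" using cs[OF x] by (simp add: u_def)
    have "v k x \<notin> (\<lambda>i. v i x) ` {..<k}"
    proof
      assume "v k x \<in> (\<lambda>i. v i x) ` {..<k}"
      then obtain i where i: "i < k" "v k x = v i x" by auto
      then have "k = i" using inj_onD[OF Suc.prems(2)[OF x] i(2)] by simp
      then show False using i(1) by simp
    qed
    moreover have "independent (insert (v k x) ((\<lambda>i. v i x) ` {..<k}))"
      using Suc.prems(3)[OF x] by (simp add: lessThan_Suc)
    ultimately show False using * by (simp add: independent_insert)
  qed
  have ue: "u x \<bullet> e i x = 0" if x: "x \<in> S" and i: "i < k" for x i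
  proof -
    have "c x \<bullet> e i x = (\<Sum>j<k. if j = i then (v k x \<bullet> e i x) * inverse (e i x \<bullet> e i x) * (e i x \<bullet> e i x) else 0)"
      unfolding c_def inner_sum_left inner_scaleR_left
      by (intro sum.cong refl) (use e(3)[OF x _ i] in auto)
    also have "\<dots> = (v k x \<bullet> e i x) * inverse (e i x \<bullet> e i x) * (e i x \<bullet> e i x)"
      using i by simp
    also have "\<dots> = v k x \<bullet> e i x" using e(2)[OF x i] by simp
    finally show ?thesis by (simp add: u_def inner_diff_left)
  qed
  define e' where "e' i = (if i = k then u else e i)" for i
  have e'_lt: "i < k \<Longrightarrow> e' i = e i" for i by (simp add: e'_def)
  have e'k: "e' k = u" by (simp add: e'_def)
  have sp: "span ((\<lambda>i. e' i x) ` {..<Suc k}) = span ((\<lambda>i. v i x) ` {..<Suc k})" if x: "x \<in> S" for x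
  proof -
    have im: "(\<lambda>i. e' i x) ` {..<Suc k} = insert (u x) ((\<lambda>i. e i x) ` {..<k})"
      by (auto simp: lessThan_Suc e'_lt e'k)
    have iv: "(\<lambda>i. v i x) ` {..<Suc k} = insert (v k x) ((\<lambda>i. v i x) ` {..<k})"
      by (auto simp: lessThan_Suc)
    let ?V = "(\<lambda>i. v i x) ` {..<k}" and ?E = "(\<lambda>i. e i x) ` {..<k}"
    have sub: "span ?V \<subseteq> span (insert (v k x) ?V)" "span ?E \<subseteq> span (insert (u x) ?E)"
      by (intro span_mono; blast)+
    have vin: "v k x \<in> span (insert (v k x) ?V)" by (intro span_base insertI1)
    have uin': "u x \<in> span (insert (u x) ?E)" by (intro span_base insertI1)
    have uin: "u x \<in> span (insert (v k x) ?V)"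
      unfolding u_def using span_diff[OF vin] cs[OF x] sub(1) by blast
    have "c x \<in> span (insert (u x) ?E)" using cs[OF x] e(4)[OF x] sub(2) by blast
    from span_add[OF uin' this] have vin': "v k x \<in> span (insert (u x) ?E)" by (simp add: u_def)
    have "?E \<subseteq> span (insert (v k x) ?V)" using span_superset[of ?E] e(4)[OF x] sub(1) by blast
    moreover have "?V \<subseteq> span (insert (u x) ?E)" using span_superset[of ?V] e(4)[OF x] sub(2) by blast
    ultimately show ?thesis unfolding im iv using uin vin'
      by (intro equalityI span_minimal subspace_span) auto
  qed
  show ?case
  proof (intro exI[of _ e'] conjI allI ballI impI)
    fix i assume "i < Suc k"
    then show "c1 S (e' i)" using e(1) u by (cases "i = k") (auto simp: e'_def)
  next
    fix x i assume "x \<in> S" "i < Suc k"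
    then show "e' i x \<noteq> 0" using e(2) u0 by (cases "i = k") (auto simp: e'_def)
  next
    fix x i j assume x: "x \<in> S" and ij: "i < Suc k" "j < Suc k" "i \<noteq> j"
    consider "i = k" "j < k" | "j = k" "i < k" | "i < k" "j < k" using ij by linarith
    then show "e' i x \<bullet> e' j x = 0"
      by cases (use ue[OF x] e(3)[OF x] ij(3) in \<open>auto simp: e'_def inner_commute\<close>)
  next
    fix x assume "x \<in> S"
    then show "span ((\<lambda>i. e' i x) ` {..<Suc k}) = span ((\<lambda>i. v i x) ` {..<Suc k})" by (rule sp)
  qed
qed

text \<open>On \<open>S\<close>, \<open>P x\<close> is the orthogonal projection onto the complement
  of the span. As \<open>inverse 0 = 0\<close>, its formula gives a symmetric linear map at every
  point. Symmetry turns images of unit vectors into rows.\<close>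

lemma c1_orthogonal_projection:
  fixes v :: "nat \<Rightarrow> 'a::euclidean_space \<Rightarrow> 'b::euclidean_space"
  assumes "\<And>i. i < k \<Longrightarrow> c1 S (v i)"
    and "\<And>x. x \<in> S \<Longrightarrow> inj_on (\<lambda>i. v i x) {..<k}"
    and "\<And>x. x \<in> S \<Longrightarrow> independent ((\<lambda>i. v i x) ` {..<k})"
  obtains P where "\<And>y. c1 S (\<lambda>x. P x y)" "\<And>x. linear (P x)" "\<And>x y z. P x y \<bullet> z = y \<bullet> P x z"
    "\<And>x y. x \<in> S \<Longrightarrow> P x y = 0 \<longleftrightarrow> y \<in> span ((\<lambda>i. v i x) ` {..<k})"
proof -
  obtain e where "(\<forall>i<k. c1 S (e i)) \<and> (\<forall>x\<in>S. (\<forall>i<k. e i x \<noteq> 0) \<and>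
     (\<forall>i<k. \<forall>j<k. i \<noteq> j \<longrightarrow> e i x \<bullet> e j x = 0) \<and> span ((\<lambda>i. e i x) ` {..<k}) = span ((\<lambda>i. v i x) ` {..<k}))"
  proof -
    have "\<exists>e. (\<forall>i<k. c1 S (e i)) \<and> (\<forall>x\<in>S. (\<forall>i<k. e i x \<noteq> 0) \<and>
     (\<forall>i<k. \<forall>j<k. i \<noteq> j \<longrightarrow> e i x \<bullet> e j x = 0) \<and> span ((\<lambda>i. e i x) ` {..<k}) = span ((\<lambda>i. v i x) ` {..<k}))"
      by (rule c1_orthogonal_frame) (rule assms, assumption)+
    then show ?thesis by (elim exE) (rule that)
  qed
  then have e: "\<And>i. i < k \<Longrightarrow> c1 S (e i)" "\<And>x i. x \<in> S \<Longrightarrow> i < k \<Longrightarrow> e i x \<noteq> 0"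
    "\<And>x i j. x \<in> S \<Longrightarrow> i < k \<Longrightarrow> j < k \<Longrightarrow> i \<noteq> j \<Longrightarrow> e i x \<bullet> e j x = 0"
    "\<And>x. x \<in> S \<Longrightarrow> span ((\<lambda>i. e i x) ` {..<k}) = span ((\<lambda>i. v i x) ` {..<k})"
    by simp_all
  define P where "P x y = y - (\<Sum>j<k. ((y \<bullet> e j x) * inverse (e j x \<bullet> e j x)) *\<^sub>R e j x)" for x y
  have lin: "linear (P x)" for x
    by (rule linearI) (simp_all add: P_def inner_add_left distrib_right scaleR_add_left sum.distrib
        scaleR_diff_right scaleR_sum_right mult.assoc)
  show thesis
  proof (rule that[of P])
    show "c1 S (\<lambda>x. P x y)" for y unfolding P_def
      by (intro c1_diff c1_const c1_sum c1_scaleR c1_mult c1_inverse c1_inner e) (use e(2) in auto)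
    show "linear (P x)" for x by (rule lin)
    show "P x y \<bullet> z = y \<bullet> P x z" for x y z
      unfolding P_def inner_diff_left inner_diff_right inner_sum_left inner_sum_right inner_scaleR_left inner_scaleR_right
      by (simp add: inner_commute mult_ac)
    show "P x y = 0 \<longleftrightarrow> y \<in> span ((\<lambda>i. v i x) ` {..<k})" if x: "x \<in> S" for x y
    proof
      assume "P x y = 0"
      then have "y = (\<Sum>j<k. ((y \<bullet> e j x) * inverse (e j x \<bullet> e j x)) *\<^sub>R e j x)" by (simp add: P_def)
      also have "\<dots> \<in> span ((\<lambda>i. e i x) ` {..<k})" by (intro span_sum span_mul span_base) auto
      finally show "y \<in> span ((\<lambda>i. v i x) ` {..<k})" using e(4)[OF x] by simp
    next
      assume "y \<in> span ((\<lambda>i. v i x) ` {..<k})"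
      then have y: "y \<in> span ((\<lambda>i. e i x) ` {..<k})" using e(4)[OF x] by simp
      show "P x y = 0"
      proof (rule linear_eq_0_on_span[OF lin _ y])
        fix z assume "z \<in> (\<lambda>i. e i x) ` {..<k}"
        then obtain i where i: "i < k" "z = e i x" by auto
        have "(\<Sum>j<k. ((e i x \<bullet> e j x) * inverse (e j x \<bullet> e j x)) *\<^sub>R e j x)
            = (\<Sum>j<k. if j = i then e i x else 0)"
          by (intro sum.cong refl) (use e(2)[OF x i(1)] e(3)[OF x i(1)] in auto)
        then show "P x z = 0" using i by (simp add: P_def)
      qed
    qed
  qed
qed

section \<open>Brackets and sums of subspaces\<close>

lemma independent_of_dim_image:
  fixes w :: "nat \<Rightarrow> 'a::euclidean_space"
  assumes "dim (span (w ` {..<k})) = k"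
  shows "inj_on w {..<k}" "independent (w ` {..<k})"
proof -
  have d: "dim (w ` {..<k}) = k" using assms by (simp add: dim_span)
  have "k \<le> card (w ` {..<k})" using dim_le_card'[of "w ` {..<k}"] d by simp
  moreover have "card (w ` {..<k}) \<le> k" using card_image_le[of "{..<k}" w] by simp
  ultimately have c: "card (w ` {..<k}) = card {..<k}" by simp
  show "inj_on w {..<k}" by (rule eq_card_imp_inj_on[OF _ c]) simp
  show "independent (w ` {..<k})"
    by (rule card_le_dim_spanning[of _ "span (w ` {..<k})"]) (use c assms in \<open>auto intro: span_base\<close>)
qed

lemma bform_linear: "linear (\<lambda>y. bform B y z)" "linear (\<lambda>z. bform B y z)"
  unfolding bform_def
  by (intro linearI; simp add: algebra_simps sum.distrib scaleR_sum_right)+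

text \<open>Bilinearity in the values at one point reduces arbitrary fields tangent to the
  distribution to the finitely many v_i.\<close>

lemma bform_commutator_in_span:
  fixes w :: "nat \<Rightarrow> real^'n::finite"
  assumes y: "y \<in> span (w ` {..<k})" and z: "z \<in> span (w ` {..<k})"
  shows "bform B y z - bform B z y \<in> span {bform B (w a) (w b) - bform B (w b) (w a) | a b. a < k \<and> b < k}"
    (is "_ \<in> span ?X")
proof -
  have "linear (\<lambda>y. bform B y z - bform B z y)" for z by (intro linear_compose_sub bform_linear)
  moreover have "linear (\<lambda>z. bform B y z - bform B z y)" for y by (intro linear_compose_sub bform_linear)
  moreover have lin_span: "L x \<in> span ?X" if "linear L" "\<And>a. a < k \<Longrightarrow> L (w a) \<in> span ?X" "x \<in> span (w ` {..<k})"
    for L :: "real^'n \<Rightarrow> real^'n" and x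
  proof -
    have "L x \<in> span (L ` (w ` {..<k}))" using that(3) linear_span_image[OF that(1)] by blast
    also have "\<dots> \<subseteq> span ?X" using that(2) by (intro span_minimal subspace_span) auto
    finally show ?thesis .
  qed
  ultimately have L1: "linear (\<lambda>y. bform B y z - bform B z y)"
    and L2: "\<And>y. linear (\<lambda>z. bform B y z - bform B z y)" by blast+
  show ?thesis
  proof (rule lin_span[OF L1 _ y])
    fix a assume a: "a < k"
    show "bform B (w a) z - bform B z (w a) \<in> span ?X"
    proof (rule lin_span[OF L2 _ z])
      fix b assume "b < k"
      then show "bform B (w a) (w b) - bform B (w b) (w a) \<in> span ?X" using a by (intro span_base) blast
    qed
  qed
qed

text \<open>The Cartan formula \<open>d\<omega>(w, w') = - \<omega>([w, w'])\<close> for fields annihilated by all the forms \<open>\<omega> l\<close>.\<close>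

lemma lie_eq_bform:
  fixes \<omega> :: "'n::finite \<Rightarrow> real^'n \<Rightarrow> real^'n"
  assumes S: "open S" "x \<in> S" and \<omega>: "\<And>l. c1 S (\<omega> l)" and w: "c1 S w" and w': "c1 S w'"
    and ann: "\<And>l y. y \<in> S \<Longrightarrow> \<omega> l y \<bullet> w y = 0" "\<And>l y. y \<in> S \<Longrightarrow> \<omega> l y \<bullet> w' y = 0"
    and B: "\<And>i j. B i j = (\<chi> l. partial i (\<lambda>y. \<omega> l y $ j) x)"
  shows "(\<chi> l. \<omega> l x \<bullet> lie w w' x) = bform B (w x) (w' x) - bform B (w' x) (w x)"
proof -
  have D: "frechet_derivative (\<omega> l) (at x) y \<bullet> z = bform B y z $ l" for l y z
  proof -
    have "frechet_derivative (\<omega> l) (at x) y $ j = (\<Sum>i\<in>UNIV. y $ i * partial i (\<lambda>y. \<omega> l y $ j) x)" for j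
    proof -
      have "((\<lambda>y. \<omega> l y $ j) has_derivative (\<lambda>h. frechet_derivative (\<omega> l) (at x) h $ j)) (at x)"
        by (intro bounded_linear.has_derivative[OF bounded_linear_vec_nth] c1_has_derivative[OF \<omega> S(2)])
      then have "frechet_derivative (\<lambda>y. \<omega> l y $ j) (at x) = (\<lambda>h. frechet_derivative (\<omega> l) (at x) h $ j)"
        by (rule frechet_derivative_at[symmetric])
      then show ?thesis
        using frechet_eq_partials[OF c1_differentiable[OF c1_nth[OF \<omega>] S(2)], of l j y] by simp
    qed
    then have "frechet_derivative (\<omega> l) (at x) y \<bullet> z = (\<Sum>j\<in>UNIV. \<Sum>i\<in>UNIV. y $ i * z $ j * partial i (\<lambda>y. \<omega> l y $ j) x)"
      by (simp add: inner_vec_def sum_distrib_left mult_ac)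
    also have "\<dots> = (\<Sum>i\<in>UNIV. \<Sum>j\<in>UNIV. y $ i * z $ j * partial i (\<lambda>y. \<omega> l y $ j) x)" by (rule sum.swap)
    finally show ?thesis by (simp add: bform_def B)
  qed
  \<comment> \<open>Differentiating the relation omega . u = 0, valid on an open set, moves the
    derivative from the field to the form.\<close>
  have prod: "\<omega> l x \<bullet> frechet_derivative u (at x) h = - (frechet_derivative (\<omega> l) (at x) h \<bullet> u x)"
    if u: "c1 S u" "\<And>y. y \<in> S \<Longrightarrow> \<omega> l y \<bullet> u y = 0" for u l h
  proof -
    have "((\<lambda>y. \<omega> l y \<bullet> u y) has_derivative
        (\<lambda>h. \<omega> l x \<bullet> frechet_derivative u (at x) h + frechet_derivative (\<omega> l) (at x) h \<bullet> u x)) (at x)"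
      by (intro has_derivative_inner c1_has_derivative[OF \<omega> S(2)] c1_has_derivative[OF u(1) S(2)])
    moreover have "((\<lambda>y. \<omega> l y \<bullet> u y) has_derivative (\<lambda>h. 0)) (at x)"
      by (rule has_derivative_transform_within_open[OF has_derivative_const S]) (simp add: u(2))
    ultimately have "(\<lambda>h. \<omega> l x \<bullet> frechet_derivative u (at x) h + frechet_derivative (\<omega> l) (at x) h \<bullet> u x) = (\<lambda>h. 0)"
      by (rule has_derivative_unique)
    from fun_cong[OF this, of h] show ?thesis by simp
  qed
  show ?thesis
    unfolding lie_def vec_eq_iff
    using prod[OF w ann(1)] prod[OF w' ann(2)] by (simp add: inner_diff_right D)
qed

lemma span_scaled_family:
  assumes "\<And>J. J \<in> A \<Longrightarrow> f J = c *\<^sub>R g J" "c \<noteq> 0"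
  shows "span (f ` A) = span (g ` A)"
proof (intro equalityI span_minimal subspace_span subsetI)
  fix y assume "y \<in> f ` A"
  then show "y \<in> span (g ` A)" using assms(1) by (auto intro: span_mul span_base)
next
  fix y assume "y \<in> g ` A"
  then obtain J where J: "J \<in> A" "y = g J" by blast
  then have "y = inverse c *\<^sub>R f J" using assms by simp
  then show "y \<in> span (f ` A)" using J(1) by (auto intro: span_mul span_base)
qed

text \<open>Vectors with equal image differ by an element of the kernel, which the summand
  \<open>V\<close> absorbs. The two orders of summation are those of statement (ii) and of
  \<open>Vhat\<close>.\<close>

lemma subspace_sum_eq_of_projection:
  assumes P: "linear P" and ker: "\<And>y. P y = 0 \<longleftrightarrow> y \<in> V" and V: "subspace V" and eq: "P ` S = P ` T"
  shows "{a + b | a b. a \<in> S \<and> b \<in> V} = {a + b | a b. a \<in> V \<and> b \<in> T}"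
proof -
  have shift: "\<exists>t\<in>T'. s - t \<in> V" if "P ` S' \<subseteq> P ` T'" "s \<in> S'" for S' T' s
  proof -
    obtain t where "t \<in> T'" "P s = P t" using \<open>P ` S' \<subseteq> P ` T'\<close> \<open>s \<in> S'\<close> by blast
    then show ?thesis using ker[of "s - t"] by (auto simp: linear_diff[OF P])
  qed
  show ?thesis
  proof (intro equalityI subsetI)
    fix y assume "y \<in> {a + b | a b. a \<in> S \<and> b \<in> V}"
    then obtain a b where ab: "y = a + b" "a \<in> S" "b \<in> V" by blast
    then obtain t where "t \<in> T" "a - t \<in> V" using shift[of S T a] eq by blast
    moreover have "y = ((a - t) + b) + t" using ab by simp
    ultimately show "y \<in> {a + b | a b. a \<in> V \<and> b \<in> T}" using subspace_add[OF V _ ab(3)] by blast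
  next
    fix y assume "y \<in> {a + b | a b. a \<in> V \<and> b \<in> T}"
    then obtain a b where ab: "y = a + b" "a \<in> V" "b \<in> T" by blast
    then obtain t where "t \<in> S" "b - t \<in> V" using shift[of T S b] eq by blast
    moreover have "y = t + (a + (b - t))" using ab by simp
    ultimately show "y \<in> {a + b | a b. a \<in> S \<and> b \<in> V}" using subspace_add[OF V ab(2)] by blast
  qed
qed

theorem theorem3p3:
  fixes k :: nat and \<Omega> :: "(real^'n) set"
    and v :: "nat \<Rightarrow> real^'n \<Rightarrow> real^'n"
    and M :: "(real^'n) measure" and \<sigma> :: "real^'n \<Rightarrow> real"
    and M' :: "(real^'n) measure" and \<tau>' :: "real^'n \<Rightarrow> 'n mvec"
    and Ma Ms :: "(real^'n) measure"
  assumes "2 \<le> k" "k < CARD('n)" "open \<Omega>"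
    and v_C1: "\<forall>i<k. C1_on \<Omega> (v i)"
    and v_indep: "\<forall>x\<in>\<Omega>. dim (span ((\<lambda>i. v i x) ` {..<k})) = k"
    \<comment> \<open>mu = sigma |mu|, a finite signed measure on Omega, M = |mu|\<close>
    and "sets M = sets borel" "finite_measure M" "emeasure M (- \<Omega>) = 0"
    and "\<sigma> \<in> borel_measurable borel" "\<forall>x. \<sigma> x = 1 \<or> \<sigma> x = -1"
    \<comment> \<open>mu' finite positive measure on Omega, tau' a (k-1)-vectorfield\<close>
    and "sets M' = sets borel" "finite_measure M'" "emeasure M' (- \<Omega>) = 0"
    and "\<forall>x. alternating (k - 1) (\<tau>' x)"
    and "\<forall>is. (\<lambda>x. \<tau>' x is) \<in> borel_measurable borel"
    \<comment> \<open>T = v mu is normal\<close>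
    and "set_integrable M \<Omega> (\<lambda>x. mvnorm k (wedge k (\<lambda>i. v i x)))"
    and "set_integrable M' \<Omega> (\<lambda>x. mvnorm (k - 1) (\<tau>' x))"
    \<comment> \<open>boundary of T equals tau' mu'\<close>
    and bdry: "\<forall>\<phi>. test_form \<Omega> (k - 1) \<phi> \<longrightarrow>
         (\<integral>x\<in>\<Omega>. \<sigma> x * pair k (dform k \<phi> x) (wedge k (\<lambda>i. v i x)) \<partial>M)
       = (\<integral>x\<in>\<Omega>. pair (k - 1) (\<phi> x) (\<tau>' x) \<partial>M')"
    \<comment> \<open>Lebesgue decomposition of mu' with respect to |mu|\<close>
    and "sets Ma = sets borel" "sets Ms = sets borel"
    and "\<forall>A\<in>sets borel. emeasure M' A = emeasure Ma A + emeasure Ms A"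
    and "absolutely_continuous M Ma"
    and "\<exists>N\<in>sets borel. emeasure M N = 0 \<and> emeasure Ms (- N) = 0"
  shows "(AE x in Ms. x \<in> \<Omega> \<longrightarrow>
            mvspan (k - 1) (\<tau>' x) \<subseteq> span ((\<lambda>i. v i x) ` {..<k}))
       \<and> (AE x in Ma. x \<in> \<Omega> \<longrightarrow>
            {a + b | a b. a \<in> mvspan (k - 1) (\<tau>' x) \<and> b \<in> span ((\<lambda>i. v i x) ` {..<k})}
            = Vhat \<Omega> (\<lambda>y. span ((\<lambda>i. v i y) ` {..<k})) x)"
proof -
  \<comment> \<open>Slices of the (k-1)-vector tau' and double contractions of the k-vector v are
    both indexed by tuples of length m = k - 2.\<close>
  obtain m where k: "k = Suc (Suc m)" using \<open>2 \<le> k\<close> by (metis add_2_eq_Suc le_Suc_ex)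
  have k1: "k - 1 = Suc m" by (simp add: k)
  have v: "c1 \<Omega> (v i)" if "i < k" for i using v_C1 that by (simp add: C1_on_iff_c1)
  interpret normal_current "Suc m" \<Omega> v M \<sigma> M' \<tau>'
  proof (rule normal_current.intro)
    show "open \<Omega>" by fact
    show "c1 \<Omega> (v i)" if "i < Suc (Suc m)" for i using v that by (simp add: k)
    show "sets M = sets borel" "finite_measure M" "\<sigma> \<in> borel_measurable borel"
      "sets M' = sets borel" "finite_measure M'" by fact+
    show "\<bar>\<sigma> x\<bar> = 1" for x using \<open>\<forall>x. \<sigma> x = 1 \<or> \<sigma> x = -1\<close>[rule_format, of x] by auto
    show "alternating (Suc m) (\<tau>' x)" for x 
      using \<open>\<forall>x. alternating (k - 1) (\<tau>' x)\<close> unfolding k1 by (rule spec)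
    show "(\<lambda>x. \<tau>' x is) \<in> borel_measurable borel" for "is" using \<open>\<forall>is. (\<lambda>x. \<tau>' x is) \<in> borel_measurable borel\<close> by blast
    show "set_integrable M \<Omega> (\<lambda>x. mvnorm (Suc (Suc m)) (wedge (Suc (Suc m)) (\<lambda>i. v i x)))"
      using \<open>set_integrable M \<Omega> (\<lambda>x. mvnorm k (wedge k (\<lambda>i. v i x)))\<close> unfolding k .
    show "set_integrable M' \<Omega> (\<lambda>x. mvnorm (Suc m) (\<tau>' x))"
      using \<open>set_integrable M' \<Omega> (\<lambda>x. mvnorm (k - 1) (\<tau>' x))\<close> unfolding k1 .
    show "(\<integral>x\<in>\<Omega>. \<sigma> x * pair (Suc (Suc m)) (dform (Suc (Suc m)) \<phi> x) (wedge (Suc (Suc m)) (\<lambda>i. v i x)) \<partial>M)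
       = (\<integral>x\<in>\<Omega>. pair (Suc m) (\<phi> x) (\<tau>' x) \<partial>M')" if "test_form \<Omega> (Suc m) \<phi>" for \<phi>
      using bdry[unfolded k1, unfolded k] that by blast
  qed
  have mvspan: "mvspan (k - 1) (\<tau>' x) = span (slice (\<tau>' x) ` {J. length J = m})" for x
    unfolding k1 mvspan_eq_span_slices[OF \<tau>_alt] by (rule arg_cong[where f = span]) blast
  have inj: "inj_on (\<lambda>i. v i x) {..<k}" and ind: "independent ((\<lambda>i. v i x) ` {..<k})" if "x \<in> \<Omega>" for x
    using independent_of_dim_image[of "\<lambda>i. v i x" k] v_indep that by blast+
  let ?V = "\<lambda>x. span ((\<lambda>i. v i x) ` {..<k})"
  have "\<exists>P. (\<forall>y. c1 \<Omega> (\<lambda>x. P x y)) \<and> (\<forall>x. linear (P x)) \<and> (\<forall>x y z. P x y \<bullet> z = y \<bullet> P x z) \<and>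
      (\<forall>x y. x \<in> \<Omega> \<longrightarrow> (P x y = 0 \<longleftrightarrow> y \<in> ?V x))"
    by (rule c1_orthogonal_projection[of k \<Omega> v]) (rule v inj ind; assumption | blast)+
  then obtain P where P: "(\<forall>y. c1 \<Omega> (\<lambda>x. P x y)) \<and> (\<forall>x. linear (P x)) \<and> (\<forall>x y z. P x y \<bullet> z = y \<bullet> P x z) \<and>
      (\<forall>x y. x \<in> \<Omega> \<longrightarrow> (P x y = 0 \<longleftrightarrow> y \<in> ?V x))" ..
  then have P_c1: "c1 \<Omega> (\<lambda>x. P x y)" and lin: "linear (P x)" and sym: "P x y \<bullet> z = y \<bullet> P x z"
    and ker: "x \<in> \<Omega> \<Longrightarrow> P x y = 0 \<longleftrightarrow> y \<in> ?V x" for x y z by blast+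
  \<comment> \<open>The l-th row of the projection: pairing with it gives the l-th coordinate of
    \<open>P x\<close>, so it annihilates the distribution.\<close>
  define \<omega> where "\<omega> l x = P x (axis l 1)" for l x
  have \<omega>_c1: "c1 \<Omega> (\<omega> l)" for l unfolding \<omega>_def[abs_def] by (rule P_c1)
  have \<omega>_inner: "\<omega> l x \<bullet> y = P x y $ l" for l x y
    unfolding \<omega>_def sym by (simp add: inner_axis')
  have \<omega>_ann: "\<omega> l x \<bullet> y = 0" if "x \<in> \<Omega>" "y \<in> ?V x" for l x y
    unfolding \<omega>_inner using ker[OF that(1), of y] that(2) by simp
  have \<omega>_v: "\<forall>x\<in>\<Omega>. \<forall>i<Suc (Suc m). \<omega> l x \<bullet> v i x = 0" for l
    by (intro ballI allI impI \<omega>_ann span_base) (simp_all add: k)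
  obtain N where N: "N \<in> sets borel" "emeasure M N = 0" "emeasure Ms (- N) = 0"
    using \<open>\<exists>N\<in>sets borel. emeasure M N = 0 \<and> emeasure Ms (- N) = 0\<close> by blast
  have split: "emeasure M' A = emeasure Ma A + emeasure Ms A" if "A \<in> sets borel" for A
    using \<open>\<forall>A\<in>sets borel. emeasure M' A = emeasure Ma A + emeasure Ms A\<close> that by blast
  obtain D where D: "AE x in Ma. 0 < D x"
    "\<And>\<omega> J. c1 \<Omega> \<omega> \<Longrightarrow> \<forall>x\<in>\<Omega>. \<forall>i<Suc (Suc m). \<omega> x \<bullet> v i x = 0 \<Longrightarrow> Suc (length J) = Suc m \<Longrightarrow>
      (AE x in Ms. x \<in> \<Omega> \<longrightarrow> \<omega> x \<bullet> slice (\<tau>' x) J = 0) \<and>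
      (AE x in Ma. x \<in> \<Omega> \<longrightarrow> D x * (\<omega> x \<bullet> slice (\<tau>' x) J) = real (Suc (Suc m)) * (\<sigma> x * d_contract \<omega> J x))"
    by (rule annihilator_AE[OF \<open>sets Ma = sets borel\<close> \<open>sets Ms = sets borel\<close> split \<open>absolutely_continuous M Ma\<close> N])
      (assumption, rule that)
  \<comment> \<open>Finitely many pairs of a row and a tuple, so that one null set serves all of
    them.\<close>
  let ?I = "(UNIV :: 'n set) \<times> {J :: 'n list. length J = m}"
  have I: "countable ?I" by (intro countable_finite finite_cartesian_product) simp_all
  have "AE x in Ms. \<forall>p\<in>?I. x \<in> \<Omega> \<longrightarrow> \<omega> (fst p) x \<bullet> slice (\<tau>' x) (snd p) = 0"
    unfolding AE_ball_countable[OF I] using D(2)[OF \<omega>_c1 \<omega>_v] by auto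
  then have "AE x in Ms. x \<in> \<Omega> \<longrightarrow> mvspan (k - 1) (\<tau>' x) \<subseteq> ?V x"
  proof eventually_elim
    case (elim x)
    show ?case
    proof
      assume x: "x \<in> \<Omega>"
      have "P x (slice (\<tau>' x) J) = 0" if "length J = m" for J
        using elim x that by (auto simp: \<omega>_inner vec_eq_iff)
      then show "mvspan (k - 1) (\<tau>' x) \<subseteq> ?V x"
        unfolding mvspan using ker[OF x] by (intro span_minimal subspace_span) auto
    qed
  qed
  moreover have "AE x in Ma. \<forall>p\<in>?I. x \<in> \<Omega> \<longrightarrow> D x * (\<omega> (fst p) x \<bullet> slice (\<tau>' x) (snd p))
      = real (Suc (Suc m)) * (\<sigma> x * d_contract (\<omega> (fst p)) (snd p) x)"
    unfolding AE_ball_countable[OF I] using D(2)[OF \<omega>_c1 \<omega>_v] by auto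
  with D(1) have "AE x in Ma. x \<in> \<Omega> \<longrightarrow>
    {a + b | a b. a \<in> mvspan (k - 1) (\<tau>' x) \<and> b \<in> ?V x} = Vhat \<Omega> ?V x"
  proof eventually_elim
    case (elim x)
    show ?case
    proof
      assume x: "x \<in> \<Omega>"
      define B where "B i j = (\<chi> l. partial i (\<lambda>y. \<omega> l y $ j) x)" for i j
      define L where "L = {lie w w' x | w w'. C1_on \<Omega> w \<and> C1_on \<Omega> w' \<and> (\<forall>y\<in>\<Omega>. w y \<in> ?V y \<and> w' y \<in> ?V y)}"
      \<comment> \<open>The factor between a projected slice and the contraction of v, common to all
        coordinates and all \<open>J\<close>. It is nonzero since sigma has modulus 1 and
        \<open>D x\<close> is positive.\<close>
      define c where "c = real (Suc (Suc m)) * \<sigma> x / D x"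
      let ?S = "slice (\<tau>' x) ` {J. length J = m}"
      let ?\<beta> = "\<lambda>y z. bform B y z - bform B z y"
      let ?X = "{?\<beta> (v a x) (v b x) | a b. a < k \<and> b < k}"
      have c: "c \<noteq> 0" unfolding c_def using elim(1) \<sigma>_abs[of x] by auto
      have P_slice: "P x (slice (\<tau>' x) J) = c *\<^sub>R contract B (V x) J" if J: "length J = m" for J
      proof (subst vec_eq_iff, intro allI)
        fix l
        have "D x * (\<omega> l x \<bullet> slice (\<tau>' x) J) = real (Suc (Suc m)) * (\<sigma> x * d_contract (\<omega> l) J x)"
          using elim(2) x J by auto
        moreover have "d_contract (\<omega> l) J x = contract B (V x) J $ l"
          by (simp add: d_contract_def contract_def B_def mult.commute)
        ultimately have "D x * P x (slice (\<tau>' x) J) $ l = real (Suc (Suc m)) * \<sigma> x * contract B (V x) J $ l"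
          by (simp only: \<omega>_inner mult.assoc)
        then show "P x (slice (\<tau>' x) J) $ l = (c *\<^sub>R contract B (V x) J) $ l"
          unfolding c_def using elim(1) by (simp add: nonzero_eq_divide_eq mult.commute)
      qed
      have "P x ` span ?S = span (P x ` ?S)" by (rule linear_span_image[OF lin, symmetric])
      also have "P x ` ?S = (\<lambda>J. P x (slice (\<tau>' x) J)) ` {J. length J = m}" by (simp only: image_image)
      also have "span \<dots> = span (contract B (V x) ` {J. length J = m})"
        by (rule span_scaled_family[OF _ c]) (simp only: P_slice mem_Collect_eq)
      also have "contract B (V x) ` {J. length J = m} = {contract B (wedge (Suc (Suc m)) (\<lambda>i. v i x)) J | J. length J = m}"
        unfolding V_def by blast
      also have "span \<dots> = span ?X"
        unfolding k by (rule span_contract_wedge[OF inj[OF x, unfolded k] ind[OF x, unfolded k]])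
      finally have PS: "P x ` span ?S = span ?X" .
      have P_lie: "P x (lie w w' x) = ?\<beta> (w x) (w' x)"
        if w: "c1 \<Omega> w" "c1 \<Omega> w'" and wV: "\<And>y. y \<in> \<Omega> \<Longrightarrow> w y \<in> ?V y" "\<And>y. y \<in> \<Omega> \<Longrightarrow> w' y \<in> ?V y" for w w'
      proof -
        have "P x (lie w w' x) = (\<chi> l. \<omega> l x \<bullet> lie w w' x)" by (simp add: \<omega>_inner vec_eq_iff)
        also have "\<dots> = ?\<beta> (w x) (w' x)"
          by (rule lie_eq_bform[OF \<open>open \<Omega>\<close> x \<omega>_c1 w]) (simp_all only: \<omega>_ann wV B_def)
        finally show ?thesis .
      qed
      have "P x ` span L = span (P x ` L)" by (rule linear_span_image[OF lin, symmetric])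
      \<comment> \<open>One inclusion holds because the projected bracket depends only on the values
        of the fields at \<open>x\<close>; for the other, the v_i are themselves admissible
        fields.\<close>
      also have "\<dots> = span ?X"
      proof (intro equalityI span_minimal subspace_span subsetI)
        fix y assume "y \<in> P x ` L"
        then obtain w w' where y: "y = P x (lie w w' x)" and w: "C1_on \<Omega> w" "C1_on \<Omega> w'"
          and wV: "\<forall>y\<in>\<Omega>. w y \<in> ?V y \<and> w' y \<in> ?V y" unfolding L_def by blast
        have "y = ?\<beta> (w x) (w' x)"
          unfolding y by (rule P_lie) (use w wV in \<open>auto simp only: C1_on_iff_c1\<close>)
        also have "\<dots> \<in> span ?X"
          by (rule bform_commutator_in_span) (use wV x in blast)+
        finally show "y \<in> span ?X" .
      next
        fix y assume "y \<in> ?X"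
        then obtain a b where ab: "a < k" "b < k" and y: "y = ?\<beta> (v a x) (v b x)" by blast
        have vV: "v i z \<in> ?V z" if "i < k" for i z using that by (intro span_base) blast
        have "y = P x (lie (v a) (v b) x)" unfolding y by (rule P_lie[symmetric]) (use v ab vV in blast)+
        moreover have "lie (v a) (v b) x \<in> L"
          unfolding L_def using v[OF ab(1)] v[OF ab(2)] vV[OF ab(1)] vV[OF ab(2)] unfolding C1_on_iff_c1 by blast
        ultimately show "y \<in> span (P x ` L)" by (intro span_base) blast
      qed
      finally have "P x ` span ?S = P x ` span L" using PS by simp
      from subspace_sum_eq_of_projection[OF lin ker[OF x] subspace_span this]
      show "{a + b | a b. a \<in> mvspan (k - 1) (\<tau>' x) \<and> b \<in> ?V x} = Vhat \<Omega> ?V x"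
        unfolding mvspan Vhat_def L_def .
    qed
  qed
  ultimately show ?thesis by (rule conjI)
qed

end
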